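(* Let $X$ be a Banach function space on $\mathbb{R}$ such that the Schwartz space $S(\mathbb{R})$ is continuously embedded in $X$ and dense in $X$. Assume that no non-trivial distribution $h\in X^*$ has spectrum on $\mathbb{Z}$, i.e. if $h\in X^*$ and $h=\hat H$ with $\operatorname{supp} H\subset\mathbb{Z}$, then $h=0$. Then there exists $\varphi\in S(\mathbb{R})$ such that for every set $\Lambda\subset\mathbb{R}$ of the form $\Lambda=\{n+a_n : n\in\mathbb{Z}\}$, where $a_n\in\mathbb{R}$, $a_n\neq0$ for all $n\in\mathbb{Z}$, and $|a_n|<Cr^{|n|}$ for all $n\in\mathbb{Z}$ with some constants $C>0$ and $0<r<1$ (which may depend on $\Lambda$), the set of translates $\{\varphi(t-\lambda) : \lambda\in\Lambda\}$ spans $X$.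
   Context: Functions are complex-valued. Since $S(\mathbb{R})$ is continuously embedded and dense in $X$, each element of the dual space $X^*$ is identified with the tempered distribution obtained by restricting it to $S(\mathbb{R})$. The Fourier transform is $\hat\Phi(x)=\int_{\mathbb{R}}e^{-2\pi i tx}\Phi(t)\,dt$, extended to tempered distributions in the usual way. A tempered distribution $h=\hat H$ has spectrum on $\mathbb{Z}$ if the support of its inverse Fourier transform $H$ is contained in $\mathbb{Z}$. A family of elements spans a Banach space if its finite linear combinations with complex coefficients are dense in the space. *)

theory Defs
  imports "HOL-Analysis.Analysis"
begin

section \<open>The Schwartz space\<close>

definition nth_deriv :: "nat \<Rightarrow> (real \<Rightarrow> complex) \<Rightarrow> real \<Rightarrow> complex" where
  "nth_deriv k f = ((\<lambda>g x. vector_derivative g (at x)) ^^ k) f"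

definition schwartz_space :: "(real \<Rightarrow> complex) set" where
  "schwartz_space =
     {f. (\<forall>k x. nth_deriv k f differentiable (at x)) \<and>
         (\<forall>m k. bounded (range (\<lambda>x. x ^ m *\<^sub>R nth_deriv k f x)))}"

text \<open>The supremum is taken in the reals, so it is meaningful on \<open>schwartz_space\<close> only.\<close>
definition schwartz_seminorm :: "nat \<Rightarrow> nat \<Rightarrow> (real \<Rightarrow> complex) \<Rightarrow> real" where
  "schwartz_seminorm m k f = (SUP x. norm (x ^ m *\<^sub>R nth_deriv k f x))"

definition schwartz_topology :: "(real \<Rightarrow> complex) topology" where
  "schwartz_topology = topology_generated_by
     {{g \<in> schwartz_space. schwartz_seminorm m k (\<lambda>x. g x - f x) < e} | m k f e.
        f \<in> schwartz_space \<and> 0 < e}"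

section \<open>Tempered distributions\<close>

definition complex_linear_on ::
    "(real \<Rightarrow> complex) set \<Rightarrow> ((real \<Rightarrow> complex) \<Rightarrow> complex) \<Rightarrow> bool" where
  "complex_linear_on V T \<longleftrightarrow>
     (\<forall>f\<in>V. \<forall>g\<in>V. T (\<lambda>x. f x + g x) = T f + T g) \<and>
     (\<forall>c. \<forall>f\<in>V. T (\<lambda>x. c * f x) = c * T f)"

text \<open>Functionals are total functions in HOL; the values of a tempered distribution outside
  \<open>schwartz_space\<close> are irrelevant. In particular, a functional on a larger space is
  restricted to \<open>schwartz_space\<close> without changing the underlying term.\<close>
definition tempered_distribution :: "((real \<Rightarrow> complex) \<Rightarrow> complex) \<Rightarrow> bool" where
  "tempered_distribution T \<longleftrightarrow>
     complex_linear_on schwartz_space T \<and> continuous_map schwartz_topology euclidean T"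

definition fourier :: "(real \<Rightarrow> complex) \<Rightarrow> real \<Rightarrow> complex" where
  "fourier f x = (LINT t|lborel. exp (- 2 * of_real pi * \<i> * of_real t * of_real x) * f t)"

text \<open>The transpose of \<open>fourier\<close> under the bilinear pairing (the integral of \<open>h x * f x\<close>),
  so it extends the transform of functions, without complex conjugation.\<close>
definition fourier_distr ::
    "((real \<Rightarrow> complex) \<Rightarrow> complex) \<Rightarrow> (real \<Rightarrow> complex) \<Rightarrow> complex" where
  "fourier_distr T f = T (fourier f)"

definition vanishes_on :: "((real \<Rightarrow> complex) \<Rightarrow> complex) \<Rightarrow> real set \<Rightarrow> bool" where
  "vanishes_on T U \<longleftrightarrow>
     (\<forall>f\<in>schwartz_space. compact (closure {x. f x \<noteq> 0}) \<and> closure {x. f x \<noteq> 0} \<subseteq> U \<longrightarrow> T f = 0)"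

definition distr_support :: "((real \<Rightarrow> complex) \<Rightarrow> complex) \<Rightarrow> real set" where
  "distr_support T = - \<Union>{U. open U \<and> vanishes_on T U}"

definition spectrum_on :: "((real \<Rightarrow> complex) \<Rightarrow> complex) \<Rightarrow> real set \<Rightarrow> bool" where
  "spectrum_on h A \<longleftrightarrow>
     (\<exists>H. tempered_distribution H \<and>
          (\<forall>f\<in>schwartz_space. h f = fourier_distr H f) \<and> distr_support H \<subseteq> A)"

section \<open>Banach function spaces on the real line\<close>

text \<open>Elements of the space are represented by functions, and \<open>f\<close>, \<open>g\<close> represent the same
  element iff \<open>N (f - g) = 0\<close>; the norm of the space is thus a seminorm on representatives.
  This covers spaces of functions modulo equality almost everywhere (such as \<open>L\<^sup>p\<close>) as well as
  spaces of functions defined pointwise (such as \<open>C\<^sub>0\<close>). No lattice property, translation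
  invariance or measurability is required.\<close>
locale banach_function_space =
  fixes X :: "(real \<Rightarrow> complex) set" and N :: "(real \<Rightarrow> complex) \<Rightarrow> real"
  assumes zero_mem: "(\<lambda>x. 0) \<in> X"
    and add_mem: "f \<in> X \<Longrightarrow> g \<in> X \<Longrightarrow> (\<lambda>x. f x + g x) \<in> X"
    and scale_mem: "f \<in> X \<Longrightarrow> (\<lambda>x. c * f x) \<in> X"
    and norm_nonneg: "f \<in> X \<Longrightarrow> 0 \<le> N f"
    and norm_triangle: "f \<in> X \<Longrightarrow> g \<in> X \<Longrightarrow> N (\<lambda>x. f x + g x) \<le> N f + N g"
    and norm_scale: "f \<in> X \<Longrightarrow> N (\<lambda>x. c * f x) = cmod c * N f"
    and complete: "(\<And>n. u n \<in> X) \<Longrightarrow>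
        (\<And>e. 0 < e \<Longrightarrow> \<exists>K. \<forall>m\<ge>K. \<forall>n\<ge>K. N (\<lambda>x. u m x - u n x) < e) \<Longrightarrow>
        \<exists>f\<in>X. (\<lambda>n. N (\<lambda>x. u n x - f x)) \<longlonglongrightarrow> 0"

definition norm_topology ::
    "(real \<Rightarrow> complex) set \<Rightarrow> ((real \<Rightarrow> complex) \<Rightarrow> real) \<Rightarrow> (real \<Rightarrow> complex) topology" where
  "norm_topology X N = topology_generated_by
     {{g \<in> X. N (\<lambda>x. g x - f x) < e} | f e. f \<in> X \<and> 0 < e}"

definition dual_space ::
    "(real \<Rightarrow> complex) set \<Rightarrow> ((real \<Rightarrow> complex) \<Rightarrow> real) \<Rightarrow> ((real \<Rightarrow> complex) \<Rightarrow> complex) set" where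
  "dual_space X N = {h. complex_linear_on X h \<and> continuous_map (norm_topology X N) euclidean h}"

definition dense_in_space ::
    "(real \<Rightarrow> complex) set \<Rightarrow> ((real \<Rightarrow> complex) \<Rightarrow> real) \<Rightarrow> (real \<Rightarrow> complex) set \<Rightarrow> bool" where
  "dense_in_space X N D \<longleftrightarrow> D \<subseteq> X \<and> norm_topology X N closure_of D = X"

text \<open>The second conjunct is injectivity of the embedding, given the identification of
  functions at distance zero.\<close>
definition schwartz_continuously_embedded ::
    "(real \<Rightarrow> complex) set \<Rightarrow> ((real \<Rightarrow> complex) \<Rightarrow> real) \<Rightarrow> bool" where
  "schwartz_continuously_embedded X N \<longleftrightarrow>
     schwartz_space \<subseteq> X \<and>
     (\<forall>f\<in>schwartz_space. N f = 0 \<longrightarrow> f = (\<lambda>x. 0)) \<and>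
     continuous_map schwartz_topology (norm_topology X N) (\<lambda>f. f)"

definition linear_combinations :: "(real \<Rightarrow> complex) set \<Rightarrow> (real \<Rightarrow> complex) set" where
  "linear_combinations G = {\<lambda>t. \<Sum>g\<in>F. c g * g t | F c. finite F \<and> F \<subseteq> G}"

definition spans_space ::
    "(real \<Rightarrow> complex) set \<Rightarrow> ((real \<Rightarrow> complex) \<Rightarrow> real) \<Rightarrow> (real \<Rightarrow> complex) set \<Rightarrow> bool" where
  "spans_space X N G \<longleftrightarrow> dense_in_space X N (linear_combinations G)"

definition exp_small_perturbation :: "real set \<Rightarrow> bool" where
  "exp_small_perturbation \<Lambda> \<longleftrightarrow>
     (\<exists>a :: int \<Rightarrow> real. \<exists>C r :: real.
        (\<forall>n. a n \<noteq> 0) \<and> 0 < C \<and> 0 < r \<and> r < 1 \<and>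
        (\<forall>n. \<bar>a n\<bar> < C * r ^ nat \<bar>n\<bar>) \<and>
        \<Lambda> = {of_int n + a n | n. True})"

end

(* Let psi be a Gaussian times a function vanishing to infinite order exactly on the integers, and
   let phi be its inverse Fourier transform. If h in the dual of X annihilates the translates
   phi(t - l), l = n + a_n, and h is the Fourier transform of T, then F(s) = T(exp(2 pi i s x) psi)
   is an entire function vanishing at the points n + a_n, up to sign. Hence F(n) decays
   exponentially in |n|, so the periodization of psi T is real analytic; being flat at the integers
   together with psi, it is zero, i.e. F(n) = 0. As a_n is not 0, Taylor expansion at n now makes
   F'(n) exponentially small, so F'(n) = 0 in the same way, and inductively all derivatives of F
   vanish at the integers. Therefore F = 0, psi T = 0 and T is supported on the integers, so h = 0
   by hypothesis. The Hahn-Banach theorem concludes.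

   The periodization is handled by sequences only: psi / (1 - exp(2 pi i x))^k is again a Schwartz
   function, so the sequence F(n) has iterated antidifferences of all orders with one common
   polynomial growth rate, and an exponentially decaying sequence with this property is zero. *)
theory Submission
  imports Defs "HOL-Probability.Probability" "HOL-Complex_Analysis.Complex_Analysis"
begin

section \<open>Smooth functions\<close>

text \<open>\<open>T\<close> is only a distribution, so the periodization of psi T cannot be said to
  be flat by looking at values near the integers. Division expresses it instead: the quotients of
  psi by powers of \<open>1 - wave 1\<close> are Schwartz functions, and as \<open>T\<close> has a
  finite order \<open>M\<close>, all their coefficient sequences grow at most like |n|^M. The common
  exponent is decisive. If the first antidifference tended to a nonzero limit, the k-th one would
  grow like n^(k-1); hence the limit is zero, every antidifference inherits the exponential decay
  with a constant geometric in k, and the Laurent series of the sequence has a zero of infinite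
  order at 1. The numbers \<open>a n\<close> may be arbitrarily close to zero. In the Taylor step
  the remainder of order J + 1 is divided by |a n|^J, and the one factor |a n| that is left supplies
  the decay. The Gaussian factor lets psi be multiplied by functions of exponential growth. Taylor
  remainders of waves are estimated with such weights, uniformly in their order.\<close>

definition smooth :: "(real \<Rightarrow> complex) \<Rightarrow> bool" where
  "smooth f \<longleftrightarrow> (\<forall>k x. nth_deriv k f differentiable (at x))"

lemma nth_deriv_0 [simp]: "nth_deriv 0 f = f"
  by (simp add: nth_deriv_def)

lemma nth_deriv_Suc: "nth_deriv (Suc k) f x = vector_derivative (nth_deriv k f) (at x)"
  by (simp add: nth_deriv_def)

lemma nth_deriv_Suc': "nth_deriv (Suc k) f = nth_deriv k (nth_deriv 1 f)"
  unfolding nth_deriv_def by (subst funpow_Suc_right) simp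

lemma smooth_has_deriv:
  "smooth f \<Longrightarrow> (nth_deriv k f has_vector_derivative nth_deriv (Suc k) f x) (at x)"
  unfolding nth_deriv_Suc smooth_def by (simp flip: vector_derivative_works)

text \<open>\<open>vector_derivative\<close> is a choice, so a formula for \<open>nth_deriv\<close>
  is proved by exhibiting the whole sequence \<open>D\<close> of successive derivatives;
  \<open>smooth_nth_deriv_sequence\<close> gives smoothness from the same data.\<close>

lemma nth_deriv_unique:
  assumes "\<And>k x. (D k has_vector_derivative D (Suc k) x) (at x)"
  shows "nth_deriv k (D 0) = D k"
proof (induction k)
  case (Suc k)
  show ?case
    by (rule ext) (simp add: nth_deriv_Suc Suc vector_derivative_at[OF assms])
qed simp

lemma smooth_nth_deriv_sequence:
  assumes "\<And>k x. (D k has_vector_derivative D (Suc k) x) (at x)"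
  shows "smooth (D 0)"
  unfolding smooth_def nth_deriv_unique[of D, OF assms]
  using assms differentiableI_vector by blast

text \<open>For functions whose higher derivatives have no manageable closed form: a class closed
  under differentiation contains all of them. It serves for products, for the flat functions and for
  quotients by them.\<close>

lemma nth_deriv_closed_set:
  assumes "f \<in> K" "\<And>f. f \<in> K \<Longrightarrow> \<exists>f'\<in>K. \<forall>x. (f has_vector_derivative f' x) (at x)"
  shows "smooth f \<and> nth_deriv k f \<in> K"
proof -
  obtain d where d: "\<And>f. f \<in> K \<Longrightarrow> d f \<in> K \<and> (\<forall>x. (f has_vector_derivative d f x) (at x))"
    using assms(2) by metis
  define D where "D k = (d ^^ k) f" for k
  have K: "D k \<in> K" for k
    by (induction k) (use assms(1) d in \<open>auto simp: D_def\<close>)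
  have der: "(D k has_vector_derivative D (Suc k) x) (at x)" for k x
    using d[OF K[of k]] by (simp add: D_def)
  have "D 0 = f" by (simp add: D_def)
  with K nth_deriv_unique[of D, OF der] smooth_nth_deriv_sequence[of D, OF der]
  show ?thesis by auto
qed

lemma smooth_nth_deriv: "smooth f \<Longrightarrow> smooth (nth_deriv j f)"
  using nth_deriv_closed_set[of "nth_deriv j f" "range (\<lambda>j. nth_deriv j f)" 0]
    smooth_has_deriv[of f] by blast

lemma nth_deriv_nth_deriv: "nth_deriv k (nth_deriv j f) = nth_deriv (k + j) f"
  by (simp add: nth_deriv_def funpow_add)

lemma nth_deriv_eqI:
  "(\<And>x. (f has_vector_derivative f' x) (at x)) \<Longrightarrow> nth_deriv 1 f = f'"
  by (rule ext) (simp add: nth_deriv_Suc vector_derivative_at)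

lemma smooth_continuous: "smooth f \<Longrightarrow> continuous_on S f"
  using smooth_has_deriv[of f 0]
  by (metis continuous_at_imp_continuous_on has_vector_derivative_continuous nth_deriv_0)

lemma smooth_borel [measurable_dest]: "smooth f \<Longrightarrow> f \<in> borel_measurable borel"
  by (intro borel_measurable_continuous_onI smooth_continuous)

lemma nth_deriv_add:
  assumes "smooth f" "smooth g"
  shows "smooth (\<lambda>x. f x + g x)" "nth_deriv k (\<lambda>x. f x + g x) = (\<lambda>x. nth_deriv k f x + nth_deriv k g x)"
proof -
  have "((\<lambda>x. nth_deriv k f x + nth_deriv k g x) has_vector_derivative
      nth_deriv (Suc k) f x + nth_deriv (Suc k) g x) (at x)" for k x
    using assms by (intro has_vector_derivative_add smooth_has_deriv)
  note nth_deriv_unique[of "\<lambda>k x. nth_deriv k f x + nth_deriv k g x", OF this]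
    smooth_nth_deriv_sequence[of "\<lambda>k x. nth_deriv k f x + nth_deriv k g x", OF this]
  then show "smooth (\<lambda>x. f x + g x)" "nth_deriv k (\<lambda>x. f x + g x) = (\<lambda>x. nth_deriv k f x + nth_deriv k g x)"
    by auto
qed

lemma nth_deriv_cmult:
  assumes "smooth f"
  shows "smooth (\<lambda>x. c * f x)" "nth_deriv k (\<lambda>x. c * f x) = (\<lambda>x. c * nth_deriv k f x)"
proof -
  have "((\<lambda>x. c * nth_deriv k f x) has_vector_derivative c * nth_deriv (Suc k) f x) (at x)" for k x
    using assms by (intro has_vector_derivative_mult_right smooth_has_deriv)
  note nth_deriv_unique[of "\<lambda>k x. c * nth_deriv k f x", OF this]
    smooth_nth_deriv_sequence[of "\<lambda>k x. c * nth_deriv k f x", OF this]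
  then show "smooth (\<lambda>x. c * f x)" "nth_deriv k (\<lambda>x. c * f x) = (\<lambda>x. c * nth_deriv k f x)"
    by auto
qed

lemma nth_deriv_diff:
  assumes "smooth f" "smooth g"
  shows "smooth (\<lambda>x. f x - g x)" "nth_deriv k (\<lambda>x. f x - g x) = (\<lambda>x. nth_deriv k f x - nth_deriv k g x)"
  using nth_deriv_add[OF assms(1) nth_deriv_cmult(1)[OF assms(2), of "-1"]]
    nth_deriv_cmult(2)[OF assms(2), of _ "-1"] by simp_all

lemma nth_deriv_zero [simp]: "nth_deriv k (\<lambda>x. 0) = (\<lambda>x. 0)" "smooth (\<lambda>x. 0)"
proof -
  have "((\<lambda>x::real. 0::complex) has_vector_derivative 0) (at x)" for x by simp
  from nth_deriv_unique[of "\<lambda>_ _. 0", OF this] smooth_nth_deriv_sequence[of "\<lambda>_ _. 0", OF this]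
  show "nth_deriv k (\<lambda>x. 0) = (\<lambda>x. 0)" "smooth (\<lambda>x. 0)" by auto
qed

text \<open>Closed under differentiation by the product rule, so products are smooth without an
  explicit Leibniz formula.\<close>

inductive_set product_sums :: "(real \<Rightarrow> complex) set" where
  prod: "smooth f \<Longrightarrow> smooth g \<Longrightarrow> (\<lambda>x. f x * g x) \<in> product_sums"
| add: "f \<in> product_sums \<Longrightarrow> g \<in> product_sums \<Longrightarrow> (\<lambda>x. f x + g x) \<in> product_sums"

lemma product_has_deriv:
  assumes "smooth f" "smooth g"
  shows "((\<lambda>x. f x * g x) has_vector_derivative (f x * nth_deriv 1 g x + nth_deriv 1 f x * g x)) (at x)"
  using has_vector_derivative_mult[OF smooth_has_deriv[OF assms(1), of 0] smooth_has_deriv[OF assms(2), of 0]]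
  by simp

lemma smooth_mult:
  assumes "smooth f" "smooth g"
  shows "smooth (\<lambda>x. f x * g x)"
proof -
  have "\<exists>h'\<in>product_sums. \<forall>x. (h has_vector_derivative h' x) (at x)" if "h \<in> product_sums" for h
    using that
  proof induction
    case (prod f g)
    show ?case
      by (rule bexI[of _ "\<lambda>x. f x * nth_deriv 1 g x + nth_deriv 1 f x * g x"])
        (use prod in \<open>auto intro!: product_has_deriv product_sums.intros smooth_nth_deriv simp del: One_nat_def\<close>)
  next
    case (add f g)
    then obtain f' g' where "f' \<in> product_sums" "g' \<in> product_sums"
      "\<forall>x. (f has_vector_derivative f' x) (at x)" "\<forall>x. (g has_vector_derivative g' x) (at x)"
      by blast
    then show ?case
      by (intro bexI[of _ "\<lambda>x. f' x + g' x"]) (auto intro!: derivative_intros product_sums.add)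
  qed
  then show ?thesis
    using nth_deriv_closed_set[of "\<lambda>x. f x * g x" product_sums 0] product_sums.prod[OF assms] by blast
qed

text \<open>A crude Leibniz estimate: 2^k is the sum of the binomial coefficients. One derivative is
  moved onto the factors by the product rule, and both resulting products satisfy the hypotheses for
  the smaller order.\<close>

lemma nth_deriv_mult_bound:
  assumes "smooth f" "smooth g"
    and "\<And>j. j \<le> k \<Longrightarrow> norm (nth_deriv j f x) \<le> a" "\<And>j. j \<le> k \<Longrightarrow> norm (nth_deriv j g x) \<le> b"
  shows "norm (nth_deriv k (\<lambda>x. f x * g x) x) \<le> 2 ^ k * a * b"
  using assms
proof (induction k arbitrary: f g)
  case 0
  then have "norm (f x) \<le> a" "norm (g x) \<le> b" by fastforce+
  then have "norm (f x) * norm (g x) \<le> a * b"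
    by (intro mult_mono) (auto intro: order_trans[OF norm_ge_zero])
  then show ?case by (simp add: norm_mult)
next
  case (Suc k)
  have eq: "nth_deriv (Suc k) (\<lambda>x. f x * g x)
      = nth_deriv k (\<lambda>x. f x * nth_deriv 1 g x + nth_deriv 1 f x * g x)"
    unfolding nth_deriv_Suc'[of k "\<lambda>x. f x * g x"]
    by (subst nth_deriv_eqI[OF product_has_deriv]) (use Suc in auto)
  have "norm (nth_deriv k (\<lambda>x. f x * nth_deriv 1 g x) x) \<le> 2 ^ k * a * b"
    by (rule Suc.IH) (use Suc.prems in \<open>auto intro: smooth_nth_deriv simp: nth_deriv_nth_deriv simp del: One_nat_def\<close>)
  moreover have "norm (nth_deriv k (\<lambda>x. nth_deriv 1 f x * g x) x) \<le> 2 ^ k * a * b"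
    by (rule Suc.IH) (use Suc.prems in \<open>auto intro: smooth_nth_deriv simp: nth_deriv_nth_deriv simp del: One_nat_def\<close>)
  ultimately show ?case
    unfolding eq
    by (subst nth_deriv_add(2)) (use Suc.prems in \<open>auto intro!: smooth_mult smooth_nth_deriv norm_triangle_le simp del: One_nat_def\<close>)
qed

section \<open>The Schwartz space and its topology\<close>

lemma schwartz_space_iff:
  "f \<in> schwartz_space \<longleftrightarrow> smooth f \<and> (\<forall>m k. \<exists>B. \<forall>x. \<bar>x\<bar> ^ m * norm (nth_deriv k f x) \<le> B)"
  by (auto simp: schwartz_space_def smooth_def bounded_iff norm_mult power_abs)

lemma schwartzD: "f \<in> schwartz_space \<Longrightarrow> smooth f"
  "f \<in> schwartz_space \<Longrightarrow> \<exists>B. \<forall>x. \<bar>x\<bar> ^ m * norm (nth_deriv k f x) \<le> B"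
  by (auto simp: schwartz_space_iff)

lemma schwartz_add:
  assumes "f \<in> schwartz_space" "g \<in> schwartz_space"
  shows "(\<lambda>x. f x + g x) \<in> schwartz_space"
  unfolding schwartz_space_iff
proof (intro conjI allI)
  show "smooth (\<lambda>x. f x + g x)" using assms by (simp add: schwartzD nth_deriv_add)
  fix m k
  obtain A B where AB: "\<And>x. \<bar>x\<bar> ^ m * norm (nth_deriv k f x) \<le> A" "\<And>x. \<bar>x\<bar> ^ m * norm (nth_deriv k g x) \<le> B"
    using schwartzD(2)[OF assms(1)] schwartzD(2)[OF assms(2)] by metis
  have "\<bar>x\<bar> ^ m * norm (nth_deriv k f x + nth_deriv k g x) \<le> A + B" for x
  proof -
    have "\<bar>x\<bar> ^ m * norm (nth_deriv k f x + nth_deriv k g x)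
        \<le> \<bar>x\<bar> ^ m * (norm (nth_deriv k f x) + norm (nth_deriv k g x))"
      by (intro mult_left_mono norm_triangle_ineq) simp
    with AB[of x] show ?thesis by (simp add: distrib_left)
  qed
  then show "\<exists>B. \<forall>x. \<bar>x\<bar> ^ m * norm (nth_deriv k (\<lambda>x. f x + g x) x) \<le> B"
    using assms by (auto simp: schwartzD nth_deriv_add)
qed

lemma schwartz_cmult:
  assumes "f \<in> schwartz_space"
  shows "(\<lambda>x. c * f x) \<in> schwartz_space"
  unfolding schwartz_space_iff
proof (intro conjI allI)
  show "smooth (\<lambda>x. c * f x)" using assms by (simp add: schwartzD nth_deriv_cmult)
  fix m k
  obtain A where A: "\<And>x. \<bar>x\<bar> ^ m * norm (nth_deriv k f x) \<le> A"
    using schwartzD(2)[OF assms(1)] by metis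
  have "\<bar>x\<bar> ^ m * norm (c * nth_deriv k f x) \<le> norm c * A" for x
    using mult_left_mono[OF A[of x], of "norm c"] by (simp add: norm_mult mult_ac)
  then show "\<exists>B. \<forall>x. \<bar>x\<bar> ^ m * norm (nth_deriv k (\<lambda>x. c * f x) x) \<le> B"
    using assms by (auto simp: schwartzD nth_deriv_cmult)
qed

lemma schwartz_diff:
  assumes "f \<in> schwartz_space" "g \<in> schwartz_space"
  shows "(\<lambda>x. f x - g x) \<in> schwartz_space"
  using schwartz_add[OF assms(1) schwartz_cmult[OF assms(2), of "-1"]] by simp

lemma zero_schwartz [simp]: "(\<lambda>x. 0) \<in> schwartz_space"
  by (auto simp: schwartz_space_iff)

lemma schwartz_nth_deriv: "f \<in> schwartz_space \<Longrightarrow> nth_deriv j f \<in> schwartz_space"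
  by (auto simp: schwartz_space_iff smooth_nth_deriv nth_deriv_nth_deriv)

lemma schwartz_bdd:
  assumes "f \<in> schwartz_space"
  shows "bdd_above (range (\<lambda>x. norm (x ^ m *\<^sub>R nth_deriv k f x)))"
proof -
  obtain B where "\<And>x. \<bar>x\<bar> ^ m * norm (nth_deriv k f x) \<le> B" using schwartzD(2)[OF assms] by metis
  then show ?thesis by (intro bdd_aboveI2[of _ _ B]) (simp add: power_abs)
qed

lemma le_schwartz_seminorm:
  assumes "f \<in> schwartz_space"
  shows "\<bar>x\<bar> ^ m * norm (nth_deriv k f x) \<le> schwartz_seminorm m k f"
  unfolding schwartz_seminorm_def
  using cSUP_upper[OF UNIV_I schwartz_bdd[OF assms, of m k], of x] by (simp add: power_abs)

lemma schwartz_seminorm_le: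
  assumes "\<And>x. \<bar>x\<bar> ^ m * norm (nth_deriv k f x) \<le> B"
  shows "schwartz_seminorm m k f \<le> B"
  unfolding schwartz_seminorm_def using assms by (intro cSUP_least) (auto simp: power_abs)

lemma schwartz_seminorm_triangle:
  assumes "f \<in> schwartz_space" "g \<in> schwartz_space" "h \<in> schwartz_space"
  shows "schwartz_seminorm m k (\<lambda>x. f x - h x)
    \<le> schwartz_seminorm m k (\<lambda>x. f x - g x) + schwartz_seminorm m k (\<lambda>x. g x - h x)"
proof (rule schwartz_seminorm_le)
  fix x
  note s = assms[THEN schwartzD(1)]
  have "\<bar>x\<bar> ^ m * norm (nth_deriv k (\<lambda>x. f x - h x) x)
     \<le> \<bar>x\<bar> ^ m * (norm (nth_deriv k (\<lambda>x. f x - g x) x) + norm (nth_deriv k (\<lambda>x. g x - h x) x))"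
    by (intro mult_left_mono) (use s norm_diff_triangle_ineq[of "nth_deriv k f x" "nth_deriv k g x" "nth_deriv k g x" "nth_deriv k h x"] in \<open>simp_all add: nth_deriv_diff\<close>)
  also have "\<dots> \<le> schwartz_seminorm m k (\<lambda>x. f x - g x) + schwartz_seminorm m k (\<lambda>x. g x - h x)"
    unfolding distrib_left by (intro add_mono le_schwartz_seminorm schwartz_diff assms)
  finally show "\<bar>x\<bar> ^ m * norm (nth_deriv k (\<lambda>x. f x - h x) x) \<le> \<dots>" .
qed

text \<open>The generating sets are balls of single seminorms about arbitrary centres; the triangle
  inequality recentres them and yields the usual neighbourhoods by finitely many seminorms. One
  statement serves the Schwartz topology and the norm topology, the latter with \<open>unit\<close>
  as index type.\<close>

lemma openin_seminorm_topology:
  fixes P :: "'i \<Rightarrow> (real \<Rightarrow> complex) \<Rightarrow> real" and V :: "(real \<Rightarrow> complex) set"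
  assumes tri: "\<And>i f g h. f \<in> V \<Longrightarrow> g \<in> V \<Longrightarrow> h \<in> V \<Longrightarrow>
      P i (\<lambda>x. f x - h x) \<le> P i (\<lambda>x. f x - g x) + P i (\<lambda>x. g x - h x)"
    and zero: "\<And>i. P i (\<lambda>x. 0) = 0"
  shows "openin (topology_generated_by {{g\<in>V. P i (\<lambda>x. g x - f x) < e} | i f e. f \<in> V \<and> 0 < e}) U \<longleftrightarrow>
     U \<subseteq> V \<and> (\<forall>f\<in>U. \<exists>J e. finite J \<and> 0 < e \<and> {g\<in>V. \<forall>i\<in>J. P i (\<lambda>x. g x - f x) < e} \<subseteq> U)"
    (is "openin (topology_generated_by ?S) U \<longleftrightarrow> ?R U")
proof
  assume "openin (topology_generated_by ?S) U"
  then have "generate_topology_on ?S U" by (simp add: openin_topology_generated_by_iff)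
  then show "?R U"
  proof induction
    case Empty
    show ?case by simp
  next
    case (Int a b)
    show ?case
    proof (intro conjI ballI)
      show "a \<inter> b \<subseteq> V" using Int by auto
      fix f assume f: "f \<in> a \<inter> b"
      from f Int obtain J e where J: "finite J" "0 < e" "{g\<in>V. \<forall>i\<in>J. P i (\<lambda>x. g x - f x) < e} \<subseteq> a" by blast
      from f Int obtain J' e' where J': "finite J'" "0 < e'" "{g\<in>V. \<forall>i\<in>J'. P i (\<lambda>x. g x - f x) < e'} \<subseteq> b" by blast
      show "\<exists>J e. finite J \<and> 0 < e \<and> {g\<in>V. \<forall>i\<in>J. P i (\<lambda>x. g x - f x) < e} \<subseteq> a \<inter> b"
        by (rule exI[of _ "J \<union> J'"], rule exI[of _ "min e e'"]) (use J J' in auto)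
    qed
  next
    case (UN K)
    show ?case
    proof (intro conjI ballI)
      show "\<Union>K \<subseteq> V" using UN by auto
      fix f assume "f \<in> \<Union>K"
      then obtain k where k: "k \<in> K" "f \<in> k" by auto
      have "\<exists>J e. finite J \<and> 0 < e \<and> {g\<in>V. \<forall>i\<in>J. P i (\<lambda>x. g x - f x) < e} \<subseteq> k"
        using UN.IH[OF k(1)] k(2) by (elim conjE) (erule (1) bspec)
      then obtain J e where "finite J" "0 < e" "{g\<in>V. \<forall>i\<in>J. P i (\<lambda>x. g x - f x) < e} \<subseteq> k"
        by (elim exE conjE) (rule that)
      moreover have "k \<subseteq> \<Union>K" using k by blast
      ultimately show "\<exists>J e. finite J \<and> 0 < e \<and> {g\<in>V. \<forall>i\<in>J. P i (\<lambda>x. g x - f x) < e} \<subseteq> \<Union>K"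
        by (intro exI conjI) (assumption, assumption, rule order_trans)
    qed
  next
    case (Basis s)
    then obtain i f e where s: "s = {g\<in>V. P i (\<lambda>x. g x - f x) < e}" "f \<in> V" "0 < e"
      by (elim CollectE exE conjE) (rule that)
    show ?case
    proof (intro conjI ballI)
      show "s \<subseteq> V" using s by auto
      fix g assume g: "g \<in> s"
      show "\<exists>J e. finite J \<and> 0 < e \<and> {h\<in>V. \<forall>i\<in>J. P i (\<lambda>x. h x - g x) < e} \<subseteq> s"
      proof (intro exI conjI subsetI)
        show "finite {i}" by simp
        show "0 < e - P i (\<lambda>x. g x - f x)" using g s by simp
        fix h assume h: "h \<in> {h\<in>V. \<forall>j\<in>{i}. P j (\<lambda>x. h x - g x) < e - P i (\<lambda>x. g x - f x)}"
        have "P i (\<lambda>x. h x - f x) \<le> P i (\<lambda>x. h x - g x) + P i (\<lambda>x. g x - f x)"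
          by (rule tri) (use g h s in auto)
        also have "\<dots> < e" using h by simp
        finally show "h \<in> s" using h s by auto
      qed
    qed
  qed
next
  assume R: "?R U"
  have ball: "openin (topology_generated_by ?S) {g\<in>V. P i (\<lambda>x. g x - f x) < e}" if "f \<in> V" "0 < e" for i f e
    by (rule topology_generated_by_Basis) (use that in blast)
  show "openin (topology_generated_by ?S) U"
  proof (subst openin_subopen, intro ballI)
    fix f assume f: "f \<in> U"
    with R have fV: "f \<in> V" by blast
    from f R obtain J e where J: "finite J" "0 < e" "{g\<in>V. \<forall>i\<in>J. P i (\<lambda>x. g x - f x) < e} \<subseteq> U" by blast
    fix i0 :: 'i
    \<comment> \<open>The additional index makes the index set nonempty, so that a finite
      intersection of open sets is formed even when \<open>J\<close> is empty; a further ball only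
      shrinks \<open>T\<close>.\<close>
    define T where "T = (\<Inter>i\<in>insert undefined J. {g\<in>V. P i (\<lambda>x. g x - f x) < e})"
    have "openin (topology_generated_by ?S) T"
      unfolding T_def by (intro openin_INT2 ball fV J) (use J in auto)
    moreover have "f \<in> T" using fV J by (auto simp: T_def zero)
    moreover have "T \<subseteq> U" using J(3) by (auto simp: T_def)
    ultimately show "\<exists>T. openin (topology_generated_by ?S) T \<and> f \<in> T \<and> T \<subseteq> U" by blast
  qed
qed

lemma openin_schwartz:
  "openin schwartz_topology U \<longleftrightarrow> U \<subseteq> schwartz_space \<and>
     (\<forall>f\<in>U. \<exists>J e. finite J \<and> 0 < e \<and>
        {g\<in>schwartz_space. \<forall>(m, k)\<in>J. schwartz_seminorm m k (\<lambda>x. g x - f x) < e} \<subseteq> U)"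
proof -
  have "schwartz_topology = topology_generated_by
      {{g\<in>schwartz_space. (\<lambda>(m, k). schwartz_seminorm m k) i (\<lambda>x. g x - f x) < e} | i f e. f \<in> schwartz_space \<and> 0 < e}"
    unfolding schwartz_topology_def by (rule arg_cong[of _ _ topology_generated_by]) force
  also have "openin \<dots> U \<longleftrightarrow> U \<subseteq> schwartz_space \<and>
     (\<forall>f\<in>U. \<exists>J e. finite J \<and> 0 < e \<and>
        {g\<in>schwartz_space. \<forall>i\<in>J. (\<lambda>(m, k). schwartz_seminorm m k) i (\<lambda>x. g x - f x) < e} \<subseteq> U)"
    by (rule openin_seminorm_topology)
      (auto intro: schwartz_seminorm_triangle, auto simp: schwartz_seminorm_def)
  finally show ?thesis by (simp add: split_beta)
qed

lemma topspace_schwartz: "topspace schwartz_topology = schwartz_space"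
proof (rule antisym)
  show "topspace schwartz_topology \<subseteq> schwartz_space"
    using openin_schwartz openin_topspace by blast
  have "openin schwartz_topology schwartz_space"
    unfolding openin_schwartz by (auto intro!: exI[of _ "{}"] exI[of _ "1::real"])
  then show "schwartz_space \<subseteq> topspace schwartz_topology" by (rule openin_subset)
qed

section \<open>Linear functionals on the Schwartz space: continuity as finite order\<close>

lemma linear_add:
  "complex_linear_on V T \<Longrightarrow> f \<in> V \<Longrightarrow> g \<in> V \<Longrightarrow> T (\<lambda>x. f x + g x) = T f + T g"
  by (simp add: complex_linear_on_def)

lemma linear_cmult: "complex_linear_on V T \<Longrightarrow> f \<in> V \<Longrightarrow> T (\<lambda>x. c * f x) = c * T f"
  by (simp add: complex_linear_on_def)

lemma linear_zero: "complex_linear_on V T \<Longrightarrow> f \<in> V \<Longrightarrow> T (\<lambda>x. 0) = 0"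
  using linear_cmult[of V T f 0] by simp

lemma linear_diff:
  assumes "complex_linear_on V T" "f \<in> V" "g \<in> V" "(\<lambda>x. (-1) * g x) \<in> V"
  shows "T (\<lambda>x. f x - g x) = T f - T g"
  using linear_add[OF assms(1,2,4)] linear_cmult[OF assms(1,3), of "-1"] by simp

text \<open>Stated with a common bound \<open>B\<close> on the seminorms instead of their suprema.
  The order \<open>M\<close> later becomes the exponent in the growth of the coefficient
  sequences.\<close>

definition schwartz_bounded :: "((real \<Rightarrow> complex) \<Rightarrow> complex) \<Rightarrow> nat \<Rightarrow> real \<Rightarrow> bool" where
  "schwartz_bounded T M C \<longleftrightarrow> (\<forall>f\<in>schwartz_space. \<forall>B.
     (\<forall>m\<le>M. \<forall>k\<le>M. \<forall>x. \<bar>x\<bar> ^ m * norm (nth_deriv k f x) \<le> B) \<longrightarrow> norm (T f) \<le> C * B)"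

lemma schwartz_boundedD:
  "schwartz_bounded T M C \<Longrightarrow> f \<in> schwartz_space \<Longrightarrow>
   (\<And>m k x. m \<le> M \<Longrightarrow> k \<le> M \<Longrightarrow> \<bar>x\<bar> ^ m * norm (nth_deriv k f x) \<le> B) \<Longrightarrow> norm (T f) \<le> C * B"
  by (auto simp: schwartz_bounded_def)

text \<open>The preimage of the unit disc contains a neighbourhood of zero given by finitely many
  seminorms; \<open>M\<close> is their largest index, and homogeneity does the rest.\<close>

lemma continuous_imp_schwartz_bounded:
  assumes lin: "complex_linear_on schwartz_space T"
    and cont: "continuous_map schwartz_topology euclidean T"
  shows "\<exists>M C. 0 \<le> C \<and> schwartz_bounded T M C"
proof -
  have T0: "T (\<lambda>x. 0) = 0" using linear_zero[OF lin zero_schwartz] .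
  define U where "U = {f \<in> topspace schwartz_topology. T f \<in> ball 0 1}"
  have "openin schwartz_topology U"
    unfolding U_def using cont by (rule openin_continuous_map_preimage) auto
  moreover have "(\<lambda>x. 0) \<in> U"
    by (simp add: topspace_schwartz T0 U_def)
  ultimately have "\<exists>J e. finite J \<and> 0 < e \<and>
      {g\<in>schwartz_space. \<forall>(m, k)\<in>J. schwartz_seminorm m k (\<lambda>x. g x - 0) < e} \<subseteq> U"
    unfolding openin_schwartz by (elim conjE) (erule (1) bspec)
  then obtain J e where J': "finite J" "0 < e"
    "{g\<in>schwartz_space. \<forall>(m, k)\<in>J. schwartz_seminorm m k (\<lambda>x. g x - 0) < e} \<subseteq> U"
    by (elim exE conjE) (rule that)
  then have J: "finite J" "0 < e"
    "{g\<in>schwartz_space. \<forall>(m, k)\<in>J. schwartz_seminorm m k g < e} \<subseteq> {f. norm (T f) < 1}"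
    by (auto simp: U_def)
  define M where "M = Max (insert 0 (fst ` J \<union> snd ` J))"
  have M: "m \<le> M" "k \<le> M" if "(m, k) \<in> J" for m k
    unfolding M_def using J(1) that by (intro Max_ge; force)+
  have "schwartz_bounded T M (2 / e)"
    unfolding schwartz_bounded_def
  proof (intro ballI allI impI)
    fix f B assume f: "f \<in> schwartz_space"
      and B: "\<forall>m\<le>M. \<forall>k\<le>M. \<forall>x. \<bar>x\<bar> ^ m * norm (nth_deriv k f x) \<le> B"
    have B0: "0 \<le> B" using B[rule_format, of 0 0 0] by (auto intro: order_trans[OF norm_ge_zero])
    \<comment> \<open>The function is rescaled by means of a number \<open>t\<close> above
      \<open>B\<close>, since \<open>B\<close> itself may be zero; \<open>dense_ge\<close> then lets
      \<open>t\<close> decrease to \<open>B\<close>.\<close>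
    have *: "norm (T f) * (e / 2) \<le> t" if t: "B < t" for t
    proof -
      have t0: "0 < t" using t B0 by simp
      define c where "c = e / (2 * t)"
      have c: "0 < c" using t0 J by (simp add: c_def)
      have "schwartz_seminorm m k (\<lambda>x. of_real c * f x) < e" if "(m, k) \<in> J" for m k
      proof -
        have "schwartz_seminorm m k (\<lambda>x. of_real c * f x) \<le> e / 2"
        proof (rule schwartz_seminorm_le)
          fix x
          have "\<bar>x\<bar> ^ m * norm (nth_deriv k (\<lambda>x. of_real c * f x) x) = c * (\<bar>x\<bar> ^ m * norm (nth_deriv k f x))"
            using c f by (simp add: nth_deriv_cmult schwartzD norm_mult)
          also have "\<dots> \<le> c * t"
            using B[rule_format, OF M[OF that], of x] c t by (intro mult_left_mono) auto
          also have "\<dots> = e / 2" using t0 by (simp add: c_def)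
          finally show "\<bar>x\<bar> ^ m * norm (nth_deriv k (\<lambda>x. of_real c * f x) x) \<le> e / 2" .
        qed
        with J show ?thesis by simp
      qed
      then have "(\<lambda>x. of_real c * f x) \<in> {f. norm (T f) < 1}"
        using J(3) schwartz_cmult[OF f, of "of_real c"] by auto
      moreover have "T (\<lambda>x. of_real c * f x) = of_real c * T f"
        by (rule linear_cmult[OF lin f])
      ultimately have "c * norm (T f) < 1" using c by (simp add: norm_mult)
      then show ?thesis using t0 by (simp add: c_def field_simps)
    qed
    have "norm (T f) * (e / 2) \<le> B" by (rule dense_ge) (rule *)
    then show "norm (T f) \<le> 2 / e * B" using J by (simp add: field_simps)
  qed
  with J show ?thesis by (intro exI[of _ M] exI[of _ "2 / e"]) auto
qed

lemma schwartz_bounded_imp_tempered: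
  assumes lin: "complex_linear_on schwartz_space T" and bd: "schwartz_bounded T M C"
  shows "tempered_distribution T"
  unfolding tempered_distribution_def
proof (intro conjI lin)
  show "continuous_map schwartz_topology euclidean T"
    unfolding continuous_map_def topspace_schwartz
  proof (intro conjI allI impI)
    show "T \<in> schwartz_space \<rightarrow> topspace euclidean" by simp
    fix U :: "complex set" assume "openin euclidean U"
    then have U: "open U" by simp
    show "openin schwartz_topology {f \<in> schwartz_space. T f \<in> U}"
      unfolding openin_schwartz
    proof (intro conjI ballI)
      fix f assume f: "f \<in> {f \<in> schwartz_space. T f \<in> U}"
      with U obtain \<epsilon> where \<epsilon>: "0 < \<epsilon>" "ball (T f) \<epsilon> \<subseteq> U" by (auto simp: open_contains_ball)
      \<comment> \<open>The added 1 keeps the denominator positive when \<open>C\<close> is zero,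
        and the absolute value covers negative \<open>C\<close>.\<close>
      define e where "e = \<epsilon> / (\<bar>C\<bar> + 1)"
      show "\<exists>J e. finite J \<and> 0 < e \<and> {g\<in>schwartz_space. \<forall>(m, k)\<in>J.
          schwartz_seminorm m k (\<lambda>x. g x - f x) < e} \<subseteq> {f \<in> schwartz_space. T f \<in> U}"
      proof (intro exI conjI subsetI)
        show "finite ({..M} \<times> {..M})" by simp
        show e: "0 < e" using \<epsilon> by (simp add: e_def add_nonneg_pos)
        fix g assume g: "g \<in> {g\<in>schwartz_space. \<forall>(m, k)\<in>{..M} \<times> {..M}. schwartz_seminorm m k (\<lambda>x. g x - f x) < e}"
        have gf: "(\<lambda>x. g x - f x) \<in> schwartz_space" using f g by (auto intro: schwartz_diff)
        have "norm (T (\<lambda>x. g x - f x)) \<le> C * e"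
          by (rule schwartz_boundedD[OF bd gf])
            (rule order_trans[OF le_schwartz_seminorm[OF gf]], use g in \<open>fastforce intro: less_imp_le\<close>)
        also have "\<dots> < (\<bar>C\<bar> + 1) * e" using e by (intro mult_strict_right_mono) auto
        also have "\<dots> = \<epsilon>" by (simp add: e_def add_nonneg_pos less_imp_neq[symmetric])
        finally have "norm (T g - T f) < \<epsilon>"
          using linear_diff[OF lin, of g f] f g schwartz_cmult[of f "-1"] by simp
        then have "T g \<in> ball (T f) \<epsilon>" by (simp add: dist_norm norm_minus_commute)
        with \<epsilon> g show "g \<in> {f \<in> schwartz_space. T f \<in> U}" by auto
      qed
    qed auto
  qed
qed

section \<open>The norm topology, dual functionals and density\<close>

context banach_function_space
begin

lemma diff_mem: "f \<in> X \<Longrightarrow> g \<in> X \<Longrightarrow> (\<lambda>x. f x - g x) \<in> X"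
  using add_mem[of f "\<lambda>x. (-1) * g x"] scale_mem[of g "-1"] by simp

lemma N_zero: "N (\<lambda>x. 0) = 0"
  using norm_scale[OF zero_mem, of 0] by simp

lemma openin_norm_topology:
  "openin (norm_topology X N) U \<longleftrightarrow> U \<subseteq> X \<and> (\<forall>f\<in>U. \<exists>e>0. {g\<in>X. N (\<lambda>x. g x - f x) < e} \<subseteq> U)"
proof -
  have "norm_topology X N = topology_generated_by
      {{g\<in>X. (\<lambda>_. N) i (\<lambda>x. g x - f x) < e} | (i::unit) f e. f \<in> X \<and> 0 < e}"
    unfolding norm_topology_def by (rule arg_cong[of _ _ topology_generated_by]) force
  also have "openin \<dots> U \<longleftrightarrow> U \<subseteq> X \<and>
     (\<forall>f\<in>U. \<exists>J e. finite J \<and> 0 < e \<and> {g\<in>X. \<forall>i\<in>J. (\<lambda>_. N) (i::unit) (\<lambda>x. g x - f x) < e} \<subseteq> U)"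
  proof (rule openin_seminorm_topology)
    fix f g h assume "f \<in> X" "g \<in> X" "h \<in> X"
    then show "N (\<lambda>x. f x - h x) \<le> N (\<lambda>x. f x - g x) + N (\<lambda>x. g x - h x)"
      using norm_triangle[OF diff_mem[of f g] diff_mem[of g h]] by simp
  qed (rule N_zero)
  also have "\<dots> \<longleftrightarrow> U \<subseteq> X \<and> (\<forall>f\<in>U. \<exists>e>0. {g\<in>X. N (\<lambda>x. g x - f x) < e} \<subseteq> U)"
  proof (rule conj_cong[OF refl], rule ball_cong[OF refl])
    fix f
    show "(\<exists>J e. finite J \<and> 0 < e \<and> {g\<in>X. \<forall>i\<in>J. (\<lambda>_. N) (i::unit) (\<lambda>x. g x - f x) < e} \<subseteq> U) \<longleftrightarrow>
      (\<exists>e>0. {g\<in>X. N (\<lambda>x. g x - f x) < e} \<subseteq> U)"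
      by (auto intro: exI[of _ "{()}"])
  qed
  finally show ?thesis .
qed

lemma topspace_norm_topology: "topspace (norm_topology X N) = X"
proof (rule antisym)
  show "topspace (norm_topology X N) \<subseteq> X"
    using openin_norm_topology openin_topspace by blast
  have "openin (norm_topology X N) X"
    unfolding openin_norm_topology by (auto intro: exI[of _ "1::real"])
  then show "X \<subseteq> topspace (norm_topology X N)" by (rule openin_subset)
qed

lemma dual_spaceI:
  assumes lin: "complex_linear_on X h" and bd: "\<And>f. f \<in> X \<Longrightarrow> norm (h f) \<le> K * N f"
  shows "h \<in> dual_space X N"
  unfolding dual_space_def
proof (intro CollectI conjI lin)
  show "continuous_map (norm_topology X N) euclidean h"
    unfolding continuous_map_def topspace_norm_topology
  proof (intro conjI allI impI)
    fix U :: "complex set" assume "openin euclidean U"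
    then have U: "open U" by simp
    show "openin (norm_topology X N) {f \<in> X. h f \<in> U}"
      unfolding openin_norm_topology
    proof (intro conjI ballI)
      fix f assume f: "f \<in> {f \<in> X. h f \<in> U}"
      with U obtain \<epsilon> where \<epsilon>: "0 < \<epsilon>" "ball (h f) \<epsilon> \<subseteq> U" by (auto simp: open_contains_ball)
      define e where "e = \<epsilon> / (\<bar>K\<bar> + 1)"
      have e: "0 < e" using \<epsilon> by (simp add: e_def add_nonneg_pos)
      have "h g \<in> U" if g: "g \<in> X" "N (\<lambda>x. g x - f x) < e" for g
      proof -
        have "norm (h g - h f) = norm (h (\<lambda>x. g x - f x))"
          using linear_diff[OF lin, of g f] f g scale_mem[of f "-1"] by simp
        also have "\<dots> \<le> K * N (\<lambda>x. g x - f x)" using f g by (intro bd diff_mem) auto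
        also have "\<dots> \<le> (\<bar>K\<bar> + 1) * N (\<lambda>x. g x - f x)"
          using f g by (intro mult_right_mono norm_nonneg diff_mem) auto
        also have "\<dots> < (\<bar>K\<bar> + 1) * e" using g by (intro mult_strict_left_mono) auto
        also have "\<dots> = \<epsilon>" by (simp add: e_def add_nonneg_pos less_imp_neq[symmetric])
        finally have "h g \<in> ball (h f) \<epsilon>" by (simp add: dist_norm norm_minus_commute)
        with \<epsilon> show ?thesis by auto
      qed
      with e show "\<exists>e>0. {g \<in> X. N (\<lambda>x. g x - f x) < e} \<subseteq> {f \<in> X. h f \<in> U}" by blast
    qed auto
  qed auto
qed

lemma dense_in_spaceI:
  assumes "D \<subseteq> X" "\<And>f e. f \<in> X \<Longrightarrow> 0 < e \<Longrightarrow> \<exists>g\<in>D. N (\<lambda>x. g x - f x) < e"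
  shows "dense_in_space X N D"
  unfolding dense_in_space_def
proof (intro conjI assms(1) antisym subsetI)
  fix f assume "f \<in> norm_topology X N closure_of D"
  then show "f \<in> X" by (simp add: in_closure_of topspace_norm_topology)
next
  fix f assume f: "f \<in> X"
  show "f \<in> norm_topology X N closure_of D"
    unfolding in_closure_of topspace_norm_topology
  proof (intro conjI allI impI f)
    fix T assume "f \<in> T \<and> openin (norm_topology X N) T"
    then obtain e where "e > 0" "{g\<in>X. N (\<lambda>x. g x - f x) < e} \<subseteq> T"
      unfolding openin_norm_topology by blast
    with assms f show "\<exists>g. g \<in> D \<and> g \<in> T" by blast
  qed
qed

end

section \<open>The Hahn-Banach theorem\<close>

context banach_function_space
begin

text \<open>Positive homogeneity is required as an inequality, which is easier to check for infima;
  applying it to the reciprocal factor gives equality in \<open>sublinear_scale\<close>.\<close>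

definition sublinear :: "((real \<Rightarrow> complex) \<Rightarrow> real) \<Rightarrow> bool" where
  "sublinear q \<longleftrightarrow> q (\<lambda>x. 0) = 0 \<and>
     (\<forall>f\<in>X. \<forall>g\<in>X. q (\<lambda>x. f x + g x) \<le> q f + q g) \<and>
     (\<forall>t>0. \<forall>f\<in>X. q (\<lambda>x. of_real t * f x) \<le> t * q f)"

lemma uminus_mem: "f \<in> X \<Longrightarrow> (\<lambda>x. - f x) \<in> X"
  using scale_mem[of f "-1"] by simp

lemma sublinear_add: "sublinear q \<Longrightarrow> f \<in> X \<Longrightarrow> g \<in> X \<Longrightarrow> q (\<lambda>x. f x + g x) \<le> q f + q g"
  by (simp add: sublinear_def)

lemma sublinear_pos_scale:
  "sublinear q \<Longrightarrow> f \<in> X \<Longrightarrow> 0 < t \<Longrightarrow> q (\<lambda>x. of_real t * f x) \<le> t * q f"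
  by (simp add: sublinear_def)

lemma sublinear_lower: "sublinear q \<Longrightarrow> f \<in> X \<Longrightarrow> - q (\<lambda>x. - f x) \<le> q f"
  using sublinear_add[of q f "\<lambda>x. - f x"] uminus_mem[of f] by (simp add: sublinear_def)

lemma sublinear_scale:
  assumes "sublinear q" "f \<in> X" "0 \<le> t"
  shows "q (\<lambda>x. of_real t * f x) = t * q f"
proof (cases "t = 0")
  case False
  with assms have t: "0 < t" by simp
  have "q (\<lambda>x. of_real (1/t) * (of_real t * f x)) \<le> (1/t) * q (\<lambda>x. of_real t * f x)"
    using assms t scale_mem[OF assms(2), of "of_real t"] unfolding sublinear_def
    by (metis divide_pos_pos zero_less_one)
  with t have "t * q f \<le> q (\<lambda>x. of_real t * f x)" by (simp add: field_simps)
  moreover have "q (\<lambda>x. of_real t * f x) \<le> t * q f" using assms t unfolding sublinear_def by blast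
  ultimately show ?thesis by simp
qed (use assms in \<open>simp add: sublinear_def\<close>)

lemma INF_le_of_lower_bound:
  fixes F :: "'i \<Rightarrow> real"
  shows "(\<And>i. i \<in> I \<Longrightarrow> b \<le> F i) \<Longrightarrow> i \<in> I \<Longrightarrow> (INF i\<in>I. F i) \<le> F i"
  by (rule cINF_lower[OF bdd_belowI2])

text \<open>The single members need not be sublinear: it suffices that bounds by two members are
  matched, for the sum, by some third member. The lower bound \<open>b\<close> keeps the real
  infimum meaningful. Applied to \<open>shift_down\<close>, to infima of chains and to the distance
  from a subspace.\<close>

lemma sublinear_INF:
  assumes ne: "I \<noteq> {}" and low: "\<And>f i. f \<in> X \<Longrightarrow> i \<in> I \<Longrightarrow> b f \<le> F i f"
    and zero: "\<And>i. i \<in> I \<Longrightarrow> 0 \<le> F i (\<lambda>x. 0)" "\<exists>i\<in>I. F i (\<lambda>x. 0) \<le> 0"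
    and add: "\<And>f g i j. f \<in> X \<Longrightarrow> g \<in> X \<Longrightarrow> i \<in> I \<Longrightarrow> j \<in> I \<Longrightarrow>
      \<exists>k\<in>I. F k (\<lambda>x. f x + g x) \<le> F i f + F j g"
    and scale: "\<And>f i t. f \<in> X \<Longrightarrow> i \<in> I \<Longrightarrow> 0 < t \<Longrightarrow> \<exists>k\<in>I. F k (\<lambda>x. of_real t * f x) \<le> t * F i f"
  shows "sublinear (\<lambda>f. INF i\<in>I. F i f)"
proof -
  define u where "u f = (INF i\<in>I. F i f)" for f
  have u_le: "u f \<le> F i f" if "i \<in> I" "f \<in> X" for i f
    unfolding u_def by (rule INF_le_of_lower_bound[of I "b f"]) (use low that in auto)
  have u_ge: "c \<le> u f" if "\<And>i. i \<in> I \<Longrightarrow> c \<le> F i f" for c f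
    unfolding u_def using ne that by (intro cINF_greatest)
  have "sublinear u"
    unfolding sublinear_def
  proof (intro conjI ballI allI impI)
    have "u (\<lambda>x. 0) \<le> 0" using zero(2) u_le[OF _ zero_mem] by (meson order_trans)
    moreover have "0 \<le> u (\<lambda>x. 0)" by (rule u_ge) (rule zero(1))
    ultimately show "u (\<lambda>x. 0) = 0" by simp
  next
    fix f g assume fg: "f \<in> X" "g \<in> X"
    have *: "u (\<lambda>x. f x + g x) \<le> F i f + F j g" if "i \<in> I" "j \<in> I" for i j
      using add[OF fg that] u_le[OF _ add_mem[OF fg]] by (meson order_trans)
    have "u (\<lambda>x. f x + g x) - u f \<le> u g"
    proof (rule u_ge)
      fix j assume j: "j \<in> I"
      have "u (\<lambda>x. f x + g x) - F j g \<le> u f" by (rule u_ge) (use *[OF _ j] in fastforce)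
      then show "u (\<lambda>x. f x + g x) - u f \<le> F j g" by simp
    qed
    then show "u (\<lambda>x. f x + g x) \<le> u f + u g" by simp
  next
    fix t :: real and f assume t: "0 < t" and f: "f \<in> X"
    have "u (\<lambda>x. of_real t * f x) / t \<le> u f"
    proof (rule u_ge)
      fix i assume "i \<in> I"
      then have "u (\<lambda>x. of_real t * f x) \<le> t * F i f"
        using scale[OF f _ t] u_le[OF _ scale_mem[OF f]] by (meson order_trans)
      then show "u (\<lambda>x. of_real t * f x) / t \<le> F i f" using t by (simp add: field_simps)
    qed
    then show "u (\<lambda>x. of_real t * f x) \<le> t * u f" using t by (simp add: field_simps)
  qed
  then show ?thesis unfolding u_def[abs_def] .
qed

text \<open>Lowers \<open>q\<close> along \<open>y\<close>: taking t = 1 at \<open>- y\<close> gives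
  a value of at most \<open>- q y\<close>. A minimal \<open>q\<close> has to agree with it, which
  forces additivity.\<close>

definition shift_down :: "((real \<Rightarrow> complex) \<Rightarrow> real) \<Rightarrow> (real \<Rightarrow> complex) \<Rightarrow> (real \<Rightarrow> complex) \<Rightarrow> real" where
  "shift_down q y f = (INF t\<in>{0..}. q (\<lambda>x. f x + of_real t * y x) - t * q y)"

lemma shift_mem: "f \<in> X \<Longrightarrow> y \<in> X \<Longrightarrow> (\<lambda>x. f x + of_real t * y x) \<in> X"
  by (intro add_mem scale_mem)

text \<open>Subadditivity for t y = (f + t y) + (- f); the bound does not depend on
  \<open>t\<close>, so the infimum in \<open>shift_down\<close> exists.\<close>

lemma shift_lower:
  assumes "sublinear q" "y \<in> X" "f \<in> X" "0 \<le> t"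
  shows "- q (\<lambda>x. - f x) \<le> q (\<lambda>x. f x + of_real t * y x) - t * q y"
proof -
  have "q (\<lambda>x. (f x + of_real t * y x) + (- f x)) \<le> q (\<lambda>x. f x + of_real t * y x) + q (\<lambda>x. - f x)"
    by (intro sublinear_add shift_mem uminus_mem assms)
  moreover have "(\<lambda>x. (f x + of_real t * y x) + (- f x)) = (\<lambda>x. of_real t * y x)" by auto
  ultimately show ?thesis using sublinear_scale[OF assms(1,2,4)] by simp
qed

lemma shift_down_le:
  assumes "sublinear q" "y \<in> X" "f \<in> X" "0 \<le> t"
  shows "shift_down q y f \<le> q (\<lambda>x. f x + of_real t * y x) - t * q y"
  unfolding shift_down_def
  by (rule INF_le_of_lower_bound[of _ "- q (\<lambda>x. - f x)"]) (use shift_lower assms in auto)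

lemma shift_down_le_self: "sublinear q \<Longrightarrow> y \<in> X \<Longrightarrow> f \<in> X \<Longrightarrow> shift_down q y f \<le> q f"
  using shift_down_le[of q y f 0] by simp

lemma sublinear_shift_down:
  assumes q: "sublinear q" and y: "y \<in> X"
  shows "sublinear (shift_down q y)"
  unfolding shift_down_def[abs_def]
proof (rule sublinear_INF)
  have q0: "q (\<lambda>x. 0) = 0" using q by (simp add: sublinear_def)
  show "0 \<le> q (\<lambda>x. 0 + of_real t * y x) - t * q y" if "t \<in> {0..}" for t
    using shift_lower[OF q y zero_mem, of t] that q0 by simp
  show "\<exists>t\<in>{0..}. q (\<lambda>x. 0 + of_real t * y x) - t * q y \<le> 0"
    by (rule bexI[of _ 0]) (simp_all add: q0)
  show "- q (\<lambda>x. - f x) \<le> q (\<lambda>x. f x + of_real t * y x) - t * q y" if "f \<in> X" "t \<in> {0..}" for f t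
    using shift_lower[OF q y that(1), of t] that by simp
next
  fix f g :: "real \<Rightarrow> complex" and s t :: real
  assume fg: "f \<in> X" "g \<in> X" and st: "s \<in> {0..}" "t \<in> {0..}"
  have "(\<lambda>x. (f x + g x) + of_real (s + t) * y x) = (\<lambda>x. (f x + of_real s * y x) + (g x + of_real t * y x))"
    by (auto simp: algebra_simps)
  then have "q (\<lambda>x. (f x + g x) + of_real (s + t) * y x) \<le> q (\<lambda>x. f x + of_real s * y x) + q (\<lambda>x. g x + of_real t * y x)"
    using sublinear_add[OF q shift_mem[OF fg(1) y] shift_mem[OF fg(2) y]] by simp
  then show "\<exists>k\<in>{0..}. q (\<lambda>x. (f x + g x) + of_real k * y x) - k * q y
      \<le> (q (\<lambda>x. f x + of_real s * y x) - s * q y) + (q (\<lambda>x. g x + of_real t * y x) - t * q y)"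
    using st by (intro bexI[of _ "s + t"]) (simp_all add: algebra_simps)
next
  fix f :: "real \<Rightarrow> complex" and t c :: real
  assume f: "f \<in> X" and t: "t \<in> {0..}" and c: "0 < c"
  have "(\<lambda>x. of_real c * f x + of_real (c * t) * y x) = (\<lambda>x. of_real c * (f x + of_real t * y x))"
    by (auto simp: algebra_simps)
  then have "q (\<lambda>x. of_real c * f x + of_real (c * t) * y x) \<le> c * q (\<lambda>x. f x + of_real t * y x)"
    using sublinear_pos_scale[OF q shift_mem[OF f y] c] by simp
  then show "\<exists>k\<in>{0..}. q (\<lambda>x. of_real c * f x + of_real k * y x) - k * q y
      \<le> c * (q (\<lambda>x. f x + of_real t * y x) - t * q y)"
    using t c by (intro bexI[of _ "c * t"]) (simp_all add: algebra_simps)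
qed simp

text \<open>Zorn's lemma for the reversed pointwise order. Infima of chains stay finite because q f
  >= - q (- f) >= - p (- f).\<close>

lemma minimal_sublinear:
  assumes p: "sublinear p"
  shows "\<exists>q. sublinear q \<and> (\<forall>f\<in>X. q f \<le> p f) \<and>
     (\<forall>q'. sublinear q' \<longrightarrow> (\<forall>f\<in>X. q' f \<le> q f) \<longrightarrow> (\<forall>f\<in>X. q' f = q f))"
proof -
  \<comment> \<open>Functionals are total, so their values outside \<open>X\<close> are fixed to
    zero; the pointwise order then compares them on \<open>X\<close> only.\<close>
  define A where "A = {q. sublinear q \<and> (\<forall>f\<in>X. q f \<le> p f) \<and> (\<forall>f. f \<notin> X \<longrightarrow> q f = 0)}"
  have trunc: "sublinear (\<lambda>f. if f \<in> X then q f else 0)" if "sublinear q" for q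
    using that add_mem scale_mem zero_mem unfolding sublinear_def by auto
  have "\<exists>m\<in>A. \<forall>a\<in>A. a \<le> m \<longrightarrow> a = m"
  proof (rule predicate_Zorn)
    show "partial_order_on A (relation_of (\<lambda>a b. b \<le> a) A)"
      by (rule partial_order_on_relation_ofI) auto
    fix C assume C: "C \<in> Chains (relation_of (\<lambda>a b. b \<le> a) A)"
    show "\<exists>u\<in>A. \<forall>a\<in>C. u \<le> a"
    proof (cases "C = {}")
      case True
      have "(\<lambda>f. if f \<in> X then p f else 0) \<in> A" using trunc[OF p] by (simp add: A_def)
      with True show ?thesis by blast
    next
      case False
      have CA: "C \<subseteq> A" using C unfolding Chains_def relation_of_def by blast
      have chain: "a \<le> b \<or> b \<le> a" if "a \<in> C" "b \<in> C" for a b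
        using C that unfolding Chains_def relation_of_def by blast
      define u where "u f = (INF q\<in>C. q f)" for f
      have low: "- p (\<lambda>x. - f x) \<le> q f" if "q \<in> C" "f \<in> X" for q f
        using that CA sublinear_lower[of q f] uminus_mem[of f] unfolding A_def by fastforce
      have u_le: "u f \<le> q f" if "q \<in> C" for q f
      proof (cases "f \<in> X")
        case True
        then show ?thesis
          unfolding u_def by (intro INF_le_of_lower_bound[of C "- p (\<lambda>x. - f x)"] that low)
      next
        case False
        then have *: "q' f = 0" if "q' \<in> C" for q' using that CA unfolding A_def by auto
        show ?thesis unfolding u_def by (intro INF_le_of_lower_bound[of C 0] that) (simp add: *)
      qed
      have sub: "sublinear q" if "q \<in> C" for q using that CA unfolding A_def by auto
      have "sublinear u"
        unfolding u_def[abs_def]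
      proof (rule sublinear_INF[OF False])
        show "- p (\<lambda>x. - f x) \<le> q f" if "f \<in> X" "q \<in> C" for q f by (rule low[OF that(2,1)])
        show "0 \<le> q (\<lambda>x. 0)" if "q \<in> C" for q using sub[OF that] by (simp add: sublinear_def)
        show "\<exists>q\<in>C. q (\<lambda>x. 0) \<le> 0" using False sub by (force simp: sublinear_def)
        show "\<exists>q\<in>C. q (\<lambda>x. of_real t * f x) \<le> t * q' f" if "f \<in> X" "q' \<in> C" "0 < t" for f q' t
          using sublinear_pos_scale[OF sub[OF that(2)] that(1,3)] that(2) by blast
        fix f g a b assume fg: "f \<in> X" "g \<in> X" and ab: "a \<in> C" "b \<in> C"
        obtain q where q: "q \<in> C" "q \<le> a" "q \<le> b" using chain[OF ab] ab by blast
        have "q (\<lambda>x. f x + g x) \<le> q f + q g" by (rule sublinear_add[OF sub[OF q(1)] fg])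
        also have "\<dots> \<le> a f + b g" using q by (intro add_mono) (auto simp: le_fun_def)
        finally show "\<exists>q\<in>C. q (\<lambda>x. f x + g x) \<le> a f + b g" using q(1) by blast
      qed
      moreover have "u f \<le> p f" if "f \<in> X" for f
        using False u_le[of _ f] CA that unfolding A_def by fastforce
      moreover have "u f = 0" if "f \<notin> X" for f
      proof -
        have "q f = 0" if "q \<in> C" for q using that CA \<open>f \<notin> X\<close> unfolding A_def by auto
        then have "(\<lambda>q. q f) ` C = (\<lambda>q. 0) ` C" by (intro image_cong) auto
        then have "(\<lambda>q. q f) ` C = {0}" using False by auto
        then show ?thesis by (simp add: u_def)
      qed
      ultimately have "u \<in> A" by (simp add: A_def)
      with u_le show ?thesis by (auto simp: le_fun_def)
    qed
  qed
  then obtain q where q: "q \<in> A" "\<And>a. a \<in> A \<Longrightarrow> a \<le> q \<Longrightarrow> a = q" by blast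
  have "\<forall>f\<in>X. q' f = q f" if q': "sublinear q'" "\<forall>f\<in>X. q' f \<le> q f" for q'
  proof -
    have "(\<lambda>f. if f \<in> X then q' f else 0) \<in> A"
      using trunc[OF q'(1)] q'(2) q(1) unfolding A_def by fastforce
    moreover have "(\<lambda>f. if f \<in> X then q' f else 0) \<le> q"
      using q'(2) q(1) unfolding A_def le_fun_def by auto
    ultimately have "(\<lambda>f. if f \<in> X then q' f else 0) = q" by (rule q(2))
    show ?thesis
    proof
      fix f assume "f \<in> X"
      with fun_cong[OF \<open>(\<lambda>f. if f \<in> X then q' f else 0) = q\<close>, of f] show "q' f = q f" by simp
    qed
  qed
  with q(1) show ?thesis unfolding A_def by blast
qed

definition real_linear :: "((real \<Rightarrow> complex) \<Rightarrow> real) \<Rightarrow> bool" where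
  "real_linear l \<longleftrightarrow> (\<forall>f\<in>X. \<forall>g\<in>X. l (\<lambda>x. f x + g x) = l f + l g) \<and>
     (\<forall>t. \<forall>f\<in>X. l (\<lambda>x. of_real t * f x) = t * l f)"

text \<open>For a minimal \<open>q\<close> the functional \<open>shift_down q y\<close>, being below
  \<open>q\<close>, equals \<open>q\<close>; with t = 1 this gives q f + q y <= q (f + y). So
  \<open>q\<close> is additive, hence linear.\<close>

lemma exists_dominated_linear:
  assumes p: "sublinear p"
  shows "\<exists>l. real_linear l \<and> (\<forall>f\<in>X. l f \<le> p f)"
proof -
  obtain q where q: "sublinear q" "\<forall>f\<in>X. q f \<le> p f"
    and min: "\<And>q'. sublinear q' \<Longrightarrow> \<forall>f\<in>X. q' f \<le> q f \<Longrightarrow> \<forall>f\<in>X. q' f = q f"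
    using minimal_sublinear[OF p] by blast
  have add: "q (\<lambda>x. f x + y x) = q f + q y" if f: "f \<in> X" and y: "y \<in> X" for f y
  proof -
    have "shift_down q y f = q f"
      using min[OF sublinear_shift_down[OF q(1) y]] shift_down_le_self[OF q(1) y] f by blast
    with shift_down_le[OF q(1) y f, of 1] have "q f + q y \<le> q (\<lambda>x. f x + y x)" by simp
    moreover have "q (\<lambda>x. f x + y x) \<le> q f + q y" by (rule sublinear_add[OF q(1) f y])
    ultimately show ?thesis by simp
  qed
  have neg: "q (\<lambda>x. - f x) = - q f" if "f \<in> X" for f
    using add[OF that uminus_mem[OF that]] q(1) by (simp add: sublinear_def)
  have "q (\<lambda>x. of_real t * f x) = t * q f" if f: "f \<in> X" for t f
  proof (cases "0 \<le> t")
    case False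
    then have "q (\<lambda>x. of_real (- t) * (- f x)) = (- t) * q (\<lambda>x. - f x)"
      by (intro sublinear_scale[OF q(1) uminus_mem[OF f]]) simp
    then show ?thesis by (simp add: neg[OF f])
  qed (use sublinear_scale[OF q(1) f] in simp)
  with add q(2) show ?thesis by (auto simp: real_linear_def intro!: exI[of _ q])
qed

text \<open>Domination by \<open>shift_down p f0\<close> instead of \<open>p\<close> forces l (- f0)
  <= - p f0, so the functional attains \<open>p\<close> at \<open>f0\<close>.\<close>

lemma exists_supporting_linear:
  assumes p: "sublinear p" and f0: "f0 \<in> X"
  shows "\<exists>l. real_linear l \<and> (\<forall>f\<in>X. l f \<le> p f) \<and> p f0 \<le> l f0"
proof -
  obtain l where l: "real_linear l" "\<And>f. f \<in> X \<Longrightarrow> l f \<le> shift_down p f0 f"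
    using exists_dominated_linear[OF sublinear_shift_down[OF p f0]] by blast
  have "l (\<lambda>x. of_real (-1) * f0 x) = (-1) * l f0"
    using l(1) f0 by (simp only: real_linear_def)
  then have "- l f0 = l (\<lambda>x. - f0 x)" by simp
  also have "\<dots> \<le> shift_down p f0 (\<lambda>x. - f0 x)" by (intro l uminus_mem f0)
  also have "\<dots> \<le> - p f0"
    using shift_down_le[OF p f0 uminus_mem[OF f0], of 1] p by (simp add: sublinear_def)
  finally have "p f0 \<le> l f0" by simp
  with l shift_down_le_self[OF p f0] show ?thesis by (meson order_trans)
qed

text \<open>The dominating functional is the distance to \<open>V\<close>: it vanishes on
  \<open>V\<close>, is at most \<open>N\<close>, and is at least \<open>e\<close> at
  \<open>f0\<close>. A real linear functional below it that attains it at \<open>f0\<close>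
  separates, and is then complexified.\<close>

theorem separating_functional:
  assumes VX: "V \<subseteq> X" and V0: "(\<lambda>x. 0) \<in> V"
    and Vadd: "\<And>f g. f \<in> V \<Longrightarrow> g \<in> V \<Longrightarrow> (\<lambda>x. f x + g x) \<in> V"
    and Vscale: "\<And>c f. f \<in> V \<Longrightarrow> (\<lambda>x. c * f x) \<in> V"
    and f0: "f0 \<in> X" and e: "0 < e" and far: "\<And>v. v \<in> V \<Longrightarrow> e \<le> N (\<lambda>x. v x - f0 x)"
  shows "\<exists>h\<in>dual_space X N. (\<forall>v\<in>V. h v = 0) \<and> h f0 \<noteq> 0"
proof -
  define p where "p f = (INF v\<in>V. N (\<lambda>x. v x - f x))" for f
  have p_le: "p f \<le> N (\<lambda>x. v x - f x)" if "v \<in> V" "f \<in> X" for v f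
    unfolding p_def using that VX by (intro INF_le_of_lower_bound[of V 0] norm_nonneg diff_mem) auto
  have p_ge: "b \<le> p f" if "\<And>v. v \<in> V \<Longrightarrow> b \<le> N (\<lambda>x. v x - f x)" for b f
    unfolding p_def using V0 that by (intro cINF_greatest) auto
  have N_uminus: "N (\<lambda>x. - f x) = N f" if "f \<in> X" for f
    using norm_scale[OF that, of "-1"] by simp
  have p_nonneg: "0 \<le> p f" if "f \<in> X" for f
    by (rule p_ge) (use that VX in \<open>auto intro!: norm_nonneg diff_mem\<close>)
  have pV: "p v = 0" if "v \<in> V" for v
    using p_le[OF that, of v] p_nonneg[of v] that VX N_zero by auto
  have pN: "p f \<le> N f" if "f \<in> X" for f
    using p_le[OF V0 that] N_uminus[OF that] by simp
  have "sublinear p"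
    unfolding p_def[abs_def]
  proof (rule sublinear_INF)
    show "0 \<le> N (\<lambda>x. v x - f x)" if "f \<in> X" "v \<in> V" for v f
      using that VX by (intro norm_nonneg diff_mem) auto
    show "0 \<le> N (\<lambda>x. v x - 0)" if "v \<in> V" for v using that VX by (auto intro: norm_nonneg)
    show "\<exists>v\<in>V. N (\<lambda>x. v x - 0) \<le> 0" using V0 N_zero by (intro bexI[of _ "\<lambda>x. 0"]) auto
    show "V \<noteq> {}" using V0 by blast
  next
    fix f g v w assume A: "f \<in> X" "g \<in> X" "v \<in> V" "w \<in> V"
    have "N (\<lambda>x. (v x - f x) + (w x - g x)) \<le> N (\<lambda>x. v x - f x) + N (\<lambda>x. w x - g x)"
      by (intro norm_triangle diff_mem) (use A VX in auto)
    then show "\<exists>u\<in>V. N (\<lambda>x. u x - (f x + g x)) \<le> N (\<lambda>x. v x - f x) + N (\<lambda>x. w x - g x)"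
      by (intro bexI[OF _ Vadd[OF A(3,4)]]) (simp add: algebra_simps)
  next
    fix f v and t :: real assume A: "f \<in> X" "v \<in> V" "0 < t"
    have "N (\<lambda>x. of_real t * (v x - f x)) = t * N (\<lambda>x. v x - f x)"
      using A VX by (subst norm_scale) (auto intro!: diff_mem)
    then show "\<exists>u\<in>V. N (\<lambda>x. u x - of_real t * f x) \<le> t * N (\<lambda>x. v x - f x)"
      by (intro bexI[OF _ Vscale[OF A(2), of "of_real t"]]) (simp add: right_diff_distrib)
  qed
  then obtain l where l: "real_linear l" and lp: "\<And>f. f \<in> X \<Longrightarrow> l f \<le> p f" and lf0: "p f0 \<le> l f0"
    using exists_supporting_linear[OF _ f0] by blast
  have ladd: "l (\<lambda>x. f x + g x) = l f + l g" if "f \<in> X" "g \<in> X" for f g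
    using l that by (simp add: real_linear_def)
  have lscale: "l (\<lambda>x. of_real t * f x) = t * l f" if "f \<in> X" for t f
    using l that by (simp add: real_linear_def)
  have labs: "\<bar>l f\<bar> \<le> N f" if f: "f \<in> X" for f
  proof -
    have "- l f = l (\<lambda>x. - f x)" using lscale[OF f, of "-1"] by simp
    also have "\<dots> \<le> N (\<lambda>x. - f x)" using lp[OF uminus_mem[OF f]] pN[OF uminus_mem[OF f]] by simp
    also have "\<dots> = N f" by (rule N_uminus[OF f])
    finally show ?thesis using lp[OF f] pN[OF f] by simp
  qed
  have lV: "l v = 0" if v: "v \<in> V" for v
  proof -
    have vX: "v \<in> X" using v VX by auto
    have "- l v = l (\<lambda>x. (-1) * v x)" using lscale[OF vX, of "-1"] by simp
    also have "\<dots> \<le> p (\<lambda>x. (-1) * v x)" by (intro lp scale_mem vX)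
    also have "\<dots> = 0" by (intro pV Vscale v)
    finally show ?thesis using lp[OF vX] pV[OF v] by simp
  qed
  \<comment> \<open>The complex linear functional with real part \<open>l\<close>: h f = l f - i l
    (i f).\<close>
  define h where "h f = Complex (l f) (- l (\<lambda>x. \<i> * f x))" for f
  have lin: "complex_linear_on X h"
    unfolding complex_linear_on_def
  proof (intro conjI ballI allI)
    fix f g assume fg: "f \<in> X" "g \<in> X"
    have "(\<lambda>x. \<i> * (f x + g x)) = (\<lambda>x. \<i> * f x + \<i> * g x)" by (simp add: distrib_left)
    then show "h (\<lambda>x. f x + g x) = h f + h g"
      using fg ladd scale_mem by (simp add: h_def complex_eq_iff)
  next
    fix c and f assume f: "f \<in> X"
    have if': "(\<lambda>x. \<i> * f x) \<in> X" by (rule scale_mem[OF f])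
    have 1: "(\<lambda>x. c * f x) = (\<lambda>x. of_real (Re c) * f x + of_real (Im c) * (\<i> * f x))"
      by (subst complex_eq[of c]) (auto simp: algebra_simps)
    have 2: "(\<lambda>x. \<i> * (c * f x)) = (\<lambda>x. of_real (Re c) * (\<i> * f x) + of_real (- Im c) * f x)"
      by (subst complex_eq[of c]) (auto simp: algebra_simps)
    have "l (\<lambda>x. c * f x) = Re c * l f + Im c * l (\<lambda>x. \<i> * f x)"
      unfolding 1 using ladd[OF scale_mem[OF f] scale_mem[OF if']] lscale[OF f] lscale[OF if'] by simp
    moreover have "l (\<lambda>x. \<i> * (c * f x)) = Re c * l (\<lambda>x. \<i> * f x) - Im c * l f"
      unfolding 2 by (simp only: ladd[OF scale_mem[OF if'] scale_mem[OF f]] lscale[OF f] lscale[OF if'])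
    ultimately show "h (\<lambda>x. c * f x) = c * h f"
      by (simp add: h_def complex_eq_iff algebra_simps)
  qed
  have "h \<in> dual_space X N"
  proof (rule dual_spaceI[OF lin])
    fix f assume f: "f \<in> X"
    have "norm (h f) \<le> \<bar>l f\<bar> + \<bar>l (\<lambda>x. \<i> * f x)\<bar>"
      using cmod_le[of "h f"] by (simp add: h_def)
    also have "\<dots> \<le> N f + N (\<lambda>x. \<i> * f x)" by (intro add_mono labs f scale_mem)
    also have "\<dots> = 2 * N f" using norm_scale[OF f, of \<i>] by simp
    finally show "norm (h f) \<le> 2 * N f" .
  qed
  moreover have "h v = 0" if "v \<in> V" for v
    using lV[OF that] lV[OF Vscale[OF that, of \<i>]] by (simp add: h_def complex_eq_iff)
  moreover have "e \<le> p f0" by (rule p_ge) (rule far)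
  with lf0 e have "h f0 \<noteq> 0" by (simp add: h_def complex_eq_iff)
  ultimately show ?thesis by blast
qed

section \<open>Linear combinations and the duality criterion for spanning\<close>

lemma linear_combinationsI:
  "finite F \<Longrightarrow> F \<subseteq> G \<Longrightarrow> (\<lambda>t. \<Sum>g\<in>F. c g * g t) \<in> linear_combinations G"
  unfolding linear_combinations_def by (intro CollectI exI conjI) (rule refl)

lemma linear_combinations_add:
  assumes "f \<in> linear_combinations G" "g \<in> linear_combinations G"
  shows "(\<lambda>x. f x + g x) \<in> linear_combinations G"
proof -
  obtain F c F' c' where F: "finite F" "F \<subseteq> G" "f = (\<lambda>t. \<Sum>g\<in>F. c g * g t)"
    "finite F'" "F' \<subseteq> G" "g = (\<lambda>t. \<Sum>g\<in>F'. c' g * g t)"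
    using assms unfolding linear_combinations_def by blast
  \<comment> \<open>\<open>F\<close> and \<open>F'\<close> may overlap, so both coefficient families
    are extended by zero and added.\<close>
  define d where "d u = (if u \<in> F then c u else 0) + (if u \<in> F' then c' u else 0)" for u
  have "(\<Sum>u\<in>F \<union> F'. d u * u t) = f t + g t" for t
  proof -
    have "(\<Sum>u\<in>F \<union> F'. d u * u t) = (\<Sum>u\<in>F \<union> F'. if u \<in> F then c u * u t else 0) + (\<Sum>u\<in>F \<union> F'. if u \<in> F' then c' u * u t else 0)"
      unfolding sum.distrib[symmetric] by (rule sum.cong) (auto simp: d_def algebra_simps)
    also have "\<dots> = f t + g t"
      using F by (simp add: sum.inter_restrict[symmetric] Int_absorb1 Un_Int_eq)
    finally show ?thesis .
  qed
  then have "(\<lambda>x. f x + g x) = (\<lambda>t. \<Sum>u\<in>F \<union> F'. d u * u t)" by auto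
  with F show ?thesis by (auto intro: linear_combinationsI)
qed

lemma linear_combinations_scale:
  assumes "f \<in> linear_combinations G"
  shows "(\<lambda>x. a * f x) \<in> linear_combinations G"
proof -
  obtain F c where "finite F" "F \<subseteq> G" "f = (\<lambda>t. \<Sum>g\<in>F. c g * g t)"
    using assms unfolding linear_combinations_def by blast
  moreover from this have "(\<lambda>x. a * f x) = (\<lambda>t. \<Sum>g\<in>F. (a * c g) * g t)"
    by (simp add: sum_distrib_left mult.assoc)
  ultimately show ?thesis by (simp only: linear_combinationsI)
qed

lemma linear_combinations_base: "g \<in> G \<Longrightarrow> g \<in> linear_combinations G"
  unfolding linear_combinations_def by (intro CollectI exI[of _ "{g}"] exI[of _ "\<lambda>_. 1"]) auto

lemma linear_combinations_subset:
  assumes "G \<subseteq> X"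
  shows "linear_combinations G \<subseteq> X"
proof
  fix f assume "f \<in> linear_combinations G"
  then obtain F c where F: "finite F" "F \<subseteq> G" "f = (\<lambda>t. \<Sum>g\<in>F. c g * g t)"
    unfolding linear_combinations_def by blast
  have "(\<lambda>t. \<Sum>g\<in>F. c g * g t) \<in> X" using F(1,2)
  proof induction
    case (insert g F)
    then show ?case using add_mem[OF scale_mem[of g "c g"]] assms by (auto simp: subset_iff)
  qed (simp add: zero_mem)
  with F show "f \<in> X" by simp
qed

lemma spans_spaceI:
  assumes G: "G \<subseteq> X" and ann: "\<And>h f. h \<in> dual_space X N \<Longrightarrow> \<forall>g\<in>G. h g = 0 \<Longrightarrow> f \<in> X \<Longrightarrow> h f = 0"
  shows "spans_space X N G"
  unfolding spans_space_def
proof (rule dense_in_spaceI)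
  show GX: "linear_combinations G \<subseteq> X" by (rule linear_combinations_subset[OF G])
  fix f e assume f: "f \<in> X" and e: "(0::real) < e"
  show "\<exists>g\<in>linear_combinations G. N (\<lambda>x. g x - f x) < e"
  proof (rule ccontr)
    assume "\<not> ?thesis"
    then have far: "\<And>v. v \<in> linear_combinations G \<Longrightarrow> e \<le> N (\<lambda>x. v x - f x)" by force
    have z: "(\<lambda>x. 0) \<in> linear_combinations G"
      unfolding linear_combinations_def by (intro CollectI exI[of _ "{}"]) auto
    obtain h where "h \<in> dual_space X N" "\<forall>v\<in>linear_combinations G. h v = 0" "h f \<noteq> 0"
      using separating_functional[OF GX z linear_combinations_add linear_combinations_scale f e far] by blast
    with ann[of h f] linear_combinations_base[of _ G] f show False by blast
  qed
qed

end

section \<open>Iterated antidifferences of exponentially decaying sequences\<close>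

lemma power_Suc_diff_le: "(real n + 1) ^ Suc m - real n ^ Suc m \<le> (real m + 1) * (real n + 1) ^ m"
proof (induction m)
  case (Suc m)
  have "(real n + 1) ^ Suc (Suc m) - real n ^ Suc (Suc m)
      = (real n + 1) * ((real n + 1) ^ Suc m - real n ^ Suc m) + real n ^ Suc m"
    by (simp add: algebra_simps)
  also have "\<dots> \<le> (real n + 1) * ((real m + 1) * (real n + 1) ^ m) + (real n + 1) ^ Suc m"
    by (intro add_mono mult_left_mono Suc.IH power_mono) auto
  also have "\<dots> = (real (Suc m) + 1) * (real n + 1) ^ Suc m"
    by (simp add: algebra_simps)
  finally show ?case .
qed simp

text \<open>The discrete counterpart of integrating a power: lower bounds on increments gain one
  degree.\<close>

lemma increments_power_growth:
  fixes w :: "nat \<Rightarrow> real"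
  assumes "0 < c" and "eventually (\<lambda>n. c * real n ^ m \<le> w (Suc n) - w n) sequentially"
  shows "\<exists>d>0. eventually (\<lambda>n. d * real n ^ Suc m \<le> w n) sequentially"
proof -
  obtain n0 where n0: "\<And>n. n0 \<le> n \<Longrightarrow> c * real n ^ m \<le> w (Suc n) - w n" "1 \<le> n0"
    using assms(2) unfolding eventually_sequentially
    by (metis max.bounded_iff max.cobounded2)
  \<comment> \<open>Chosen so that d n^(m+1) has increments of at most c n^m:
    \<open>power_Suc_diff_le\<close> contributes m + 1, and (n + 1)^m <= 2^m n^m the power of two.
    Hence \<open>v\<close> is nondecreasing from \<open>n0\<close> on.\<close>
  define d where "d = c / ((real m + 1) * 2 ^ m)"
  have d: "0 < d" using assms(1) by (simp add: d_def)
  define v where "v n = w n - d * real n ^ Suc m" for n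
  have step: "v n \<le> v (Suc n)" if n: "n0 \<le> n" for n
  proof -
    have n1: "1 \<le> n" using n n0(2) by simp
    have "(real n + 1) ^ m \<le> (2 * real n) ^ m" using n1 by (intro power_mono) auto
    then have le: "(real n + 1) ^ m \<le> 2 ^ m * real n ^ m" by (simp add: power_mult_distrib)
    have "d * (real (Suc n) ^ Suc m - real n ^ Suc m) \<le> d * ((real m + 1) * (real n + 1) ^ m)"
      using power_Suc_diff_le[of n m] d by (intro mult_left_mono) (simp_all add: add.commute)
    also have "\<dots> \<le> d * ((real m + 1) * (2 ^ m * real n ^ m))"
      using d le by (intro mult_left_mono) auto
    also have "\<dots> = c * real n ^ m" by (simp add: d_def)
    also have "\<dots> \<le> w (Suc n) - w n" by (rule n0(1)[OF n])
    finally show ?thesis by (simp add: v_def right_diff_distrib)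
  qed
  have v: "v n0 \<le> v n" if "n0 \<le> n" for n
    using that by (induction rule: dec_induct) (use step in \<open>auto intro: order_trans\<close>)
  \<comment> \<open>Half of \<open>d\<close> is given up to absorb the initial value
    \<open>v n0\<close>, which may be negative.\<close>
  obtain n1 :: nat where n1: "\<bar>v n0\<bar> / (d / 2) \<le> real n1" using real_arch_simple by blast
  have "(d / 2) * real n ^ Suc m \<le> w n" if n: "max n0 (max 1 n1) \<le> n" for n
  proof -
    have "\<bar>v n0\<bar> \<le> (d / 2) * real n1" using n1 d by (simp add: field_simps)
    also have "\<dots> \<le> (d / 2) * real n" using n d by simp
    also have "\<dots> \<le> (d / 2) * real n ^ Suc m"
      using n d self_le_power[of "real n" "Suc m"] by (intro mult_left_mono) auto
    finally have "\<bar>v n0\<bar> \<le> (d / 2) * real n ^ Suc m" .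
    moreover have "v n0 \<le> w n - d * real n ^ Suc m" using v[of n] n by (simp add: v_def)
    moreover have "d * real n ^ Suc m = (d / 2) * real n ^ Suc m + (d / 2) * real n ^ Suc m" by simp
    ultimately show ?thesis by linarith
  qed
  then have "eventually (\<lambda>n. (d / 2) * real n ^ Suc m \<le> w n) sequentially"
    unfolding eventually_sequentially by blast
  then show ?thesis using d by (intro exI[of _ "d / 2"]) simp
qed

text \<open>If \<open>L\<close> were nonzero, repeated summation would make the k-th antidifference
  grow like n^(k-1) in the direction of \<open>L\<close>, against the exponent \<open>M\<close>
  common to all \<open>k\<close>.\<close>

lemma antidifference_limit_zero:
  fixes v :: "nat \<Rightarrow> nat \<Rightarrow> complex"
  assumes rec: "\<And>k n. v (Suc k) n - v (Suc k) (Suc n) = v k n"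
    and bd: "\<And>k. \<exists>B. \<forall>n. norm (v k n) \<le> B * (1 + real n) ^ M"
    and lim: "v 1 \<longlonglongrightarrow> L"
  shows "L = 0"
proof (rule ccontr)
  assume L: "L \<noteq> 0"
  \<comment> \<open>Division by \<open>L\<close> and the real part measure growth in the direction
    of \<open>L\<close>; the sign turns the recursion v n - v (n + 1) into ordinary increments. With
    the index shifted by one, \<open>w 0\<close> tends to 1.\<close>
  define w where "w k n = Re ((-1) ^ k * v (Suc k) n / L)" for k n
  have w_rec: "w (Suc k) (Suc n) - w (Suc k) n = w k n" for k n
  proof -
    have "(-1) ^ Suc k * v (Suc (Suc k)) (Suc n) / L - (-1) ^ Suc k * v (Suc (Suc k)) n / L
       = (-1) ^ k * (v (Suc (Suc k)) n - v (Suc (Suc k)) (Suc n)) / L"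
      using L by (simp add: field_simps)
    then show ?thesis unfolding w_def rec by (simp add: minus_complex.simps(1)[symmetric] del: minus_complex.simps(1))
  qed
  have growth: "\<exists>c>0. eventually (\<lambda>n. c * real n ^ k \<le> w k n) sequentially" for k
  proof (induction k)
    case 0
    have "(\<lambda>n. v 1 n / L) \<longlonglongrightarrow> L / L" by (intro tendsto_intros lim L)
    then have "(\<lambda>n. Re (v 1 n / L)) \<longlonglongrightarrow> 1" using L tendsto_Re by fastforce
    then have "eventually (\<lambda>n. 1 / 2 < Re (v 1 n / L)) sequentially" by (rule order_tendstoD) simp
    then have "eventually (\<lambda>n. (1 / 2) * real n ^ 0 \<le> w 0 n) sequentially"
      by eventually_elim (simp add: w_def)
    then show ?case by (intro exI[of _ "1 / 2"]) auto
  next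
    case (Suc k)
    then show ?case using increments_power_growth[of _ k "w (Suc k)"] by (auto simp: w_rec)
  qed
  obtain c where c: "0 < c" "eventually (\<lambda>n. c * real n ^ Suc M \<le> w (Suc M) n) sequentially"
    using growth by blast
  obtain B where B: "\<And>n. norm (v (Suc (Suc M)) n) \<le> B * (1 + real n) ^ M" using bd by blast
  have B0: "0 \<le> B" using B[of 0] by (auto intro: order_trans[OF norm_ge_zero])
  define K where "K = B * 2 ^ M / norm L"
  have up: "w (Suc M) n \<le> K * real n ^ M" if "1 \<le> n" for n
  proof -
    have "w (Suc M) n \<le> norm ((-1) ^ Suc M * v (Suc (Suc M)) n / L)"
      unfolding w_def by (rule complex_Re_le_cmod)
    also have "\<dots> = norm (v (Suc (Suc M)) n) / norm L" by (simp add: norm_mult norm_divide norm_power)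
    also have "\<dots> \<le> B * (1 + real n) ^ M / norm L" by (intro divide_right_mono B) simp
    also have "\<dots> \<le> B * (2 * real n) ^ M / norm L"
      using that B0 by (intro divide_right_mono mult_left_mono power_mono) auto
    also have "\<dots> = K * real n ^ M" by (simp add: K_def power_mult_distrib)
    finally show ?thesis .
  qed
  obtain n1 :: nat where n1: "K / c < real n1" using reals_Archimedean2 by blast
  have "eventually (\<lambda>n. max 1 n1 \<le> n) sequentially" by (rule eventually_ge_at_top)
  with c(2) have "eventually (\<lambda>n. False) sequentially"
  proof eventually_elim
    case (elim n)
    then have "c * real n ^ Suc M \<le> K * real n ^ M" using up[of n] by (intro order_trans[OF elim(1)]) simp
    then have "(c * real n) * real n ^ M \<le> K * real n ^ M" by (simp add: mult.assoc)
    moreover have "0 < real n ^ M" using elim by simp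
    ultimately have "c * real n \<le> K" by (rule mult_right_le_imp_le)
    moreover have "K < c * real n1" using n1 c(1) by (simp add: field_simps)
    moreover have "c * real n1 \<le> c * real n" using elim c(1) by simp
    ultimately show False by linarith
  qed
  then show False by simp
qed

text \<open>\<open>v 0\<close> is summable, so \<open>v 1\<close> converges; its limit is zero by
  \<open>antidifference_limit_zero\<close>. Therefore \<open>v 1\<close> is the tail sum of
  \<open>v 0\<close>, which a geometric series bounds.\<close>

lemma antidifference_decay_nat:
  fixes v :: "nat \<Rightarrow> nat \<Rightarrow> complex"
  assumes rec: "\<And>k n. v (Suc k) n - v (Suc k) (Suc n) = v k n"
    and bd: "\<And>k. \<exists>B. \<forall>n. norm (v k n) \<le> B * (1 + real n) ^ M"
    and r: "0 < r" "r < 1" and decay: "\<And>n. norm (v 0 n) \<le> D * r ^ n"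
  shows "norm (v 1 n) \<le> D / (1 - r) * r ^ n"
proof -
  have geo: "(\<lambda>i. D * r ^ n * r ^ i) sums (D * r ^ n * (1 / (1 - r)))" for n
    by (intro sums_mult geometric_sums) (use r in auto)
  have le: "norm (v 0 (n + i)) \<le> D * r ^ n * r ^ i" for n i
    using decay[of "n + i"] by (simp add: power_add mult.assoc)
  have tele: "(\<Sum>i<N. v 0 (n + i)) = v 1 n - v 1 (n + N)" for n N
  proof (induction N)
    case (Suc N)
    have "v 1 (n + N) - v 1 (n + Suc N) = v 0 (n + N)" using rec[of 0 "n + N"] by simp
    with Suc show ?case by (simp add: algebra_simps)
  qed simp
  have summ: "summable (\<lambda>i. v 0 (n + i))" for n
    by (rule summable_comparison_test'[OF sums_summable[OF geo[of n]]]) (rule le)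
  have lim: "(\<lambda>N. v 1 (n + N)) \<longlonglongrightarrow> v 1 n - (\<Sum>i. v 0 (n + i))" for n
  proof -
    have "(\<lambda>N. v 1 n - (\<Sum>i<N. v 0 (n + i))) \<longlonglongrightarrow> v 1 n - (\<Sum>i. v 0 (n + i))"
      by (intro tendsto_intros summable_LIMSEQ summ)
    then show ?thesis by (simp add: tele)
  qed
  have "v 1 \<longlonglongrightarrow> v 1 0 - (\<Sum>i. v 0 (0 + i))" using lim[of 0] by simp
  moreover from this have "v 1 0 - (\<Sum>i. v 0 (0 + i)) = 0" by (rule antidifference_limit_zero[of v M, OF rec bd])
  ultimately have "v 1 \<longlonglongrightarrow> 0" by (simp only:)
  then have "(\<lambda>N. v 1 (n + N)) \<longlonglongrightarrow> 0"
    using LIMSEQ_ignore_initial_segment[of "v 1" 0 n] by (simp add: add.commute)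
  from LIMSEQ_unique[OF lim[of n] this] have "v 1 n = (\<Sum>i. v 0 (n + i))" by simp
  also have "norm \<dots> \<le> (\<Sum>i. D * r ^ n * r ^ i)"
    by (rule norm_suminf_le[OF le sums_summable[OF geo]])
  also have "\<dots> = D / (1 - r) * r ^ n" using sums_unique[OF geo[of n]] by simp
  finally show ?thesis .
qed

text \<open>Every passage from k to k + 1 applies the one-sided result to the chain that starts at
  k, on each half-line separately, and costs the factor 1 / (1 - r).\<close>

lemma antidifference_decay:
  fixes u :: "nat \<Rightarrow> int \<Rightarrow> complex"
  assumes rec: "\<And>k n. u (Suc k) n - u (Suc k) (n + 1) = u k n"
    and bd: "\<And>k. \<exists>B. \<forall>n. norm (u k n) \<le> B * (1 + real_of_int \<bar>n\<bar>) ^ M"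
    and r: "0 < r" "r < 1" and decay: "\<And>n. norm (u 0 n) \<le> D * r ^ nat \<bar>n\<bar>"
  shows "norm (u k n) \<le> D * (1 / (1 - r)) ^ k * r ^ nat \<bar>n\<bar>"
proof (induction k arbitrary: n)
  case 0
  show ?case using decay by simp
next
  case (Suc k0)
  define D' where "D' = D * (1 / (1 - r)) ^ k0"
  have D': "0 \<le> D'" using order_trans[OF norm_ge_zero Suc[of 0]] by (simp add: D'_def)
  have IH: "norm (u k0 n) \<le> D' * r ^ nat \<bar>n\<bar>" for n using Suc unfolding D'_def .
  consider "0 \<le> n" | "n < 0" by linarith
  then show ?case
  proof cases
    case 1
    define v where "v k n = u (k0 + k) (int n)" for k n
    have "norm (v 1 (nat n)) \<le> D' / (1 - r) * r ^ nat n"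
    proof (rule antidifference_decay_nat[OF _ _ r])
      show "v (Suc k) n - v (Suc k) (Suc n) = v k n" for k n
        using rec[of "k0 + k" "int n"] by (simp add: v_def add.commute)
      show "norm (v 0 n) \<le> D' * r ^ n" for n using IH[of "int n"] by (simp add: v_def)
      fix k
      obtain B where "\<And>n. norm (u (k0 + k) n) \<le> B * (1 + real_of_int \<bar>n\<bar>) ^ M" using bd by blast
      from this[of "int _"] show "\<exists>B. \<forall>n. norm (v k n) \<le> B * (1 + real n) ^ M"
        unfolding v_def by (intro exI[of _ B]) simp
    qed
    with 1 show ?thesis by (simp add: v_def D'_def)
  next
    case 2
    \<comment> \<open>Reflection reverses the difference, hence the sign; the shift by
      \<open>k\<close> realigns the recursion. As a result \<open>v 1\<close> at 1 - n is, up to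
      sign, the value sought at \<open>n\<close>, and the exponent 1 - n may be lowered to |n| since
      r < 1.\<close>
    define v where "v k n = (-1) ^ k * u (k0 + k) (int k - int n)" for k n
    define n' where "n' = nat (1 - n)"
    have "norm (v 1 n') \<le> D' / (1 - r) * r ^ n'"
    proof (rule antidifference_decay_nat[OF _ _ r])
      show "v (Suc k) n - v (Suc k) (Suc n) = v k n" for k n
        using rec[of "k0 + k" "int k - int n"] by (simp add: v_def algebra_simps)
      show "norm (v 0 n) \<le> D' * r ^ n" for n using IH[of "- int n"] by (simp add: v_def)
      fix k
      obtain B where B: "\<And>n. norm (u (k0 + k) n) \<le> B * (1 + real_of_int \<bar>n\<bar>) ^ M" using bd by blast
      have B0: "0 \<le> B" using order_trans[OF norm_ge_zero B[of 0]] by simp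
      have "norm (v k n) \<le> (B * (1 + real k) ^ M) * (1 + real n) ^ M" for n
      proof -
        have "norm (v k n) \<le> B * (1 + real_of_int \<bar>int k - int n\<bar>) ^ M"
          using B[of "int k - int n"] by (simp add: v_def norm_mult norm_power)
        also have "\<dots> \<le> B * ((1 + real k) * (1 + real n)) ^ M"
          using B0 by (intro mult_left_mono power_mono) (auto simp: algebra_simps abs_real_def)
        finally show ?thesis by (simp add: power_mult_distrib mult.assoc)
      qed
      then show "\<exists>B. \<forall>n. norm (v k n) \<le> B * (1 + real n) ^ M" by blast
    qed
    also have "\<dots> \<le> D' / (1 - r) * r ^ nat \<bar>n\<bar>"
      using D' r 2 by (intro mult_left_mono power_decreasing) (auto simp: n'_def)
    finally show ?thesis using 2 by (simp add: v_def n'_def D'_def)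
  qed
qed

section \<open>The Laurent series of an antidifference chain\<close>

lemma power_series_bounded_coeffs:
  fixes a :: "nat \<Rightarrow> complex"
  assumes a: "\<And>n. norm (a n) \<le> D * r ^ n" and r: "0 < r"
    and z: "norm z < 1 / r"
  shows "summable (\<lambda>n. a n * z ^ n)" "norm (\<Sum>n. a n * z ^ n) \<le> D / (1 - r * norm z)"
proof -
  have rz: "r * norm z < 1" using r z by (simp add: field_simps)
  have geo: "(\<lambda>n. D * (r * norm z) ^ n) sums (D * (1 / (1 - r * norm z)))"
    by (intro sums_mult geometric_sums) (use r rz in auto)
  have le: "norm (a n * z ^ n) \<le> D * (r * norm z) ^ n" for n
    using mult_right_mono[OF a[of n], of "norm z ^ n"]
    by (simp add: norm_mult norm_power power_mult_distrib mult.assoc)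
  show "summable (\<lambda>n. a n * z ^ n)"
    by (rule summable_comparison_test'[OF sums_summable[OF geo]]) (rule le)
  show "norm (\<Sum>n. a n * z ^ n) \<le> D / (1 - r * norm z)"
    using norm_suminf_le[OF le sums_summable[OF geo]] sums_unique[OF geo] by simp
qed

lemma power_series_bounded_coeffs_holomorphic:
  fixes a :: "nat \<Rightarrow> complex"
  assumes a: "\<And>n. norm (a n) \<le> D * r ^ n" and r: "0 < r"
  shows "(\<lambda>z. \<Sum>n. a n * z ^ n) holomorphic_on ball 0 (1 / r)"
proof (rule power_series_holomorphic)
  fix w :: complex assume "w \<in> ball 0 (1 / r)"
  then show "(\<lambda>n. a n * (w - 0) ^ n) sums (\<Sum>n. a n * w ^ n)"
    using power_series_bounded_coeffs(1)[OF a r, of w] by (simp add: summable_sums)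
qed

text \<open>The Laurent series of \<open>u 0\<close> is \<open>((z - 1) / z) ^ k\<close> times that of \<open>u k\<close>, so it vanishes near 1.\<close>
lemma antidifference_chain_zero_at_0:
  fixes u :: "nat \<Rightarrow> int \<Rightarrow> complex"
  assumes rec: "\<And>k n. u (Suc k) n - u (Suc k) (n + 1) = u k n"
    and r: "0 < r" "r < 1" and q: "0 < q"
    and decay: "\<And>k n. norm (u k n) \<le> D * q ^ k * r ^ nat \<bar>n\<bar>"
  shows "u 0 0 = 0"
proof -
  define a where "a k n = u k (int n)" for k n
  \<comment> \<open>The coefficients of negative index, for a power series in 1/z; index 0 is
    assigned to \<open>a\<close> alone.\<close>
  define b where "b k n = (if n = 0 then 0 else u k (- int n))" for k n
  define A where "A k z = (\<Sum>n. a k n * z ^ n)" for k z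
  define B where "B k z = (\<Sum>n. b k n * z ^ n)" for k z
  have D: "0 \<le> D" using order_trans[OF norm_ge_zero decay[of 0 0]] by simp
  have a: "norm (a k n) \<le> (D * q ^ k) * r ^ n" for k n using decay[of k "int n"] by (simp add: a_def)
  have b: "norm (b k n) \<le> (D * q ^ k) * r ^ n" for k n
    using decay[of k "- int n"] D q r by (simp add: b_def)
  have holA: "A k holomorphic_on ball 0 (1 / r)" for k
    unfolding A_def by (rule power_series_bounded_coeffs_holomorphic[OF a r(1)])
  have holB: "B k holomorphic_on ball 0 (1 / r)" for k
    unfolding B_def by (rule power_series_bounded_coeffs_holomorphic[OF b r(1)])
  \<comment> \<open>Shifting the index inside one half leaves the boundary term
    \<open>u (Suc k) 0\<close>; \<open>recB\<close> produces it with the opposite sign, so that it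
    cancels in \<open>P_rec\<close>.\<close>
  have recA: "z * A k z = (z - 1) * A (Suc k) z + u (Suc k) 0" if z: "norm z < 1 / r" for k z
  proof -
    note s = power_series_bounded_coeffs(1)[OF a r(1) z]
    have aS: "a k n = a (Suc k) n - a (Suc k) (Suc n)" for n
      using rec[of k "int n"] by (simp add: a_def add.commute)
    have "z * A k z = (\<Sum>n. z * (a k n * z ^ n))"
      unfolding A_def by (rule suminf_mult[OF s, symmetric])
    also have "\<dots> = (\<Sum>n. z * (a (Suc k) n * z ^ n) - a (Suc k) (Suc n) * z ^ Suc n)"
      unfolding aS by (simp add: algebra_simps)
    also have "\<dots> = (\<Sum>n. z * (a (Suc k) n * z ^ n)) - (\<Sum>n. a (Suc k) (Suc n) * z ^ Suc n)"
      by (intro suminf_diff[symmetric] summable_mult s) (subst summable_Suc_iff[of "\<lambda>n. a (Suc k) n * z ^ n"], rule s)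
    also have "(\<Sum>n. z * (a (Suc k) n * z ^ n)) = z * A (Suc k) z"
      unfolding A_def by (rule suminf_mult[OF s])
    also have "(\<Sum>n. a (Suc k) (Suc n) * z ^ Suc n) = A (Suc k) z - u (Suc k) 0"
      unfolding A_def using suminf_split_head[OF s[of "Suc k"]] by (simp add: a_def)
    finally show ?thesis by (simp add: algebra_simps)
  qed
  have recB: "B k w = (1 - w) * B (Suc k) w - w * u (Suc k) 0" if w: "norm w < 1 / r" for k w
  proof -
    note s = power_series_bounded_coeffs(1)[OF b r(1) w]
    have bS: "b (Suc k) (Suc n) * w ^ Suc n - b k (Suc n) * w ^ Suc n
        = w * (b (Suc k) n * w ^ n) + (if n = 0 then w * u (Suc k) 0 else 0)" for n
      using rec[of k "- int (Suc n)"] by (auto simp: b_def algebra_simps)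
    have "B (Suc k) w - B k w = (\<Sum>n. b (Suc k) (Suc n) * w ^ Suc n) - (\<Sum>n. b k (Suc n) * w ^ Suc n)"
      unfolding B_def using suminf_split_head[OF s[of "Suc k"]] suminf_split_head[OF s[of k]]
      by (simp add: b_def)
    also have "\<dots> = (\<Sum>n. b (Suc k) (Suc n) * w ^ Suc n - b k (Suc n) * w ^ Suc n)"
      by (intro suminf_diff; subst summable_Suc_iff[of "\<lambda>n. b _ n * w ^ n"]; rule s)
    also have "\<dots> = (\<Sum>n. w * (b (Suc k) n * w ^ n) + (if n = 0 then w * u (Suc k) 0 else 0))"
      unfolding bS ..
    also have "\<dots> = (\<Sum>n. w * (b (Suc k) n * w ^ n)) + (\<Sum>n. if n = 0 then w * u (Suc k) 0 else 0)"
      using s by (intro suminf_add[symmetric] summable_mult) auto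
    also have "(\<Sum>n. w * (b (Suc k) n * w ^ n)) = w * B (Suc k) w"
      unfolding B_def by (rule suminf_mult[OF s])
    also have "(\<Sum>n. if n = 0 then w * u (Suc k) 0 else 0) = w * u (Suc k) 0"
      by (subst suminf_finite[of "{0::nat}"]) auto
    finally show ?thesis by (simp add: algebra_simps)
  qed
  define P where "P k z = A k z + B k (1 / z)" for k z
  have ann: "norm z < 1 / r" "norm (1 / z) < 1 / r" "z \<noteq> 0" if "r < norm z" "norm z < 1 / r" for z :: complex
    using that r less_trans[OF r(1) that(1)] by (auto simp: norm_divide field_simps)
  have P_rec: "P 0 z = ((z - 1) / z) ^ k * P k z" if z: "r < norm z" "norm z < 1 / r" for k z
  proof (induction k)
    case (Suc k)
    note an = ann[OF z]
    have "z * B k (1 / z) = (z - 1) * B (Suc k) (1 / z) - u (Suc k) 0"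
      unfolding recB[OF an(2), of k] using an(3) by (simp add: field_simps)
    then have "z * P k z = (z - 1) * P (Suc k) z"
      unfolding P_def distrib_left recA[OF an(1), of k] by simp
    then have "P k z = (z - 1) / z * P (Suc k) z" using an(3) by (simp add: field_simps)
    with Suc show ?case by simp
  qed simp
  \<comment> \<open>\<open>P k\<close> is bounded by a constant times q^k. Near 1 the factor ((z -
    1) / z)^k beats this growth, and k tending to infinity leaves zero.\<close>
  have P_zero: "P 0 z = 0" if z: "r < norm z" "norm z < 1 / r" and small: "norm ((z - 1) / z) * q < 1" for z
  proof -
    note an = ann[OF z]
    define E where "E = D / (1 - r * norm z) + D / (1 - r * norm (1 / z))"
    have le: "norm (P 0 z) \<le> (norm ((z - 1) / z) * q) ^ k * E" for k
    proof -
      have "norm (P k z) \<le> norm (A k z) + norm (B k (1 / z))" unfolding P_def by (rule norm_triangle_ineq)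
      also have "\<dots> \<le> D * q ^ k / (1 - r * norm z) + D * q ^ k / (1 - r * norm (1 / z))"
        unfolding A_def B_def
        by (intro add_mono power_series_bounded_coeffs(2)[OF a r(1)] power_series_bounded_coeffs(2)[OF b r(1)] an)
      also have "\<dots> = q ^ k * E" by (simp add: E_def algebra_simps)
      finally have "norm ((z - 1) / z) ^ k * norm (P k z) \<le> norm ((z - 1) / z) ^ k * (q ^ k * E)"
        by (intro mult_left_mono) auto
      then show ?thesis by (subst P_rec[OF z, of k]) (simp add: norm_mult norm_power power_mult_distrib mult.assoc)
    qed
    have "(\<lambda>k. (norm ((z - 1) / z) * q) ^ k * E) \<longlonglongrightarrow> 0 * E"
      using q small by (intro tendsto_mult tendsto_const LIMSEQ_realpow_zero) auto
    then have "norm (P 0 z) \<le> 0 * E" by (rule LIMSEQ_le_const) (use le in blast)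
    then show ?thesis by simp
  qed
  \<comment> \<open>The exponential maps this strip onto the annulus. The strip is convex, hence
    connected, so the identity theorem applies on it; its point 0 corresponds to z = 1.\<close>
  define S where "S = {w. Re w > ln r \<and> Re w < - ln r}"
  have S: "open S" "convex S" "0 \<in> S"
  proof -
    have "S = {w. Re w > ln r} \<inter> {w. Re w < - ln r}" by (auto simp: S_def)
    then show "open S" "convex S" 
      by (auto intro!: open_Int open_halfspace_Re_gt open_halfspace_Re_lt convex_Int
            convex_halfspace_Re_gt convex_halfspace_Re_lt)
    show "0 \<in> S" using r by (simp add: S_def)
  qed
  have expS: "r < norm (exp w)" "norm (exp w) < 1 / r" if "w \<in> S" for w
    using that r ln_less_cancel_iff[of r "exp (Re w)"] ln_less_cancel_iff[of "exp (Re w)" "1 / r"]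
    by (auto simp: S_def ln_div)
  have expS': "norm (1 / exp w) < 1 / r" if "w \<in> S" for w
    by (rule ann(2)[OF expS[OF that]])
  have hol: "(\<lambda>w. P 0 (exp w)) holomorphic_on S"
    unfolding P_def
    by (intro holomorphic_intros holomorphic_on_compose_gen[OF _ holA, unfolded o_def]
        holomorphic_on_compose_gen[OF _ holB, unfolded o_def]) (use expS expS' in \<open>auto simp: norm_divide\<close>)
  define U where "U = {w. norm ((exp w - 1) / exp w) * q < 1} \<inter> S"
  have "open U"
    unfolding U_def by (intro open_Int S(1) open_Collect_less continuous_intros) auto
  moreover have "0 \<in> U" using S by (simp add: U_def)
  ultimately have isl: "0 islimpt U" by (rule open_imp_islimpt)
  have P0: "P 0 (exp w) = 0" if "w \<in> S" for w
    by (rule analytic_continuation[OF hol S(1) convex_connected[OF S(2)] _ S(3) isl _ that])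
      (use P_zero expS in \<open>auto simp: U_def\<close>)
  have P0': "P 0 z = 0" if "r < norm z" "norm z < 1 / r" for z
  proof -
    have z: "z \<noteq> 0" using that r by auto
    have "ln r < ln (norm z)" "ln (norm z) < ln (1 / r)" using that r z by (auto simp: ln_less_cancel_iff)
    then have "Ln z \<in> S" using z r by (simp add: S_def ln_div)
    from P0[OF this] z show ?thesis by simp
  qed
  \<comment> \<open>Vanishing of \<open>P 0\<close> says that the two halves agree up to sign on the
    annulus, so they glue to an entire function. It tends to zero at infinity because
    \<open>B 0\<close> vanishes at 0, so Liouville's theorem gives g = 0; its value at 0 is
    \<open>u 0 0\<close>.\<close>
  define g where "g z = (if z \<in> ball 0 (1 / r) then A 0 z else - B 0 (1 / z))" for z
  have "g holomorphic_on (ball 0 (1 / r) \<union> {z. r < norm z})"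
    unfolding g_def
  proof (rule holomorphic_on_If_Un[OF holA])
    show "(\<lambda>z. - B 0 (1 / z)) holomorphic_on {z. r < norm z}"
    proof (intro holomorphic_intros holomorphic_on_compose_gen[OF _ holB, unfolded o_def] subsetI)
      fix w assume "w \<in> (\<lambda>z. 1 / z) ` {z::complex. r < norm z}"
      then obtain z :: complex where z: "r < norm z" "w = 1 / z" by blast
      then have "1 / norm z < 1 / r" using r by (intro divide_strict_left_mono mult_pos_pos) auto
      with z show "w \<in> ball 0 (1 / r)" by (simp add: norm_divide)
    qed (use r in auto)
    show "open {z::complex. r < norm z}" by (intro open_Collect_less continuous_intros)
    show "A 0 z = - B 0 (1 / z)" if "z \<in> ball 0 (1 / r)" "z \<in> {z. r < norm z}" for z
      using P0'[of z] that by (simp add: P_def eq_neg_iff_add_eq_0)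
  qed auto
  moreover have "r < 1 / r" using r mult_strict_mono[of r 1 r 1] by (simp add: field_simps)
  then have "ball 0 (1 / r) \<union> {z. r < norm z} = (UNIV :: complex set)" by force
  ultimately have gU: "g holomorphic_on UNIV" by simp
  have B00: "B 0 0 = 0" by (simp add: B_def b_def)
  have "isCont (B 0) 0"
    using holomorphic_on_imp_continuous_on[OF holB[of 0]] r
    by (simp add: continuous_on_eq_continuous_at)
  from isCont_tendsto_compose[OF this tendsto_inverse_0]
  have "((\<lambda>z. B 0 (inverse z)) \<longlongrightarrow> 0) at_infinity" by (simp add: B00)
  then have "((\<lambda>z. - B 0 (inverse z)) \<longlongrightarrow> - 0) at_infinity" by (rule tendsto_minus)
  moreover have "eventually (\<lambda>z. - B 0 (inverse z) = g z) at_infinity"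
    unfolding eventually_at_infinity by (rule exI[of _ "1 / r"]) (auto simp: g_def divide_inverse)
  ultimately have "(g \<longlongrightarrow> 0) at_infinity" using tendsto_cong by fastforce
  then have "g 0 = 0" by (rule Liouville_weak_0[OF gU])
  then show ?thesis using r by (simp add: g_def A_def a_def)
qed

text \<open>A constant geometric in \<open>k\<close> is what the Laurent argument tolerates: it only
  shrinks the neighbourhood of 1 in which the series is first seen to vanish. Translation by
  \<open>m\<close> preserves the recursion, and |n| <= |n + m| + |m| accounts for
  \<open>D'\<close>.\<close>

theorem antidifference_chain_zero:
  fixes u :: "nat \<Rightarrow> int \<Rightarrow> complex"
  assumes rec: "\<And>k n. u (Suc k) n - u (Suc k) (n + 1) = u k n"
    and bd: "\<And>k. \<exists>B. \<forall>n. norm (u k n) \<le> B * (1 + real_of_int \<bar>n\<bar>) ^ M"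
    and r: "0 < r" "r < 1" and decay: "\<And>n. norm (u 0 n) \<le> D * r ^ nat \<bar>n\<bar>"
  shows "u 0 m = 0"
proof -
  note dec = antidifference_decay[OF rec bd r decay]
  have D: "0 \<le> D" using order_trans[OF norm_ge_zero decay[of 0]] by simp
  define q where "q = 1 / (1 - r)"
  have q: "0 < q" using r by (simp add: q_def)
  define u' where "u' k n = u k (n + m)" for k n
  define D' where "D' = D / r ^ nat \<bar>m\<bar>"
  have "u' 0 0 = 0"
  proof (rule antidifference_chain_zero_at_0[OF _ r q])
    show "u' (Suc k) n - u' (Suc k) (n + 1) = u' k n" for k n
      using rec[of k "n + m"] by (simp add: u'_def algebra_simps)
    fix k n
    have "norm (u' k n) \<le> D * q ^ k * r ^ nat \<bar>n + m\<bar>" using dec unfolding u'_def q_def .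
    also have "\<dots> = (D * q ^ k / r ^ nat \<bar>m\<bar>) * r ^ (nat \<bar>n + m\<bar> + nat \<bar>m\<bar>)"
      using r by (simp add: power_add)
    also have "\<dots> \<le> (D * q ^ k / r ^ nat \<bar>m\<bar>) * r ^ nat \<bar>n\<bar>"
      using D q r by (intro mult_left_mono power_decreasing) auto
    finally show "norm (u' k n) \<le> D' * q ^ k * r ^ nat \<bar>n\<bar>" by (simp add: D'_def)
  qed
  then show ?thesis by (simp add: u'_def)
qed

section \<open>The Fourier transform on the Schwartz space\<close>

abbreviation freq :: "real \<Rightarrow> complex" where
  "freq s \<equiv> 2 * of_real pi * \<i> * of_real s"

definition wave :: "real \<Rightarrow> real \<Rightarrow> complex" where
  "wave s x = exp (freq s * of_real x)"

lemma wave_iexp: "wave s x = iexp (2 * pi * s * x)"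
  by (simp add: wave_def mult_ac)

lemma norm_wave [simp]: "norm (wave s x) = 1"
  by (simp add: wave_iexp)

lemma wave_commute: "wave s x = wave x s"
  by (simp add: wave_def mult_ac)

lemma wave_add: "wave (s + t) x = wave s x * wave t x"
  by (simp add: wave_def exp_add[symmetric] algebra_simps)

lemma wave_0 [simp]: "wave 0 x = 1"
  by (simp add: wave_def)

lemma continuous_wave [continuous_intros]:
  "continuous_on S f \<Longrightarrow> continuous_on S g \<Longrightarrow> continuous_on S (\<lambda>x. wave (f x) (g x))"
  unfolding wave_def by (intro continuous_intros)

lemma borel_measurable_wave [measurable]:
  assumes [measurable]: "f \<in> borel_measurable M" "g \<in> borel_measurable M"
  shows "(\<lambda>x. wave (f x) (g x)) \<in> borel_measurable M"
  unfolding wave_def by measurable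

lemma wave_has_deriv:
  "((\<lambda>x. freq s ^ k * wave s x) has_vector_derivative
     freq s ^ Suc k * wave s x) (at x)"
proof -
  have "((\<lambda>z. freq s ^ k * exp (freq s * z)) has_field_derivative
     freq s ^ Suc k * exp (freq s * of_real x)) (at (of_real x))"
    by (auto intro!: derivative_eq_intros)
  from has_vector_derivative_real_field[OF this] show ?thesis by (simp add: wave_def)
qed

lemma nth_deriv_wave: "nth_deriv k (wave s) = (\<lambda>x. freq s ^ k * wave s x)"
  and smooth_wave: "smooth (wave s)"
  using nth_deriv_unique[of "\<lambda>k x. freq s ^ k * wave s x" k, OF wave_has_deriv]
    smooth_nth_deriv_sequence[of "\<lambda>k x. freq s ^ k * wave s x", OF wave_has_deriv]
  by simp_all

text \<open>The inverse Fourier transform. Estimates are made for it, and \<open>fourier\<close> is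
  treated as its reflection.\<close>

definition ift :: "(real \<Rightarrow> complex) \<Rightarrow> real \<Rightarrow> complex" where
  "ift f x = (LINT t|lborel. wave x t * f t)"

lemma fourier_eq_ift: "fourier f x = ift f (- x)"
  by (simp add: fourier_def ift_def wave_def mult_ac)

lemma integrable_wave_mult:
  "integrable lborel f \<Longrightarrow> integrable lborel (\<lambda>t. wave x t * f t)"
  by (rule Bochner_Integration.integrable_bound[of _ f]) (auto simp: norm_mult)

lemma norm_ift_le:
  assumes "integrable lborel f"
  shows "norm (ift f x) \<le> (LINT t|lborel. norm (f t))"
  unfolding ift_def using integral_norm_bound[of lborel "\<lambda>t. wave x t * f t"] by (simp add: norm_mult)

lemma ift_add: "integrable lborel f \<Longrightarrow> integrable lborel g \<Longrightarrow> ift (\<lambda>t. f t + g t) x = ift f x + ift g x"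
  unfolding ift_def by (simp add: distrib_left integrable_wave_mult)

lemma ift_diff: "integrable lborel f \<Longrightarrow> integrable lborel g \<Longrightarrow> ift (\<lambda>t. f t - g t) x = ift f x - ift g x"
  unfolding ift_def by (simp add: right_diff_distrib integrable_wave_mult)

lemma ift_cmult: "ift (\<lambda>t. c * f t) x = c * ift f x"
  unfolding ift_def by (subst integral_mult_right_zero[symmetric]) (simp add: mult_ac)

text \<open>A quadratic error term gives differentiability with an explicit derivative. It is used
  for \<open>ift\<close>, for the flat functions at the integers, and to prove a function
  constant.\<close>

lemma has_vector_derivative_quadratic:
  fixes g :: "real \<Rightarrow> complex"
  assumes "\<And>y. norm (g y - g x - of_real (y - x) * d) \<le> K * (y - x)\<^sup>2"
  shows "(g has_vector_derivative d) (at x)"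
proof -
  have lim: "((\<lambda>y. K * \<bar>y - x\<bar>) \<longlongrightarrow> 0) (at x)"
    by (rule tendsto_eq_intros refl | simp)+
  have "((\<lambda>y. (g y - g x - (y - x) *\<^sub>R d) /\<^sub>R norm (y - x)) \<longlongrightarrow> 0) (at x)"
  proof (rule Lim_null_comparison[OF _ lim])
    show "\<forall>\<^sub>F y in at x. norm ((g y - g x - (y - x) *\<^sub>R d) /\<^sub>R norm (y - x)) \<le> K * \<bar>y - x\<bar>"
    proof (rule eventually_at_filter[THEN iffD2], intro always_eventually allI impI)
      fix y assume "y \<noteq> x"
      then show "norm ((g y - g x - (y - x) *\<^sub>R d) /\<^sub>R norm (y - x)) \<le> K * \<bar>y - x\<bar>"
        using assms[of y] by (simp add: scaleR_conv_of_real divide_simps power2_eq_square abs_mult mult.assoc norm_divide)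
    qed
  qed
  then show ?thesis
    unfolding has_vector_derivative_def has_derivative_at_within
    by (simp add: bounded_linear_scaleR_left divide_inverse mult.commute)
qed

text \<open>Smoothness is not included: sharp frequency cut-offs of Schwartz functions have to
  qualify, and integrable moments are enough to differentiate under the integral.\<close>

definition rapid :: "(real \<Rightarrow> complex) \<Rightarrow> bool" where
  "rapid f \<longleftrightarrow> (\<forall>k. integrable lborel (\<lambda>t. freq t ^ k * f t))"

lemma rapidD: "rapid f \<Longrightarrow> integrable lborel (\<lambda>t. freq t ^ k * f t)"
  by (simp add: rapid_def)

lemma rapid_integrable: "rapid f \<Longrightarrow> integrable lborel f"
  using rapidD[of f 0] by simp

lemma rapid_moment: "rapid f \<Longrightarrow> rapid (\<lambda>t. freq t ^ j * f t)"
  unfolding rapid_def by (auto simp: mult.assoc[symmetric] power_add[symmetric])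

text \<open>The Taylor estimate of \<open>iexp\<close> with quadratic error is integrated against
  the second moment of \<open>f\<close>.\<close>

lemma ift_has_deriv:
  assumes f: "rapid f"
  shows "(ift f has_vector_derivative ift (\<lambda>t. freq t * f t) x) (at x)"
proof (rule has_vector_derivative_quadratic)
  fix y
  note i0 = rapid_integrable[OF f] and i1 = rapidD[OF f, of 1] and i2 = rapidD[OF f, of 2]
  have i1': "integrable lborel (\<lambda>t. freq t * f t)" using i1 by simp
  have ia: "integrable lborel (\<lambda>t. wave y t * f t)" and ib: "integrable lborel (\<lambda>t. wave x t * f t)"
    and ic: "integrable lborel (\<lambda>t. of_real (y - x) * (wave x t * (freq t * f t)))"
    by (intro integrable_mult_right integrable_wave_mult i0 i1')+
  let ?D = "\<lambda>t. wave y t * f t - wave x t * f t - of_real (y - x) * (wave x t * (freq t * f t))"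
  have "ift f y - ift f x - of_real (y - x) * ift (\<lambda>t. freq t * f t) x = (LINT t|lborel. ?D t)"
    unfolding ift_def
    using Bochner_Integration.integral_diff[OF Bochner_Integration.integrable_diff[OF ia ib] ic]
      Bochner_Integration.integral_diff[OF ia ib] by simp
  also have "norm \<dots> \<le> (LINT t|lborel. norm (freq t ^ 2 * f t) * (y - x)\<^sup>2)"
  proof (rule order_trans[OF integral_norm_bound], rule integral_mono)
    show "integrable lborel (\<lambda>t. norm (?D t))"
      by (intro integrable_norm ia ib ic Bochner_Integration.integrable_diff)
    show "integrable lborel (\<lambda>t. norm (freq t ^ 2 * f t) * (y - x)\<^sup>2)"
      by (intro integrable_mult_left integrable_norm i2)
    fix t
    define \<theta> where "\<theta> = 2 * pi * (y - x) * t"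
    have "wave y t = wave x t * iexp \<theta>"
      by (simp add: wave_iexp exp_add[symmetric] \<theta>_def algebra_simps)
    then have "?D t = wave x t * (iexp \<theta> - (1 + \<i> * \<theta>)) * f t"
      by (simp add: \<theta>_def algebra_simps)
    also have "norm \<dots> = norm (iexp \<theta> - (\<Sum>k\<le>1. (\<i> * \<theta>) ^ k / fact k)) * norm (f t)"
      by (simp add: norm_mult)
    also have "\<dots> \<le> (\<bar>\<theta>\<bar> ^ Suc 1 / fact (Suc 1)) * norm (f t)"
      by (intro mult_right_mono iexp_approx1) simp
    also have "\<dots> \<le> \<theta>\<^sup>2 * norm (f t)" by (intro mult_right_mono) (simp_all add: power2_eq_square[symmetric])
    also have "\<dots> = norm (freq t ^ 2 * f t) * (y - x)\<^sup>2"
      by (simp add: \<theta>_def norm_mult norm_power power_mult_distrib)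
    finally show "norm (?D t) \<le> norm (freq t ^ 2 * f t) * (y - x)\<^sup>2" .
  qed
  finally have "norm (ift f y - ift f x - of_real (y - x) * ift (\<lambda>t. freq t * f t) x)
     \<le> (LINT t|lborel. norm (freq t ^ 2 * f t) * (y - x)\<^sup>2)" .
  then show "norm (ift f y - ift f x - of_real (y - x) * ift (\<lambda>t. freq t * f t) x)
     \<le> (LINT t|lborel. norm (freq t ^ 2 * f t)) * (y - x)\<^sup>2" by simp
qed

lemma nth_deriv_ift:
  assumes f: "rapid f"
  shows "nth_deriv k (ift f) = ift (\<lambda>t. freq t ^ k * f t)" "smooth (ift f)"
proof -
  have "(ift (\<lambda>t. freq t ^ k * f t) has_vector_derivative
      ift (\<lambda>t. freq t ^ Suc k * f t) x) (at x)" for k x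
    using ift_has_deriv[OF rapid_moment[OF f, of k], of x] by (simp add: mult.assoc)
  note nth_deriv_unique[of "\<lambda>k. ift (\<lambda>t. freq t ^ k * f t)", OF this]
    smooth_nth_deriv_sequence[of "\<lambda>k. ift (\<lambda>t. freq t ^ k * f t)", OF this]
  then show "nth_deriv k (ift f) = ift (\<lambda>t. freq t ^ k * f t)" "smooth (ift f)"
    by simp_all
qed

section \<open>Seminorm bounds under multiplication by the variable and under
  \<open>ift\<close>\<close>

definition schwartz_le :: "nat \<Rightarrow> (real \<Rightarrow> complex) \<Rightarrow> real \<Rightarrow> bool" where
  "schwartz_le M f B \<longleftrightarrow> (\<forall>m\<le>M. \<forall>k\<le>M. \<forall>x. \<bar>x\<bar> ^ m * norm (nth_deriv k f x) \<le> B)"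

lemma schwartz_leD: "schwartz_le M f B \<Longrightarrow> m \<le> M \<Longrightarrow> k \<le> M \<Longrightarrow> \<bar>x\<bar> ^ m * norm (nth_deriv k f x) \<le> B"
  by (simp add: schwartz_le_def)

lemma schwartz_bounded_iff:
  "schwartz_bounded T M C \<longleftrightarrow> (\<forall>f\<in>schwartz_space. \<forall>B. schwartz_le M f B \<longrightarrow> norm (T f) \<le> C * B)"
  by (simp add: schwartz_bounded_def schwartz_le_def)

lemma schwartz_le_mono: "schwartz_le M f B \<Longrightarrow> M' \<le> M \<Longrightarrow> schwartz_le M' f B"
  by (simp add: schwartz_le_def)

lemma schwartz_le_nonneg: "schwartz_le M f B \<Longrightarrow> 0 \<le> B"
  using schwartz_leD[of M f B 0 0 0] by (auto intro: order_trans[OF norm_ge_zero])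

lemma schwartz_iff_le: "f \<in> schwartz_space \<longleftrightarrow> smooth f \<and> (\<forall>M. \<exists>B. schwartz_le M f B)"
proof (intro iffI conjI allI)
  fix M assume f: "f \<in> schwartz_space"
  then obtain b where b: "\<And>m k x. \<bar>x\<bar> ^ m * norm (nth_deriv k f x) \<le> b m k"
    using schwartzD(2)[OF f] by metis
  have "schwartz_le M f (\<Sum>m\<le>M. \<Sum>k\<le>M. \<bar>b m k\<bar>)"
    unfolding schwartz_le_def
  proof (intro allI impI)
    fix m k x assume mk: "m \<le> M" "k \<le> M"
    have "\<bar>x\<bar> ^ m * norm (nth_deriv k f x) \<le> \<bar>b m k\<bar>" using b[of x m k] by simp
    also have "\<dots> \<le> (\<Sum>k\<le>M. \<bar>b m k\<bar>)" using mk by (intro member_le_sum) auto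
    also have "\<dots> \<le> (\<Sum>m\<le>M. \<Sum>k\<le>M. \<bar>b m k\<bar>)"
      using mk by (intro member_le_sum[of m _ "\<lambda>m. \<Sum>k\<le>M. \<bar>b m k\<bar>"]) (auto intro: sum_nonneg)
    finally show "\<bar>x\<bar> ^ m * norm (nth_deriv k f x) \<le> (\<Sum>m\<le>M. \<Sum>k\<le>M. \<bar>b m k\<bar>)" .
  qed
  then show "\<exists>B. schwartz_le M f B" by blast
next
  assume "smooth f \<and> (\<forall>M. \<exists>B. schwartz_le M f B)"
  then show "f \<in> schwartz_space"
    unfolding schwartz_space_iff schwartz_le_def by (meson max.cobounded1 max.cobounded2)
qed (simp add: schwartzD)

lemma schwartz_le_nth_deriv: "schwartz_le (M + j) f B \<Longrightarrow> schwartz_le M (nth_deriv j f) B"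
  by (simp add: schwartz_le_def nth_deriv_nth_deriv)

text \<open>Corresponds to differentiation under \<open>ift\<close>. As an operator it can be
  iterated, so powers of \<open>freq t\<close> reduce to a one-step estimate.\<close>

definition xmul :: "(real \<Rightarrow> complex) \<Rightarrow> real \<Rightarrow> complex" where
  "xmul f t = freq t * f t"

lemma linear_fun_has_deriv:
  "nth_deriv k (\<lambda>t. c * of_real t) = (if k = 0 then \<lambda>t. c * of_real t else if k = 1 then \<lambda>t. c else (\<lambda>t. 0))"
  and smooth_linear_fun: "smooth (\<lambda>t. c * of_real t)"
proof -
  let ?D = "\<lambda>k. if k = 0 then (\<lambda>t::real. c * of_real t) else if k = 1 then (\<lambda>t. c) else (\<lambda>t. 0)"
  have "(?D k has_vector_derivative ?D (Suc k) x) (at x)" for k x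
    by (cases "k = 0"; cases "k = 1") (auto intro!: derivative_eq_intros simp: scaleR_conv_of_real)
  note nth_deriv_unique[of ?D, OF this] smooth_nth_deriv_sequence[of ?D, OF this]
  then show "nth_deriv k (\<lambda>t. c * of_real t) = (if k = 0 then \<lambda>t. c * of_real t else if k = 1 then \<lambda>t. c else (\<lambda>t. 0))"
    "smooth (\<lambda>t. c * of_real t)" by (auto split: if_splits)
qed

lemma smooth_xmul: "smooth f \<Longrightarrow> smooth (xmul f)"
  unfolding xmul_def[abs_def] by (intro smooth_mult smooth_linear_fun)

lemma schwartz_le_xmul:
  assumes f: "smooth f" and B: "schwartz_le (Suc M) f B"
  shows "schwartz_le M (xmul f) (2 ^ M * (2 * pi) * (real M + 1) * (2 * B))"
  unfolding schwartz_le_def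
proof (intro allI impI)
  fix m k x assume mk: "m \<le> M" "k \<le> M"
  have B0: "0 \<le> B" by (rule schwartz_le_nonneg[OF B])
  define b where "b = (\<Sum>j\<le>k. norm (nth_deriv j f x))"
  have "norm (nth_deriv k (xmul f) x) \<le> 2 ^ k * (2 * pi * (1 + \<bar>x\<bar>)) * b"
    unfolding xmul_def[abs_def]
  proof (rule nth_deriv_mult_bound[OF smooth_linear_fun f])
    show "norm (nth_deriv j (\<lambda>t. freq t) x) \<le> 2 * pi * (1 + \<bar>x\<bar>)" for j
      by (simp add: linear_fun_has_deriv norm_mult)
    show "norm (nth_deriv j f x) \<le> b" if "j \<le> k" for j
      unfolding b_def using that by (intro member_le_sum) auto
  qed
  then have "\<bar>x\<bar> ^ m * norm (nth_deriv k (xmul f) x) \<le> \<bar>x\<bar> ^ m * (2 ^ k * (2 * pi * (1 + \<bar>x\<bar>)) * b)"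
    by (intro mult_left_mono) auto
  also have "\<dots> = 2 ^ k * (2 * pi) * (\<Sum>j\<le>k. \<bar>x\<bar> ^ m * norm (nth_deriv j f x) + \<bar>x\<bar> ^ Suc m * norm (nth_deriv j f x))"
    unfolding b_def by (simp add: sum_distrib_left algebra_simps sum.distrib)
  also have "\<dots> \<le> 2 ^ k * (2 * pi) * (\<Sum>j\<le>k. B + B)"
    by (intro mult_left_mono sum_mono add_mono schwartz_leD[OF B]) (use mk in auto)
  also have "\<dots> = 2 ^ k * (2 * pi) * (real k + 1) * (2 * B)" by simp
  also have "\<dots> \<le> 2 ^ M * (2 * pi) * (real M + 1) * (2 * B)"
    using mk B0 by (intro mult_mono power_increasing) auto
  finally show "\<bar>x\<bar> ^ m * norm (nth_deriv k (xmul f) x) \<le> 2 ^ M * (2 * pi) * (real M + 1) * (2 * B)" .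
qed

lemma schwartz_xmul: "f \<in> schwartz_space \<Longrightarrow> xmul f \<in> schwartz_space"
  unfolding schwartz_iff_le by (meson schwartz_le_xmul smooth_xmul)

lemma xmul_funpow: "(xmul ^^ k) f = (\<lambda>t. freq t ^ k * f t)"
  by (induction k) (auto simp: xmul_def mult.assoc)

lemma schwartz_xmul_funpow: "f \<in> schwartz_space \<Longrightarrow> (xmul ^^ k) f \<in> schwartz_space"
  by (induction k) (auto intro: schwartz_xmul)

lemma schwartz_le_xmul_funpow:
  "\<exists>K. \<forall>f\<in>schwartz_space. \<forall>B. schwartz_le (M + k) f B \<longrightarrow> schwartz_le M ((xmul ^^ k) f) (K * B)"
proof (induction k arbitrary: M)
  case 0
  show ?case by (intro exI[of _ 1]) simp
next
  case (Suc k)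
  obtain K where K: "\<And>f B. f \<in> schwartz_space \<Longrightarrow> schwartz_le (Suc M + k) f B \<Longrightarrow> schwartz_le (Suc M) ((xmul ^^ k) f) (K * B)"
    using Suc[of "Suc M"] by blast
  show ?case
  proof (intro exI ballI allI impI)
    fix f B assume f: "f \<in> schwartz_space" and B: "schwartz_le (M + Suc k) f B"
    have "schwartz_le M (xmul ((xmul ^^ k) f)) (2 ^ M * (2 * pi) * (real M + 1) * (2 * (K * B)))"
      by (intro schwartz_le_xmul schwartzD(1) schwartz_xmul_funpow f K) (use B in simp)
    then show "schwartz_le M ((xmul ^^ Suc k) f) ((2 ^ M * (2 * pi) * (real M + 1) * 2 * K) * B)"
      by (simp add: mult_ac)
  qed
qed

lemma integrable_inverse_square: "integrable lborel (\<lambda>x::real. inverse (1 + x\<^sup>2))"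
  and integral_inverse_square: "(LINT x|lborel. inverse (1 + x\<^sup>2)) = pi"
  using integrable_inverse_1_plus_square LBINT_inverse_1_plus_square
  by (simp_all add: set_integrable_def interval_lebesgue_integral_def set_lebesgue_integral_def)

text \<open>Comparison with 1 / (1 + t^2), whose integral is pi; the factor 2 comes from adding the
  two bounds.\<close>

lemma integrable_schwartz_le:
  fixes f :: "real \<Rightarrow> complex"
  assumes f: "f \<in> borel_measurable borel" and B: "\<And>t. norm (f t) \<le> B" "\<And>t. \<bar>t\<bar> ^ 2 * norm (f t) \<le> B"
  shows "integrable lborel f" "(LINT t|lborel. norm (f t)) \<le> 2 * pi * B"
proof -
  have le: "norm (f t) \<le> 2 * B * inverse (1 + t\<^sup>2)" for t
  proof -
    have "0 < 1 + t\<^sup>2" by (simp add: add_pos_nonneg)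
    moreover have "(1 + t\<^sup>2) * norm (f t) \<le> 2 * B" using B[of t] by (simp add: algebra_simps)
    ultimately show ?thesis by (simp add: field_simps)
  qed
  have i: "integrable lborel (\<lambda>t. 2 * B * inverse (1 + t\<^sup>2))"
    by (intro integrable_mult_right integrable_inverse_square)
  show int: "integrable lborel f"
    by (rule Bochner_Integration.integrable_bound[OF i]) (use f le in \<open>auto intro: order_trans[OF _ abs_ge_self]\<close>)
  have "(LINT t|lborel. norm (f t)) \<le> (LINT t|lborel. 2 * B * inverse (1 + t\<^sup>2))"
    by (intro integral_mono integrable_norm int i le)
  also have "\<dots> = 2 * pi * B" by (simp add: integral_inverse_square)
  finally show "(LINT t|lborel. norm (f t)) \<le> 2 * pi * B" .
qed

lemma schwartz_integrable:
  assumes "f \<in> schwartz_space"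
  shows "integrable lborel f"
proof -
  obtain B where B: "schwartz_le 2 f B" using assms by (auto simp: schwartz_iff_le)
  show ?thesis
    by (rule integrable_schwartz_le(1)[of _ B])
      (use smooth_borel[OF schwartzD(1)[OF assms]] schwartz_leD[OF B, of 0 0] schwartz_leD[OF B, of 2 0] in auto)
qed

lemma schwartz_rapid: "f \<in> schwartz_space \<Longrightarrow> rapid f"
  unfolding rapid_def using schwartz_integrable[OF schwartz_xmul_funpow] by (simp add: xmul_funpow)

lemma norm_ift_schwartz_le:
  assumes f: "f \<in> schwartz_space" and B: "schwartz_le 2 f B"
  shows "norm (ift f x) \<le> 2 * pi * B"
proof -
  have "norm (ift f x) \<le> (LINT t|lborel. norm (f t))" by (rule norm_ift_le[OF schwartz_integrable[OF f]])
  also have "\<dots> \<le> 2 * pi * B"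
    by (rule integrable_schwartz_le(2)[of _ B])
      (use smooth_borel[OF schwartzD(1)[OF f]] schwartz_leD[OF B, of 0 0] schwartz_leD[OF B, of 2 0] in auto)
  finally show ?thesis .
qed

lemma schwartz_tendsto_zero:
  assumes f: "f \<in> schwartz_space"
  shows "(f \<longlongrightarrow> 0) at_top" "(f \<longlongrightarrow> 0) at_bot"
proof -
  obtain B where B: "\<And>t. \<bar>t\<bar> ^ 1 * norm (nth_deriv 0 f t) \<le> B" using schwartzD(2)[OF f, of 1 0] by blast
  then have B: "norm (f t) \<le> B / \<bar>t\<bar>" if "t \<noteq> 0" for t using B[of t] that by (simp add: field_simps)
  have lim: "((\<lambda>t. B / \<bar>t\<bar>) \<longlongrightarrow> 0) at_top" "((\<lambda>t. B / \<bar>t\<bar>) \<longlongrightarrow> 0) at_bot"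
    by (intro tendsto_divide_0[OF tendsto_const] filterlim_at_top_imp_at_infinity filterlim_abs_real
          filterlim_compose[OF filterlim_norm_at_top[where 'a = real, unfolded real_norm_def]] filterlim_at_bot_imp_at_infinity filterlim_ident)+
  show "(f \<longlongrightarrow> 0) at_top"
    by (rule Lim_null_comparison[OF _ lim(1)])
      (rule eventually_mono[OF eventually_gt_at_top[of 0]], rule B, simp)
  show "(f \<longlongrightarrow> 0) at_bot"
    by (rule Lim_null_comparison[OF _ lim(2)])
      (rule eventually_mono[OF eventually_at_bot_linorder[THEN iffD2, of "\<lambda>t. t \<noteq> 0"]], fastforce intro: exI[of _ "-1"], rule B, simp)
qed

text \<open>Integration by parts; the boundary terms vanish because \<open>f\<close> tends to zero
  at both ends.\<close>

lemma ift_deriv: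
  assumes f: "f \<in> schwartz_space"
  shows "ift (nth_deriv 1 f) x = - freq x * ift f x"
proof -
  let ?c = "freq x"
  have f': "nth_deriv 1 f \<in> schwartz_space" by (rule schwartz_nth_deriv[OF f])
  define F' where "F' t = ?c * (wave x t * f t) + wave x t * nth_deriv 1 f t" for t
  have int: "integrable lborel F'"
    unfolding F'_def
    by (intro Bochner_Integration.integrable_add integrable_mult_right integrable_wave_mult
        schwartz_integrable[OF f] schwartz_integrable[OF f'])
  have "(LBINT t=-\<infinity>..\<infinity>. F' t) = 0 - 0"
  proof (rule interval_integral_FTC_integrable[where F = "\<lambda>t. wave x t * f t"])
    show "((\<lambda>t. wave x t * f t) has_vector_derivative F' t) (at t)" for t
      using has_vector_derivative_mult[OF wave_has_deriv[of x 0 t] smooth_has_deriv[OF schwartzD(1)[OF f], of 0 t]]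
      by (simp add: F'_def mult_ac add.commute)
    have "continuous_on UNIV F'"
      unfolding F'_def by (intro continuous_intros smooth_continuous schwartzD(1) f f')
    then show "isCont F' t" for t by (simp add: continuous_on_eq_continuous_at)
    show "set_integrable lborel (einterval (- \<infinity>) \<infinity>) F'" using int by (simp add: set_integrable_def)
    have n: "norm (wave x t * f t) = norm (f t)" for t by (simp add: norm_mult)
    show "(((\<lambda>t. wave x t * f t) \<circ> real_of_ereal) \<longlongrightarrow> 0) (at_right (- \<infinity>))"
      unfolding ereal_tendsto_simps using schwartz_tendsto_zero(2)[OF f]
      by (subst tendsto_norm_zero_iff[symmetric]) (simp add: n tendsto_norm_zero)
    show "(((\<lambda>t. wave x t * f t) \<circ> real_of_ereal) \<longlongrightarrow> 0) (at_left \<infinity>)"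
      unfolding ereal_tendsto_simps using schwartz_tendsto_zero(1)[OF f]
      by (subst tendsto_norm_zero_iff[symmetric]) (simp add: n tendsto_norm_zero)
  qed simp
  then have "(LINT t|lborel. F' t) = 0"
    by (simp add: interval_lebesgue_integral_def set_lebesgue_integral_def)
  also have "(LINT t|lborel. F' t) = ?c * ift f x + ift (nth_deriv 1 f) x"
    unfolding F'_def ift_def
    using Bochner_Integration.integral_add[OF integrable_mult_right[OF integrable_wave_mult[OF schwartz_integrable[OF f], of x], of ?c]
        integrable_wave_mult[OF schwartz_integrable[OF f'], of x]] by simp
  finally show ?thesis by (simp add: eq_neg_iff_add_eq_0 add.commute)
qed

lemma ift_nth_deriv:
  assumes f: "f \<in> schwartz_space"
  shows "ift (nth_deriv k f) x = (- freq x) ^ k * ift f x"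
proof (induction k)
  case (Suc k)
  have "nth_deriv (Suc k) f = nth_deriv 1 (nth_deriv k f)"
    by (simp add: nth_deriv_nth_deriv)
  then show ?case using ift_deriv[OF schwartz_nth_deriv[OF f, of k], of x] Suc by simp
qed simp

text \<open>The order 2 M + 2 consists of at most M weights produced by differentiating the
  integral, at most M derivatives traded for powers of x by integration by parts, and two weights
  for integrability.\<close>

lemma schwartz_le_ift:
  "\<exists>K. \<forall>f\<in>schwartz_space. \<forall>B. schwartz_le (2 * M + 2) f B \<longrightarrow> schwartz_le M (ift f) (K * B)"
proof -
  have "\<exists>K. \<forall>f\<in>schwartz_space. \<forall>B. schwartz_le (2 + M + k) f B \<longrightarrow> schwartz_le (2 + M) ((xmul ^^ k) f) (K * B)" for k
    by (rule schwartz_le_xmul_funpow)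
  then obtain K where K: "\<And>k f B. f \<in> schwartz_space \<Longrightarrow> schwartz_le (2 + M + k) f B \<Longrightarrow>
      schwartz_le (2 + M) ((xmul ^^ k) f) (K k * B)" by metis
  show ?thesis
  proof (intro exI ballI allI impI)
    fix f B assume f: "f \<in> schwartz_space" and B: "schwartz_le (2 * M + 2) f B"
    have B0: "0 \<le> B" by (rule schwartz_le_nonneg[OF B])
    show "schwartz_le M (ift f) ((2 * pi * (\<Sum>k\<le>M. \<bar>K k\<bar>)) * B)"
      unfolding schwartz_le_def
    proof (intro allI impI)
      fix m k x assume mk: "m \<le> M" "k \<le> M"
      define g where "g = (xmul ^^ k) f"
      have g: "g \<in> schwartz_space" unfolding g_def by (rule schwartz_xmul_funpow[OF f])
      have gB: "schwartz_le (2 + M) g (K k * B)"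
        unfolding g_def by (rule K[OF f]) (rule schwartz_le_mono[OF B], use mk in simp)
      have "1 * \<bar>x\<bar> \<le> (2 * pi) * \<bar>x\<bar>" using pi_ge_two by (intro mult_right_mono) auto
      then have "\<bar>x\<bar> ^ m \<le> (2 * pi * \<bar>x\<bar>) ^ m" by (intro power_mono) auto
      then have "\<bar>x\<bar> ^ m * norm (nth_deriv k (ift f) x) \<le> (2 * pi * \<bar>x\<bar>) ^ m * norm (ift g x)"
        unfolding nth_deriv_ift[OF schwartz_rapid[OF f]] g_def xmul_funpow by (intro mult_right_mono) auto
      also have "\<dots> = norm (ift (nth_deriv m g) x)"
        unfolding ift_nth_deriv[OF g] by (simp add: norm_mult norm_power)
      also have "\<dots> \<le> 2 * pi * (K k * B)"
        by (intro norm_ift_schwartz_le schwartz_nth_deriv[OF g] schwartz_le_nth_deriv schwartz_le_mono[OF gB])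
          (use mk in simp)
      also have "\<dots> \<le> 2 * pi * ((\<Sum>k\<le>M. \<bar>K k\<bar>) * B)"
      proof (intro mult_left_mono mult_right_mono B0)
        have "K k \<le> \<bar>K k\<bar>" by simp
        also have "\<dots> \<le> (\<Sum>k\<le>M. \<bar>K k\<bar>)" using mk by (intro member_le_sum) auto
        finally show "K k \<le> (\<Sum>k\<le>M. \<bar>K k\<bar>)" .
      qed simp
      finally show "\<bar>x\<bar> ^ m * norm (nth_deriv k (ift f) x) \<le> (2 * pi * (\<Sum>k\<le>M. \<bar>K k\<bar>)) * B"
        by (simp add: mult.assoc)
    qed
  qed
qed

lemma schwartz_ift: "f \<in> schwartz_space \<Longrightarrow> ift f \<in> schwartz_space"
  unfolding schwartz_iff_le
  using schwartz_le_ift nth_deriv_ift(2)[OF schwartz_rapid] schwartz_iff_le by meson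

lemma schwartz_fourier: 
  assumes f: "f \<in> schwartz_space"
  shows "fourier f \<in> schwartz_space"
proof -
  have der: "((\<lambda>x. (-1) ^ k * nth_deriv k (ift f) (- x)) has_vector_derivative (-1) ^ Suc k * nth_deriv (Suc k) (ift f) (- x)) (at x)" for k x
  proof -
    have "((\<lambda>x. nth_deriv k (ift f) (- x)) has_vector_derivative (-1) *\<^sub>R nth_deriv (Suc k) (ift f) (- x)) (at x)"
      by (rule vector_diff_chain_at[of "\<lambda>x. - x", unfolded o_def])
        (auto intro!: derivative_eq_intros smooth_has_deriv schwartzD(1) schwartz_ift f)
    then have "((\<lambda>x. (-1) ^ k * nth_deriv k (ift f) (- x)) has_vector_derivative
        (-1) ^ k * ((-1) *\<^sub>R nth_deriv (Suc k) (ift f) (- x))) (at x)"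
      by (rule has_vector_derivative_mult_right)
    then show ?thesis by simp
  qed
  have eq: "fourier f = (\<lambda>x. (-1) ^ 0 * nth_deriv 0 (ift f) (- x))" by (auto simp: fourier_eq_ift)
  have nd: "nth_deriv k (fourier f) = (\<lambda>x. (-1) ^ k * nth_deriv k (ift f) (- x))" for k
    unfolding eq by (rule nth_deriv_unique[of "\<lambda>k x. (-1) ^ k * nth_deriv k (ift f) (- x)", OF der])
  show ?thesis
    unfolding schwartz_space_iff
  proof (intro conjI allI)
    show "smooth (fourier f)"
      unfolding eq by (rule smooth_nth_deriv_sequence[of "\<lambda>k x. (-1) ^ k * nth_deriv k (ift f) (- x)", OF der])
    fix m k
    obtain B where "\<And>x. \<bar>x\<bar> ^ m * norm (nth_deriv k (ift f) x) \<le> B"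
      using schwartzD(2)[OF schwartz_ift[OF f], of m k] by blast
    from this[of "- _"] show "\<exists>B. \<forall>x. \<bar>x\<bar> ^ m * norm (nth_deriv k (fourier f) x) \<le> B"
      unfolding nd by (intro exI[of _ B]) (simp add: norm_mult norm_power)
  qed
qed

section \<open>Gaussian regularization and Fourier inversion\<close>

lemma integrable_std_normal: "integrable lborel std_normal_density"
  by (rule integrable_normal_density) simp

lemma char_std_normal_lborel:
  "(LINT y|lborel. of_real (std_normal_density y) * iexp (t * y)) = of_real (exp (- t\<^sup>2 / 2))"
proof -
  have "char std_normal_distribution t = (LINT y|lborel. std_normal_density y *\<^sub>R iexp (t * y))"
    unfolding char_def by (subst integral_density) (auto simp: normal_density_nonneg)
  then show ?thesis by (simp add: char_std_normal_distribution scaleR_conv_of_real)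
qed

text \<open>After rescaling by \<open>\<sigma>\<close> this is the characteristic function of the
  standard normal distribution.\<close>

lemma ift_gaussian:
  fixes \<sigma> :: real
  assumes \<sigma>: "0 < \<sigma>"
  shows "ift (\<lambda>s. of_real (exp (- (\<sigma> * s)\<^sup>2 / 2))) y
    = of_real (2 * pi / \<sigma> * std_normal_density (2 * pi * y / \<sigma>))"
proof -
  have "ift (\<lambda>s. of_real (exp (- (\<sigma> * s)\<^sup>2 / 2))) y
      = \<bar>1 / \<sigma>\<bar> *\<^sub>R (LINT x|lborel. wave y (0 + (1 / \<sigma>) * x) * of_real (exp (- (\<sigma> * (0 + (1 / \<sigma>) * x))\<^sup>2 / 2)))"
    unfolding ift_def by (rule lborel_integral_real_affine) (use \<sigma> in simp)
  also have "(\<lambda>x. wave y (0 + (1 / \<sigma>) * x) * of_real (exp (- (\<sigma> * (0 + (1 / \<sigma>) * x))\<^sup>2 / 2)))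
      = (\<lambda>x. of_real (sqrt (2 * pi)) * (of_real (std_normal_density x) * iexp ((2 * pi * y / \<sigma>) * x)))"
    using \<sigma> by (auto simp: wave_iexp std_normal_density_def mult_ac fun_eq_iff)
  also have "(LINT x|lborel. of_real (sqrt (2 * pi)) * (of_real (std_normal_density x) * iexp ((2 * pi * y / \<sigma>) * x)))
      = of_real (sqrt (2 * pi)) * of_real (exp (- (2 * pi * y / \<sigma>)\<^sup>2 / 2))"
    by (simp only: integral_mult_right_zero char_std_normal_lborel)
  also have "\<bar>1 / \<sigma>\<bar> *\<^sub>R (of_real (sqrt (2 * pi)) * of_real (exp (- (2 * pi * y / \<sigma>)\<^sup>2 / 2)) :: complex)
      = of_real (2 * pi / \<sigma> * std_normal_density (2 * pi * y / \<sigma>))"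
  proof -
    have "\<bar>1 / \<sigma>\<bar> * (sqrt (2 * pi) * exp (- (2 * pi * y / \<sigma>)\<^sup>2 / 2))
        = 2 * pi / \<sigma> * std_normal_density (2 * pi * y / \<sigma>)"
      using \<sigma> real_sqrt_mult_self[of "2 * pi"] by (simp add: std_normal_density_def field_simps)
    then show ?thesis by (simp only: scaleR_conv_of_real flip: of_real_mult)
  qed
  finally show ?thesis .
qed

lemma integrable_gaussian:
  fixes \<sigma> :: real
  assumes \<sigma>: "0 < \<sigma>"
  shows "integrable lborel (\<lambda>s. exp (- (\<sigma> * s)\<^sup>2 / 2))"
proof -
  have "integrable lborel (\<lambda>s. sqrt (2 * pi) * std_normal_density (0 + \<sigma> * s))"
    using lborel_integrable_real_affine[OF integrable_std_normal, of \<sigma> 0] \<sigma> by (intro integrable_mult_right) auto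
  then show ?thesis by (simp add: std_normal_density_def)
qed

text \<open>The Gaussian factor makes the double integral absolutely convergent, so Fubini applies;
  what results is a mean of \<open>f\<close> around \<open>x\<close> at a scale proportional to
  \<open>\<sigma>\<close>.\<close>

lemma ift_fourier_gaussian:
  assumes f: "f \<in> schwartz_space" and \<sigma>: "0 < \<sigma>"
  shows "ift (\<lambda>s. of_real (exp (- (\<sigma> * s)\<^sup>2 / 2)) * fourier f s) x
    = (LINT y|lborel. of_real (std_normal_density y) * f (x + \<sigma> / (2 * pi) * y))"
proof -
  interpret lborel_pair: pair_sigma_finite "lborel :: real measure" "lborel :: real measure" ..
  have fm[measurable]: "f \<in> borel_measurable borel" by (rule smooth_borel[OF schwartzD(1)[OF f]])
  note fi = schwartz_integrable[OF f] and gi = integrable_gaussian[OF \<sigma>]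
  let ?g = "\<lambda>s. exp (- (\<sigma> * s)\<^sup>2 / 2)"
  define F where "F s t = wave x s * (of_real (?g s) * (wave (- s) t * f t))" for s t
  have norm_F: "norm (F s t) = ?g s * norm (f t)" for s t by (simp add: F_def norm_mult)
  have Fm: "(\<lambda>(s, t). F s t) \<in> borel_measurable (lborel \<Otimes>\<^sub>M lborel)"
    unfolding F_def by measurable
  have Fint: "integrable (lborel \<Otimes>\<^sub>M lborel) (\<lambda>(s, t). F s t)"
  proof (rule lborel_pair.Fubini_integrable[OF Fm])
    show "integrable lborel (\<lambda>s. LINT t|lborel. norm (case (s, t) of (s, t) \<Rightarrow> F s t))"
      using gi by (simp add: norm_F)
    show "AE s in lborel. integrable lborel (\<lambda>t. case (s, t) of (s, t) \<Rightarrow> F s t)"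
      unfolding F_def prod.case by (intro AE_I2 integrable_mult_right integrable_wave_mult fi)
  qed
  have "ift (\<lambda>s. of_real (?g s) * fourier f s) x = (LINT s|lborel. LINT t|lborel. F s t)"
    unfolding fourier_eq_ift ift_def F_def
    by (simp only: integral_mult_right_zero)
  also have "\<dots> = (LINT t|lborel. LINT s|lborel. F s t)"
    by (rule lborel_pair.Fubini_integral[OF Fint, symmetric])
  also have "\<dots> = (LINT t|lborel. ift (\<lambda>s. of_real (?g s)) (x - t) * f t)"
  proof (intro Bochner_Integration.integral_cong refl)
    fix t
    have "F s t = (wave (x - t) s * of_real (?g s)) * f t" for s
    proof -
      have "wave (x - t) s = wave x s * wave (- s) t"
        using wave_add[of x "- t" s] by (simp add: wave_def mult_ac)
      then show ?thesis by (simp add: F_def mult_ac)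
    qed
    then show "(LINT s|lborel. F s t) = ift (\<lambda>s. of_real (?g s)) (x - t) * f t"
      unfolding ift_def by simp
  qed
  also have "\<dots> = (LINT t|lborel. of_real (2 * pi / \<sigma> * std_normal_density (2 * pi * (x - t) / \<sigma>)) * f t)"
    unfolding ift_gaussian[OF \<sigma>] ..
  also have "\<dots> = \<bar>\<sigma> / (2 * pi)\<bar> *\<^sub>R (LINT y|lborel.
      of_real (2 * pi / \<sigma> * std_normal_density (2 * pi * (x - (x + \<sigma> / (2 * pi) * y)) / \<sigma>)) * f (x + \<sigma> / (2 * pi) * y))"
    by (rule lborel_integral_real_affine) (use \<sigma> in simp)
  also have "(\<lambda>y. of_real (2 * pi / \<sigma> * std_normal_density (2 * pi * (x - (x + \<sigma> / (2 * pi) * y)) / \<sigma>)) * f (x + \<sigma> / (2 * pi) * y))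
     = (\<lambda>y. of_real (2 * pi / \<sigma>) * (of_real (std_normal_density y) * f (x + \<sigma> / (2 * pi) * y)))"
  proof
    fix y
    have "2 * pi * (x - (x + \<sigma> / (2 * pi) * y)) / \<sigma> = - y" using \<sigma> by (simp add: field_simps)
    moreover have "std_normal_density (- y) = std_normal_density y" by (simp add: std_normal_density_def)
    ultimately show "of_real (2 * pi / \<sigma> * std_normal_density (2 * pi * (x - (x + \<sigma> / (2 * pi) * y)) / \<sigma>)) * f (x + \<sigma> / (2 * pi) * y)
      = of_real (2 * pi / \<sigma>) * (of_real (std_normal_density y) * f (x + \<sigma> / (2 * pi) * y))"
      by (simp only: of_real_mult mult.assoc)
  qed
  also have "\<bar>\<sigma> / (2 * pi)\<bar> *\<^sub>R (LINT y|lborel. of_real (2 * pi / \<sigma>) * (of_real (std_normal_density y) * f (x + \<sigma> / (2 * pi) * y)))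
     = (LINT y|lborel. of_real (std_normal_density y) * f (x + \<sigma> / (2 * pi) * y))"
    using \<sigma> by (simp only: integral_mult_right_zero) (simp add: scaleR_conv_of_real)
  finally show ?thesis .
qed

text \<open>Both sides of the regularized identity pass to the limit \<open>\<sigma> = 0\<close> by
  dominated convergence.\<close>

theorem ift_fourier:
  assumes f: "f \<in> schwartz_space"
  shows "ift (fourier f) x = f x"
proof -
  have fm[measurable]: "f \<in> borel_measurable borel" by (rule smooth_borel[OF schwartzD(1)[OF f]])
  have Ff: "integrable lborel (fourier f)" by (rule schwartz_integrable[OF schwartz_fourier[OF f]])
  have Fm[measurable]: "fourier f \<in> borel_measurable borel"
    by (rule smooth_borel[OF schwartzD(1)[OF schwartz_fourier[OF f]]])
  obtain B where B: "\<And>x. norm (f x) \<le> B" using schwartzD(2)[OF f, of 0 0] by auto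
  define \<sigma> where "\<sigma> n = inverse (real (Suc n))" for n
  have \<sigma>: "0 < \<sigma> n" for n by (simp add: \<sigma>_def)
  have \<sigma>0: "\<sigma> \<longlonglongrightarrow> 0" unfolding \<sigma>_def by (rule LIMSEQ_inverse_real_of_nat)
  have "(\<lambda>n. ift (\<lambda>s. of_real (exp (- (\<sigma> n * s)\<^sup>2 / 2)) * fourier f s) x) \<longlonglongrightarrow> ift (fourier f) x"
    unfolding ift_def
  proof (rule integral_dominated_convergence[where w = "\<lambda>s. norm (fourier f s)"])
    show "AE s in lborel. (\<lambda>n. wave x s * (of_real (exp (- (\<sigma> n * s)\<^sup>2 / 2)) * fourier f s)) \<longlonglongrightarrow> wave x s * fourier f s"
    proof (rule AE_I2)
      fix s
      have "(\<lambda>n. wave x s * (of_real (exp (- (\<sigma> n * s)\<^sup>2 / 2)) * fourier f s)) \<longlonglongrightarrow>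
          wave x s * (of_real (exp (- (0 * s)\<^sup>2 / 2)) * fourier f s)"
        by (intro tendsto_intros \<sigma>0) simp
      then show "(\<lambda>n. wave x s * (of_real (exp (- (\<sigma> n * s)\<^sup>2 / 2)) * fourier f s)) \<longlonglongrightarrow> wave x s * fourier f s"
        by simp
    qed
    show "AE s in lborel. norm (wave x s * (of_real (exp (- (\<sigma> n * s)\<^sup>2 / 2)) * fourier f s)) \<le> norm (fourier f s)" for n
      by (intro AE_I2) (simp add: norm_mult mult_left_le_one_le)
  qed (use Ff in \<open>auto intro: integrable_norm\<close>)
  moreover have "(\<lambda>n. LINT y|lborel. of_real (std_normal_density y) * f (x + \<sigma> n / (2 * pi) * y)) \<longlonglongrightarrow>
      (LINT y|lborel. of_real (std_normal_density y) * f x)"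
  proof (rule integral_dominated_convergence[where w = "\<lambda>y. std_normal_density y * B"])
    show "integrable lborel (\<lambda>y. std_normal_density y * B)"
      by (intro integrable_mult_left integrable_std_normal)
    show "AE y in lborel. (\<lambda>n. of_real (std_normal_density y) * f (x + \<sigma> n / (2 * pi) * y)) \<longlonglongrightarrow> of_real (std_normal_density y) * f x"
    proof (rule AE_I2)
      fix y
      have "(\<lambda>n. x + \<sigma> n / (2 * pi) * y) \<longlonglongrightarrow> x + 0 / (2 * pi) * y" by (intro tendsto_intros \<sigma>0) simp
      then have "(\<lambda>n. x + \<sigma> n / (2 * pi) * y) \<longlonglongrightarrow> x" by simp
      moreover have "isCont f x"
        using smooth_continuous[OF schwartzD(1)[OF f], of UNIV] by (simp add: continuous_on_eq_continuous_at)
      ultimately have "(\<lambda>n. f (x + \<sigma> n / (2 * pi) * y)) \<longlonglongrightarrow> f x" by (rule isCont_tendsto_compose[rotated])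
      then show "(\<lambda>n. of_real (std_normal_density y) * f (x + \<sigma> n / (2 * pi) * y)) \<longlonglongrightarrow> of_real (std_normal_density y) * f x"
        by (intro tendsto_intros)
    qed
    show "AE y in lborel. norm (of_real (std_normal_density y) * f (x + \<sigma> n / (2 * pi) * y)) \<le> std_normal_density y * B" for n
      by (intro AE_I2) (simp add: norm_mult mult_left_mono B)
  qed auto
  moreover have "(LINT y|lborel. of_real (std_normal_density y) * f x) = f x"
    using char_std_normal_lborel[of 0] by simp
  ultimately show ?thesis
    unfolding ift_fourier_gaussian[OF f \<sigma>] by (metis (no_types) LIMSEQ_unique)
qed

section \<open>Functions of exponential decay and growth\<close>

text \<open>Stronger than rapid decrease: multipliers of class \<open>exp_growing\<close>, among
  them Taylor remainders of waves, keep the product in the Schwartz space.\<close>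

definition exp_decaying :: "(real \<Rightarrow> complex) \<Rightarrow> bool" where
  "exp_decaying g \<longleftrightarrow> smooth g \<and> (\<forall>k R. \<exists>C. \<forall>x. exp (R * \<bar>x\<bar>) * norm (nth_deriv k g x) \<le> C)"

definition exp_growing :: "(real \<Rightarrow> complex) \<Rightarrow> bool" where
  "exp_growing w \<longleftrightarrow> smooth w \<and> (\<forall>k. \<exists>C R. \<forall>x. norm (nth_deriv k w x) \<le> C * exp (R * \<bar>x\<bar>))"

lemma exp_growingI:
  "smooth w \<Longrightarrow> (\<And>k x. norm (nth_deriv k w x) \<le> C k * exp (R k * \<bar>x\<bar>)) \<Longrightarrow> exp_growing w"
  unfolding exp_growing_def by blast

lemma power_le_fact_exp: "0 \<le> x \<Longrightarrow> x ^ m \<le> fact m * exp (x::real)"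
proof -
  assume x: "0 \<le> x"
  have "x ^ m / fact m \<le> (\<Sum>n. x ^ n /\<^sub>R fact n)"
    using sum_le_suminf[OF summable_exp_generic[of x], of "{m}"] x by (simp add: divide_inverse mult.commute)
  then show ?thesis by (simp add: exp_def field_simps)
qed

lemma uniform_bound:
  fixes P :: "nat \<Rightarrow> 'a \<Rightarrow> real"
  assumes "\<And>k. \<exists>C. \<forall>x. P k x \<le> C"
  shows "\<exists>C\<ge>0. \<forall>k\<le>M. \<forall>x. P k x \<le> C"
proof -
  obtain c where c: "\<And>k x. P k x \<le> c k" using assms by metis
  have "P k x \<le> (\<Sum>k\<le>M. \<bar>c k\<bar>)" if "k \<le> M" for k x
  proof -
    have "P k x \<le> \<bar>c k\<bar>" using c[of k x] by simp
    also have "\<dots> \<le> (\<Sum>k\<le>M. \<bar>c k\<bar>)" using that by (intro member_le_sum) auto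
    finally show ?thesis .
  qed
  then show ?thesis by (intro exI[of _ "\<Sum>k\<le>M. \<bar>c k\<bar>"]) (auto intro: sum_nonneg)
qed

lemma exp_decaying_bound:
  assumes "exp_decaying g"
  shows "\<exists>C\<ge>0. \<forall>k\<le>M. \<forall>x. norm (nth_deriv k g x) \<le> C * exp (- R * \<bar>x\<bar>)"
proof -
  have "\<exists>C\<ge>0. \<forall>k\<le>M. \<forall>x. exp (R * \<bar>x\<bar>) * norm (nth_deriv k g x) \<le> C"
    by (rule uniform_bound) (use assms in \<open>auto simp: exp_decaying_def\<close>)
  then obtain C where "0 \<le> C" "\<And>k x. k \<le> M \<Longrightarrow> exp (R * \<bar>x\<bar>) * norm (nth_deriv k g x) \<le> C" by blast
  then show ?thesis by (intro exI[of _ C]) (auto simp: exp_minus field_simps)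
qed

lemma exp_growing_bound:
  assumes "exp_growing w"
  shows "\<exists>C R. 0 \<le> C \<and> 0 \<le> R \<and> (\<forall>k\<le>M. \<forall>x. norm (nth_deriv k w x) \<le> C * exp (R * \<bar>x\<bar>))"
proof -
  obtain c r where c: "\<And>k x. norm (nth_deriv k w x) \<le> c k * exp (r k * \<bar>x\<bar>)"
    using assms unfolding exp_growing_def by metis
  define C R where "C = (\<Sum>k\<le>M. \<bar>c k\<bar>)" and "R = (\<Sum>k\<le>M. \<bar>r k\<bar>)"
  have "norm (nth_deriv k w x) \<le> C * exp (R * \<bar>x\<bar>)" if "k \<le> M" for k x
  proof -
    have "c k \<le> C" "r k \<le> R"
      unfolding C_def R_def using that member_le_sum[of k "{..M}" "\<lambda>k. \<bar>c k\<bar>"] member_le_sum[of k "{..M}" "\<lambda>k. \<bar>r k\<bar>"]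
      by fastforce+
    moreover have "0 \<le> C" unfolding C_def by (intro sum_nonneg) auto
    ultimately have "c k * exp (r k * \<bar>x\<bar>) \<le> C * exp (R * \<bar>x\<bar>)"
      by (intro mult_mono) (auto intro: mult_right_mono)
    with c show ?thesis by (rule order_trans)
  qed
  moreover have "0 \<le> C" "0 \<le> R" by (auto simp: C_def R_def intro: sum_nonneg)
  ultimately show ?thesis by blast
qed

lemma exp_growing_mult_decaying_bound:
  assumes g: "exp_decaying g"
  shows "\<exists>K\<ge>0. \<forall>w B. smooth w \<longrightarrow> (\<forall>k\<le>M. \<forall>x. norm (nth_deriv k w x) \<le> B * exp (R * \<bar>x\<bar>)) \<longrightarrow>
     schwartz_le M (\<lambda>x. w x * g x) (K * B)"
proof -
  \<comment> \<open>The rate R + 1 leaves a spare factor exp(-|x|), which pays for the weights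
    through |x|^m <= m! exp |x|.\<close>
  obtain C where C: "0 \<le> C" "\<And>k x. k \<le> M \<Longrightarrow> norm (nth_deriv k g x) \<le> C * exp (- (R + 1) * \<bar>x\<bar>)"
    using exp_decaying_bound[OF g, of M "R + 1"] by blast
  have sg: "smooth g" using g by (simp add: exp_decaying_def)
  define K where "K = fact M * 2 ^ M * C"
  have "schwartz_le M (\<lambda>x. w x * g x) (K * B)"
    if w: "smooth w" and wB: "\<And>k x. k \<le> M \<Longrightarrow> norm (nth_deriv k w x) \<le> B * exp (R * \<bar>x\<bar>)" for w B
    unfolding schwartz_le_def
  proof (intro allI impI)
    fix m k x assume mk: "m \<le> M" "k \<le> M"
    have B0: "0 \<le> B" using order_trans[OF norm_ge_zero wB[of 0 0]] by simp
    have "norm (nth_deriv k (\<lambda>x. w x * g x) x) \<le> 2 ^ k * (B * exp (R * \<bar>x\<bar>)) * (C * exp (- (R + 1) * \<bar>x\<bar>))"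
      by (rule nth_deriv_mult_bound[OF w sg]) (use wB C mk in auto)
    also have "\<dots> = 2 ^ k * (B * C) * (exp (R * \<bar>x\<bar>) * exp (- (R + 1) * \<bar>x\<bar>))" by simp
    also have "exp (R * \<bar>x\<bar>) * exp (- (R + 1) * \<bar>x\<bar>) = exp (- \<bar>x\<bar>)"
      by (simp add: exp_add[symmetric] algebra_simps)
    finally have "\<bar>x\<bar> ^ m * norm (nth_deriv k (\<lambda>x. w x * g x) x)
       \<le> (fact m * exp \<bar>x\<bar>) * (2 ^ k * (B * C) * exp (- \<bar>x\<bar>))"
      by (intro mult_mono power_le_fact_exp) auto
    also have "\<dots> = fact m * 2 ^ k * (B * C)" by (simp add: exp_minus)
    also have "\<dots> \<le> fact M * 2 ^ M * (B * C)"
      using mk B0 C by (intro mult_right_mono mult_mono power_increasing fact_mono) auto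
    finally show "\<bar>x\<bar> ^ m * norm (nth_deriv k (\<lambda>x. w x * g x) x) \<le> K * B" by (simp add: K_def mult_ac)
  qed
  moreover have "0 \<le> K" using C by (simp add: K_def)
  ultimately show ?thesis by blast
qed

lemma exp_growing_mult_decaying_schwartz:
  assumes "exp_growing w" "exp_decaying g"
  shows "(\<lambda>x. w x * g x) \<in> schwartz_space"
  unfolding schwartz_iff_le
proof (intro conjI allI)
  have sw: "smooth w" and sg: "smooth g" using assms by (auto simp: exp_growing_def exp_decaying_def)
  show "smooth (\<lambda>x. w x * g x)" by (rule smooth_mult[OF sw sg])
  fix M
  obtain C R where "\<forall>k\<le>M. \<forall>x. norm (nth_deriv k w x) \<le> C * exp (R * \<bar>x\<bar>)"
    using exp_growing_bound[OF assms(1)] by blast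
  with exp_growing_mult_decaying_bound[OF assms(2), of M R] sw
  show "\<exists>B. schwartz_le M (\<lambda>x. w x * g x) B" by blast
qed

lemma exp_decaying_schwartz: "exp_decaying g \<Longrightarrow> g \<in> schwartz_space"
proof -
  assume "exp_decaying g"
  moreover have wave0: "wave 0 = (\<lambda>x. 1)" by auto
  have "exp_growing (\<lambda>x. 1)"
  proof (rule exp_growingI[where C = "\<lambda>_. 1" and R = "\<lambda>_. 0"])
    show "smooth (\<lambda>x. 1)" using smooth_wave[of 0] by (simp add: wave0)
    show "norm (nth_deriv k (\<lambda>x. 1) x) \<le> 1 * exp (0 * \<bar>x\<bar>)" for k x
      using nth_deriv_wave[of k 0] by (cases k) (simp_all add: wave0)
  qed
  ultimately show ?thesis using exp_growing_mult_decaying_schwartz by fastforce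
qed

lemma exp_growing_wave: "exp_growing (wave s)"
proof (rule exp_growingI[OF smooth_wave])
  show "norm (nth_deriv k (wave s) x) \<le> (2 * pi * \<bar>s\<bar>) ^ k * exp (0 * \<bar>x\<bar>)" for k x
    by (simp add: nth_deriv_wave norm_mult norm_power)
qed

lemma exp_growing_cmult:
  assumes "exp_growing w"
  shows "exp_growing (\<lambda>x. c * w x)"
proof -
  obtain C R where CR: "\<And>k x. norm (nth_deriv k w x) \<le> C k * exp (R k * \<bar>x\<bar>)"
    using assms unfolding exp_growing_def by metis
  have w: "smooth w" using assms by (simp add: exp_growing_def)
  show ?thesis
  proof (rule exp_growingI[where C = "\<lambda>k. norm c * C k" and R = R])
    show "smooth (\<lambda>x. c * w x)" by (rule nth_deriv_cmult(1)[OF w])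
    show "norm (nth_deriv k (\<lambda>x. c * w x) x) \<le> norm c * C k * exp (R k * \<bar>x\<bar>)" for k x
      using mult_left_mono[OF CR, of "norm c" k x] by (simp add: nth_deriv_cmult(2)[OF w] norm_mult mult.assoc)
  qed
qed

lemma exp_growing_diff:
  assumes "exp_growing v" "exp_growing w"
  shows "exp_growing (\<lambda>x. v x - w x)"
proof -
  have s: "smooth v" "smooth w" using assms by (auto simp: exp_growing_def)
  have "\<exists>C R. \<forall>x. norm (nth_deriv k (\<lambda>x. v x - w x) x) \<le> C * exp (R * \<bar>x\<bar>)" for k
  proof -
    obtain C R where v: "0 \<le> C" "0 \<le> R" "\<And>j x. j \<le> k \<Longrightarrow> norm (nth_deriv j v x) \<le> C * exp (R * \<bar>x\<bar>)"
      using exp_growing_bound[OF assms(1), of k] by metis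
    obtain C' R' where w: "0 \<le> C'" "0 \<le> R'" "\<And>j x. j \<le> k \<Longrightarrow> norm (nth_deriv j w x) \<le> C' * exp (R' * \<bar>x\<bar>)"
      using exp_growing_bound[OF assms(2), of k] by metis
    note CR = v(1,2) v(3)[OF order_refl] w(1,2) w(3)[OF order_refl]
    have "norm (nth_deriv k (\<lambda>x. v x - w x) x) \<le> (C + C') * exp ((R + R') * \<bar>x\<bar>)" for x
    proof -
      have "norm (nth_deriv k (\<lambda>x. v x - w x) x) \<le> C * exp (R * \<bar>x\<bar>) + C' * exp (R' * \<bar>x\<bar>)"
        unfolding nth_deriv_diff(2)[OF s] by (rule order_trans[OF norm_triangle_ineq4 add_mono[OF CR(3,6)]])
      also have "\<dots> \<le> C * exp ((R + R') * \<bar>x\<bar>) + C' * exp ((R + R') * \<bar>x\<bar>)"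
        using CR by (intro add_mono mult_left_mono) (auto intro!: mult_right_mono)
      finally show ?thesis by (simp add: algebra_simps)
    qed
    then show ?thesis by blast
  qed
  then show ?thesis using nth_deriv_diff(1)[OF s] unfolding exp_growing_def by blast
qed

lemma exp_growing_mult:
  assumes "exp_growing v" "exp_growing w"
  shows "exp_growing (\<lambda>x. v x * w x)"
proof -
  have s: "smooth v" "smooth w" using assms by (auto simp: exp_growing_def)
  have "\<exists>C R. \<forall>x. norm (nth_deriv k (\<lambda>x. v x * w x) x) \<le> C * exp (R * \<bar>x\<bar>)" for k
  proof -
    obtain C R where v: "\<And>j x. j \<le> k \<Longrightarrow> norm (nth_deriv j v x) \<le> C * exp (R * \<bar>x\<bar>)"
      using exp_growing_bound[OF assms(1), of k] by metis
    obtain C' R' where w: "\<And>j x. j \<le> k \<Longrightarrow> norm (nth_deriv j w x) \<le> C' * exp (R' * \<bar>x\<bar>)"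
      using exp_growing_bound[OF assms(2), of k] by metis
    note CR = v w
    have "norm (nth_deriv k (\<lambda>x. v x * w x) x) \<le> (2 ^ k * C * C') * exp ((R + R') * \<bar>x\<bar>)" for x
    proof -
      have "norm (nth_deriv k (\<lambda>x. v x * w x) x) \<le> 2 ^ k * (C * exp (R * \<bar>x\<bar>)) * (C' * exp (R' * \<bar>x\<bar>))"
        by (intro nth_deriv_mult_bound s CR)
      then show ?thesis by (simp add: exp_add algebra_simps)
    qed
    then show ?thesis by blast
  qed
  then show ?thesis using smooth_mult[OF s] unfolding exp_growing_def by blast
qed

section \<open>A Schwartz function that is flat exactly on the integers\<close>

lemma sin_pi_eq_0_iff: "sin (pi * x) = 0 \<longleftrightarrow> x \<in> \<int>"
  using sin_times_pi_eq_0[of x] by (simp add: mult.commute)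

text \<open>Closed under differentiation off the integers, and it contains the logarithmic
  derivative of \<open>flat_weight\<close>; hence the derivatives of \<open>flat_fun p\<close> are
  again of the form \<open>flat_fun q\<close>. The values that \<open>inverse 0 = 0\<close> produces
  at the integers are discarded by \<open>flat_fun\<close>.\<close>

inductive_set trig_algebra :: "(real \<Rightarrow> complex) set" where
  const: "(\<lambda>x. c) \<in> trig_algebra"
| ident: "(\<lambda>x. of_real x) \<in> trig_algebra"
| sine: "(\<lambda>x. of_real (sin (pi * x))) \<in> trig_algebra"
| cosine: "(\<lambda>x. of_real (cos (pi * x))) \<in> trig_algebra"
| cosecant: "(\<lambda>x. of_real (inverse (sin (pi * x)))) \<in> trig_algebra"
| add: "p \<in> trig_algebra \<Longrightarrow> q \<in> trig_algebra \<Longrightarrow> (\<lambda>x. p x + q x) \<in> trig_algebra"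
| mult: "p \<in> trig_algebra \<Longrightarrow> q \<in> trig_algebra \<Longrightarrow> (\<lambda>x. p x * q x) \<in> trig_algebra"

lemma trig_algebra_power: "p \<in> trig_algebra \<Longrightarrow> (\<lambda>x. p x ^ k) \<in> trig_algebra"
  by (induction k) (auto intro: trig_algebra.const trig_algebra.mult)

lemma of_real_has_vector_derivative:
  "(f has_real_derivative d) (at x) \<Longrightarrow> ((\<lambda>x. complex_of_real (f x)) has_vector_derivative of_real d) (at x)"
  by (intro has_vector_derivative_of_real) (simp add: has_real_derivative_iff_has_vector_derivative)

lemma trig_algebra_deriv:
  assumes "p \<in> trig_algebra"
  shows "\<exists>p'\<in>trig_algebra. \<forall>x. x \<notin> \<int> \<longrightarrow> (p has_vector_derivative p' x) (at x)"
  using assms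
proof induction
  case (const c)
  show ?case by (rule bexI[of _ "\<lambda>x. 0"]) (auto intro: trig_algebra.const)
next
  case ident
  show ?case
    by (rule bexI[of _ "\<lambda>x. of_real 1"])
      (auto intro!: trig_algebra.const of_real_has_vector_derivative derivative_eq_intros simp del: of_real_1)
next
  case sine
  have "((\<lambda>x. complex_of_real (sin (pi * x))) has_vector_derivative of_real pi * of_real (cos (pi * x))) (at x)" for x
    unfolding of_real_mult[symmetric] by (intro of_real_has_vector_derivative) (auto intro!: derivative_eq_intros)
  then show ?case by (intro bexI[of _ "\<lambda>x. of_real pi * of_real (cos (pi * x))"]) (auto intro: trig_algebra.intros)
next
  case cosine
  have "((\<lambda>x. complex_of_real (cos (pi * x))) has_vector_derivative of_real (- pi) * of_real (sin (pi * x))) (at x)" for x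
    unfolding of_real_mult[symmetric] by (intro of_real_has_vector_derivative) (auto intro!: derivative_eq_intros)
  then show ?case by (intro bexI[of _ "\<lambda>x. of_real (- pi) * of_real (sin (pi * x))"]) (auto intro: trig_algebra.intros simp del: of_real_minus)
next
  case cosecant
  have "((\<lambda>x. complex_of_real (inverse (sin (pi * x)))) has_vector_derivative
      of_real (- pi) * of_real (cos (pi * x)) * (of_real (inverse (sin (pi * x))) * of_real (inverse (sin (pi * x))))) (at x)"
    if "x \<notin> \<int>" for x
    unfolding of_real_mult[symmetric]
    by (intro of_real_has_vector_derivative) (use that in \<open>auto intro!: derivative_eq_intros simp: sin_pi_eq_0_iff mult_ac\<close>)
  then show ?case
    by (intro bexI[of _ "\<lambda>x. of_real (- pi) * of_real (cos (pi * x)) * (of_real (inverse (sin (pi * x))) * of_real (inverse (sin (pi * x))))"])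
      (auto intro!: trig_algebra.intros simp del: of_real_minus of_real_inverse)
next
  case (add p q)
  then obtain p' q' where "p' \<in> trig_algebra" "q' \<in> trig_algebra"
    "\<forall>x. x \<notin> \<int> \<longrightarrow> (p has_vector_derivative p' x) (at x)" "\<forall>x. x \<notin> \<int> \<longrightarrow> (q has_vector_derivative q' x) (at x)"
    by blast
  then show ?case
    by (intro bexI[of _ "\<lambda>x. p' x + q' x"]) (auto intro!: derivative_intros trig_algebra.add)
next
  case (mult p q)
  then obtain p' q' where "p' \<in> trig_algebra" "q' \<in> trig_algebra"
    "\<forall>x. x \<notin> \<int> \<longrightarrow> (p has_vector_derivative p' x) (at x)" "\<forall>x. x \<notin> \<int> \<longrightarrow> (q has_vector_derivative q' x) (at x)"
    by blast
  then show ?case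
    by (intro bexI[of _ "\<lambda>x. p x * q' x + p' x * q x"])
      (auto intro!: has_vector_derivative_mult trig_algebra.add trig_algebra.mult mult)
qed

text \<open>One majorant for all generators off the integers, up to constants. Being at least 1, its
  powers also bound sums and products.\<close>

definition trig_growth :: "real \<Rightarrow> real" where
  "trig_growth x = exp \<bar>x\<bar> * inverse \<bar>sin (pi * x)\<bar>"

lemma trig_growth_ge:
  assumes "x \<notin> \<int>"
  shows "1 \<le> trig_growth x" "\<bar>x\<bar> \<le> trig_growth x" "inverse \<bar>sin (pi * x)\<bar> \<le> trig_growth x"
proof -
  have s: "1 \<le> inverse \<bar>sin (pi * x)\<bar>"
    using assms abs_sin_le_one[of "pi * x"] by (auto simp: sin_pi_eq_0_iff one_le_inverse)
  have e: "1 \<le> exp \<bar>x\<bar>" "\<bar>x\<bar> \<le> exp \<bar>x\<bar>" using exp_ge_add_one_self[of "\<bar>x\<bar>"] by linarith+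
  show "1 \<le> trig_growth x" "\<bar>x\<bar> \<le> trig_growth x" "inverse \<bar>sin (pi * x)\<bar> \<le> trig_growth x"
    unfolding trig_growth_def using mult_mono[OF e(1) s] mult_mono[OF e(2) s] mult_right_mono[OF e(1), of "inverse \<bar>sin (pi * x)\<bar>"]
    by simp_all
qed

lemma trig_algebra_bound:
  assumes "p \<in> trig_algebra"
  shows "\<exists>C m. 0 \<le> C \<and> (\<forall>x. x \<notin> \<int> \<longrightarrow> norm (p x) \<le> C * trig_growth x ^ m)"
  using assms
proof induction
  case (const c)
  show ?case by (intro exI[of _ "norm c"] exI[of _ 0]) simp
next
  case ident
  show ?case by (intro exI[of _ 1]) (simp add: trig_growth_ge)
next
  case sine
  show ?case by (intro exI[of _ 1] exI[of _ 0]) (simp add: norm_of_real)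
next
  case cosine
  show ?case by (intro exI[of _ 1] exI[of _ 0]) (simp add: norm_of_real)
next
  case cosecant
  show ?case by (intro exI[of _ 1]) (use trig_growth_ge(3) in \<open>simp add: norm_inverse\<close>)
next
  case (add p q)
  then obtain C m C' m' where CC: "0 \<le> C" "\<And>x. x \<notin> \<int> \<Longrightarrow> norm (p x) \<le> C * trig_growth x ^ m"
     "0 \<le> C'" "\<And>x. x \<notin> \<int> \<Longrightarrow> norm (q x) \<le> C' * trig_growth x ^ m'"
    by blast
  have "norm (p x + q x) \<le> (C + C') * trig_growth x ^ (m + m')" if x: "x \<notin> \<int>" for x
  proof -
    have "norm (p x + q x) \<le> C * trig_growth x ^ m + C' * trig_growth x ^ m'"
      by (rule order_trans[OF norm_triangle_ineq add_mono[OF CC(2,4)[OF x]]])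
    also have "\<dots> \<le> C * trig_growth x ^ (m + m') + C' * trig_growth x ^ (m + m')"
      using CC trig_growth_ge(1)[OF x] by (intro add_mono mult_left_mono power_increasing) auto
    finally show ?thesis by (simp add: algebra_simps)
  qed
  moreover have "0 \<le> C + C'" using CC by simp
  ultimately show ?case by blast
next
  case (mult p q)
  then obtain C m C' m' where CC: "0 \<le> C" "\<And>x. x \<notin> \<int> \<Longrightarrow> norm (p x) \<le> C * trig_growth x ^ m"
     "0 \<le> C'" "\<And>x. x \<notin> \<int> \<Longrightarrow> norm (q x) \<le> C' * trig_growth x ^ m'"
    by blast
  have "norm (p x * q x) \<le> (C * C') * trig_growth x ^ (m + m')" if x: "x \<notin> \<int>" for x
  proof -
    have "norm (p x * q x) \<le> (C * trig_growth x ^ m) * (C' * trig_growth x ^ m')"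
      unfolding norm_mult using CC x trig_growth_ge(1)[OF x] by (intro mult_mono) auto
    then show ?thesis by (simp add: power_add mult_ac)
  qed
  moreover have "0 \<le> C * C'" using CC by simp
  ultimately show ?case by blast
qed

definition flat_weight :: "real \<Rightarrow> real" where
  "flat_weight x = exp (- x\<^sup>2 - inverse (sin (pi * x)) ^ 2)"

text \<open>The case distinction is essential: \<open>inverse 0 = 0\<close> makes \<open>flat_weight\<close> positive on the integers.\<close>
definition flat_fun :: "(real \<Rightarrow> complex) \<Rightarrow> real \<Rightarrow> complex" where
  "flat_fun p x = (if x \<in> \<int> then 0 else of_real (flat_weight x) * p x)"

text \<open>The two parts of the exponent act separately: the Gaussian part absorbs exp(K|x|), and
  the reciprocal sine makes the weight smaller than any power of the sine.\<close>

lemma flat_weight_bound: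
  assumes x: "x \<notin> \<int>"
  shows "exp (K * \<bar>x\<bar>) * flat_weight x \<le> exp (K\<^sup>2) * (fact n * \<bar>sin (pi * x)\<bar> ^ n)"
proof -
  define s where "s = \<bar>sin (pi * x)\<bar>"
  have s: "0 < s" "s \<le> 1" using x abs_sin_le_one by (auto simp: s_def sin_pi_eq_0_iff)
  have "exp (- (inverse (sin (pi * x)) ^ 2)) = exp (- (inverse s ^ 2))" by (simp add: s_def power_inverse)
  also have "\<dots> \<le> fact n * s ^ n"
  proof -
    have "inverse s ^ n \<le> (inverse s ^ 2) ^ n"
      using s one_le_inverse[of s] self_le_power[of "inverse s" 2] by (intro power_mono) auto
    also have "\<dots> \<le> fact n * exp (inverse s ^ 2)" by (intro power_le_fact_exp) simp
    finally have "inverse s ^ n * exp (- (inverse s ^ 2)) \<le> (fact n * exp (inverse s ^ 2)) * exp (- (inverse s ^ 2))"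
      by (intro mult_right_mono) auto
    also have "\<dots> = fact n" by (simp add: exp_minus)
    finally have "inverse s ^ n * exp (- (inverse s ^ 2)) \<le> fact n" .
    then show ?thesis using s by (simp add: power_inverse field_simps)
  qed
  finally have 1: "exp (- (inverse (sin (pi * x)) ^ 2)) \<le> fact n * s ^ n" .
  \<comment> \<open>Completing the square bounds K|x| by K^2 + x^2/4.\<close>
  have "0 \<le> (K - \<bar>x\<bar> / 2)\<^sup>2" by simp
  then have "K * \<bar>x\<bar> - x\<^sup>2 \<le> K\<^sup>2 - 3 / 4 * x\<^sup>2" by (simp add: power2_eq_square algebra_simps)
  also have "\<dots> \<le> K\<^sup>2" by simp
  finally have 2: "exp (K * \<bar>x\<bar> - x\<^sup>2) \<le> exp (K\<^sup>2)" by simp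
  have "exp (K * \<bar>x\<bar>) * flat_weight x = exp (K * \<bar>x\<bar> - x\<^sup>2) * exp (- (inverse (sin (pi * x)) ^ 2))"
    by (simp add: flat_weight_def exp_add[symmetric] algebra_simps)
  also have "\<dots> \<le> exp (K\<^sup>2) * (fact n * s ^ n)" by (intro mult_mono 1 2) auto
  finally show ?thesis by (simp add: s_def)
qed

lemma flat_bound:
  assumes "p \<in> trig_algebra"
  shows "\<exists>C\<ge>0. \<forall>x. exp (R * \<bar>x\<bar>) * norm (flat_fun p x) \<le> C * \<bar>sin (pi * x)\<bar> ^ n"
proof -
  obtain C m where C: "0 \<le> C" "\<And>x. x \<notin> \<int> \<Longrightarrow> norm (p x) \<le> C * trig_growth x ^ m"
    using trig_algebra_bound[OF assms] by blast
  \<comment> \<open>A factor \<open>trig_growth x ^ m\<close> costs \<open>m\<close> in the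
    exponential rate and \<open>m\<close> powers of the sine, hence R + m and n + m.\<close>
  define C' where "C' = C * exp ((R + real m)\<^sup>2) * fact (n + m)"
  have "exp (R * \<bar>x\<bar>) * norm (flat_fun p x) \<le> C' * \<bar>sin (pi * x)\<bar> ^ n" for x
  proof (cases "x \<in> \<int>")
    case False
    define s where "s = \<bar>sin (pi * x)\<bar>"
    have s: "0 < s" using False by (auto simp: s_def sin_pi_eq_0_iff)
    have "exp (R * \<bar>x\<bar>) * norm (flat_fun p x) = exp (R * \<bar>x\<bar>) * flat_weight x * norm (p x)"
      using False by (simp add: flat_fun_def norm_mult flat_weight_def)
    also have "\<dots> \<le> exp (R * \<bar>x\<bar>) * flat_weight x * (C * trig_growth x ^ m)"
      using False by (intro mult_left_mono C) (auto simp: flat_weight_def)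
    also have "trig_growth x ^ m = exp (real m * \<bar>x\<bar>) * inverse s ^ m"
      by (simp add: trig_growth_def s_def power_mult_distrib exp_of_nat_mult)
    also have "exp (R * \<bar>x\<bar>) * flat_weight x * (C * (exp (real m * \<bar>x\<bar>) * inverse s ^ m))
        = (exp ((R + real m) * \<bar>x\<bar>) * flat_weight x) * (C * inverse s ^ m)"
      by (simp add: exp_add algebra_simps)
    also have "\<dots> \<le> (exp ((R + real m)\<^sup>2) * (fact (n + m) * s ^ (n + m))) * (C * inverse s ^ m)"
      unfolding s_def using False C by (intro mult_right_mono flat_weight_bound) auto
    also have "\<dots> = C' * s ^ n" using s by (simp add: C'_def power_add power_inverse field_simps)
    finally show ?thesis by (simp add: s_def)
  qed (use C in \<open>simp add: flat_fun_def C'_def\<close>)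
  moreover have "0 \<le> C'" using C by (simp add: C'_def)
  ultimately show ?thesis by blast
qed

definition flat_log_deriv :: "real \<Rightarrow> real" where
  "flat_log_deriv x = - 2 * x + 2 * pi * cos (pi * x) * inverse (sin (pi * x)) ^ 3"

lemma flat_log_deriv_trig_algebra: "(\<lambda>x. complex_of_real (flat_log_deriv x)) \<in> trig_algebra"
proof -
  have "(\<lambda>x. complex_of_real (flat_log_deriv x)) = (\<lambda>x. of_real (-2) * of_real x +
      of_real (2 * pi) * of_real (cos (pi * x)) * of_real (inverse (sin (pi * x))) ^ 3)"
    by (auto simp: flat_log_deriv_def)
  also have "\<dots> \<in> trig_algebra"
    by (intro trig_algebra.intros trig_algebra_power)
  finally show ?thesis .
qed

lemma flat_weight_has_deriv:
  assumes "x \<notin> \<int>"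
  shows "(flat_weight has_real_derivative flat_weight x * flat_log_deriv x) (at x)"
proof -
  let ?c = "cos (pi * x)" and ?i = "inverse (sin (pi * x))"
  have s: "sin (pi * x) \<noteq> 0" using assms by (simp add: sin_pi_eq_0_iff)
  have "((\<lambda>x. sin (pi * x)) has_real_derivative ?c * pi) (at x)"
    by (auto intro!: derivative_eq_intros)
  from DERIV_power[OF DERIV_inverse'[OF this s], of 2]
  have "((\<lambda>x. inverse (sin (pi * x)) ^ 2) has_real_derivative - 2 * pi * ?c * ?i ^ 3) (at x)"
    by (simp add: power3_eq_cube mult_ac)
  moreover have "((\<lambda>x. - x\<^sup>2) has_real_derivative - 2 * x) (at x)"
    by (auto intro!: derivative_eq_intros)
  ultimately have "((\<lambda>x. - x\<^sup>2 - inverse (sin (pi * x)) ^ 2) has_real_derivative (- 2 * x - - 2 * pi * ?c * ?i ^ 3)) (at x)"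
    by (intro DERIV_diff)
  from DERIV_fun_exp[OF this] show ?thesis by (simp add: flat_weight_def[abs_def] flat_log_deriv_def)
qed

text \<open>Off the integers this is the product rule with the logarithmic derivative of the weight.
  At an integer the function is quadratically small, so its derivative there is zero, in agreement
  with the case distinction in \<open>flat_fun\<close>.\<close>

lemma flat_deriv:
  assumes p: "p \<in> trig_algebra"
  shows "\<exists>q\<in>trig_algebra. \<forall>x. (flat_fun p has_vector_derivative flat_fun q x) (at x)"
proof -
  obtain p' where p': "p' \<in> trig_algebra" "\<And>x. x \<notin> \<int> \<Longrightarrow> (p has_vector_derivative p' x) (at x)"
    using trig_algebra_deriv[OF p] by blast
  define q where "q x = p' x + of_real (flat_log_deriv x) * p x" for x
  have q: "q \<in> trig_algebra" unfolding q_def by (intro trig_algebra.add trig_algebra.mult p' flat_log_deriv_trig_algebra p)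
  have "(flat_fun p has_vector_derivative flat_fun q x) (at x)" for x
  proof (cases "x \<in> \<int>")
    case False
    have "((\<lambda>x. of_real (flat_weight x) * p x) has_vector_derivative
        (of_real (flat_weight x) * p' x + of_real (flat_weight x * flat_log_deriv x) * p x)) (at x)"
      by (intro has_vector_derivative_mult of_real_has_vector_derivative flat_weight_has_deriv False p')
    then have "((\<lambda>x. of_real (flat_weight x) * p x) has_vector_derivative flat_fun q x) (at x)"
      using False by (simp add: flat_fun_def q_def algebra_simps)
    then show ?thesis
      by (rule has_vector_derivative_transform_within_open[of _ _ _ "- \<int>"])
        (use False in \<open>auto simp: flat_fun_def closed_of_int_image open_Compl\<close>)
  next
    case True
    obtain C where C: "0 \<le> C" "\<And>x. exp (0 * \<bar>x\<bar>) * norm (flat_fun p x) \<le> C * \<bar>sin (pi * x)\<bar> ^ 2"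
      using flat_bound[OF p] by blast
    show ?thesis
    proof (rule has_vector_derivative_quadratic)
      fix y
      obtain n :: int where n: "x = of_int n" using True by (auto elim: Ints_cases)
      have "\<bar>sin (pi * y)\<bar> = \<bar>sin (pi * (y - x) + of_int n * pi)\<bar>" by (simp add: n algebra_simps)
      also have "\<dots> = \<bar>sin (pi * (y - x))\<bar> * \<bar>cos (of_int n * pi)\<bar>"
        using sin_times_pi_eq_0[of "of_int n"] by (simp add: sin_add abs_mult)
      also have "\<dots> \<le> \<bar>pi * (y - x)\<bar> * 1"
        by (intro mult_mono abs_sin_x_le_abs_x abs_cos_le_one) auto
      finally have "\<bar>sin (pi * y)\<bar> ^ 2 \<le> (pi * \<bar>y - x\<bar>) ^ 2"
        by (intro power_mono) (auto simp: abs_mult)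
      then have "norm (flat_fun p y) \<le> C * (pi * \<bar>y - x\<bar>) ^ 2"
        using C(2)[of y] mult_left_mono[OF _ C(1), of "\<bar>sin (pi * y)\<bar> ^ 2" "(pi * \<bar>y - x\<bar>) ^ 2"] by simp
      then show "norm (flat_fun p y - flat_fun p x - of_real (y - x) * flat_fun q x) \<le> (C * pi\<^sup>2) * (y - x)\<^sup>2"
        using True by (simp add: flat_fun_def power_mult_distrib mult.assoc)
    qed
  qed
  with q show ?thesis by blast
qed

lemma flat_exp_decaying:
  assumes "p \<in> trig_algebra"
  shows "exp_decaying (flat_fun p)"
proof -
  have *: "smooth (flat_fun p) \<and> nth_deriv k (flat_fun p) \<in> flat_fun ` trig_algebra" for k
    by (rule nth_deriv_closed_set) (use assms flat_deriv in auto)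
  have "\<exists>C. \<forall>x. exp (R * \<bar>x\<bar>) * norm (nth_deriv k (flat_fun p) x) \<le> C" for k R
  proof -
    obtain q where q: "q \<in> trig_algebra" "nth_deriv k (flat_fun p) = flat_fun q" using * by blast
    with flat_bound[OF q(1), of R 0] show ?thesis by auto
  qed
  with * show ?thesis by (simp add: exp_decaying_def)
qed

section \<open>Taylor remainders of exponentials\<close>

text \<open>The Taylor remainder of the exponential, kept as a function of \<open>x\<close> so that
  it can multiply the function on which \<open>T\<close> acts.\<close>

definition wave_rem :: "nat \<Rightarrow> real \<Rightarrow> real \<Rightarrow> complex" where
  "wave_rem m a x = wave a x - (\<Sum>j<m. freq a ^ j / fact j * of_real x ^ j)"

text \<open>Truncated subtraction is correct here: for \<open>m = 0\<close> nothing has been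
  subtracted from the wave, and differentiation only multiplies by the frequency.\<close>

lemma wave_rem_has_deriv:
  "(wave_rem m a has_vector_derivative freq a * wave_rem (m - 1) a x) (at x)"
proof -
  let ?c = "freq a :: complex"
  have w: "(wave a has_vector_derivative ?c * wave a x) (at x)"
    using wave_has_deriv[of a 0 x] by simp
  have t: "((\<lambda>x. \<Sum>j<m. ?c ^ j / fact j * of_real x ^ j) has_vector_derivative
      ?c * (\<Sum>j<m - 1. ?c ^ j / fact j * of_real x ^ j)) (at x)"
  proof (cases m)
    case (Suc n)
    have "((\<lambda>z. \<Sum>j<Suc n. ?c ^ j / fact j * z ^ j) has_field_derivative
        (\<Sum>j<Suc n. ?c ^ j / fact j * (of_nat j * of_real x ^ (j - 1)))) (at (of_real x))"
      by (rule DERIV_sum) (auto intro!: derivative_eq_intros)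
    also have "(\<Sum>j<Suc n. ?c ^ j / fact j * (of_nat j * of_real x ^ (j - 1)))
        = (\<Sum>j<n. ?c ^ Suc j / fact (Suc j) * (of_nat (Suc j) * of_real x ^ j))"
      by (subst sum.lessThan_Suc_shift) simp
    also have "\<dots> = ?c * (\<Sum>j<n. ?c ^ j / fact j * of_real x ^ j)"
      unfolding sum_distrib_left by (intro sum.cong refl) (simp add: divide_simps del: of_nat_Suc)
    finally show ?thesis
      using has_vector_derivative_real_field unfolding Suc by fastforce
  qed simp
  from has_vector_derivative_diff[OF w t] show ?thesis
    by (simp add: wave_rem_def[abs_def] right_diff_distrib)
qed

lemma nth_deriv_wave_rem:
  "nth_deriv k (wave_rem m a) = (\<lambda>x. freq a ^ k * wave_rem (m - k) a x)"
  and smooth_wave_rem: "smooth (wave_rem m a)"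
proof -
  let ?D = "\<lambda>k x. freq a ^ k * wave_rem (m - k) a x"
  have "(?D k has_vector_derivative ?D (Suc k) x) (at x)" for k x
    using has_vector_derivative_mult_right[OF wave_rem_has_deriv[of "m - k" a x], of "freq a ^ k"]
    by (simp add: mult.assoc mult.left_commute)
  note nth_deriv_unique[of ?D, OF this] smooth_nth_deriv_sequence[of ?D, OF this]
  then show "nth_deriv k (wave_rem m a) = ?D k" "smooth (wave_rem m a)" by simp_all
qed

lemma norm_wave_rem_le: "norm (wave_rem m a x) \<le> (2 * pi * \<bar>a\<bar> * \<bar>x\<bar>) ^ m / fact m"
proof (cases m)
  case (Suc n)
  have "wave_rem m a x = iexp (2 * pi * a * x) - (\<Sum>k\<le>n. (\<i> * of_real (2 * pi * a * x)) ^ k / fact k)"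
    unfolding wave_rem_def Suc lessThan_Suc_atMost wave_iexp by (simp add: power_mult_distrib mult_ac)
  also have "norm \<dots> \<le> \<bar>2 * pi * a * x\<bar> ^ Suc n / fact (Suc n)" by (rule iexp_approx1)
  finally show ?thesis by (simp add: Suc abs_mult)
qed (simp add: wave_rem_def)

lemma norm_nth_deriv_wave_rem_le:
  "norm (nth_deriv k (wave_rem m a) x) \<le> (2 * pi * \<bar>a\<bar>) ^ k * ((2 * pi * \<bar>a\<bar> * \<bar>x\<bar>) ^ (m - k) / fact (m - k))"
  unfolding nth_deriv_wave_rem norm_mult norm_power
  using mult_left_mono[OF norm_wave_rem_le[of "m - k" a x], of "(2 * pi * \<bar>a\<bar>) ^ k"]
  by (simp add: norm_mult)

lemma exp_growing_wave_rem: "exp_growing (wave_rem m a)"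
proof (rule exp_growingI[OF smooth_wave_rem])
  fix k x
  have "(2 * pi * \<bar>a\<bar> * \<bar>x\<bar>) ^ (m - k) / fact (m - k) \<le> exp ((2 * pi * \<bar>a\<bar>) * \<bar>x\<bar>)"
    using power_le_fact_exp[of "2 * pi * \<bar>a\<bar> * \<bar>x\<bar>" "m - k"] by (simp add: field_simps)
  then have "(2 * pi * \<bar>a\<bar>) ^ k * ((2 * pi * \<bar>a\<bar> * \<bar>x\<bar>) ^ (m - k) / fact (m - k)) \<le> (2 * pi * \<bar>a\<bar>) ^ k * exp ((2 * pi * \<bar>a\<bar>) * \<bar>x\<bar>)"
    by (intro mult_left_mono) auto
  then show "norm (nth_deriv k (wave_rem m a) x) \<le> (2 * pi * \<bar>a\<bar>) ^ k * exp ((2 * pi * \<bar>a\<bar>) * \<bar>x\<bar>)"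
    by (rule order_trans[OF norm_nth_deriv_wave_rem_le])
qed

text \<open>Each derivative lowers the order of the remainder by one but yields a factor of the
  frequency, so the full power of |a| survives. Derivatives beyond the order \<open>m\<close> yield
  surplus factors, which L^M absorbs.\<close>

lemma wave_rem_small_frequency:
  assumes "2 * pi * \<bar>a\<bar> \<le> L" "1 \<le> L" "k \<le> M"
  shows "norm (nth_deriv k (wave_rem m a) x) \<le> (2 * pi * \<bar>a\<bar>) ^ m * L ^ M * exp \<bar>x\<bar>"
proof -
  define l where "l = 2 * pi * \<bar>a\<bar>"
  have l: "0 \<le> l" "l \<le> L" using assms by (auto simp: l_def)
  have L: "1 \<le> L ^ M" using assms by simp
  have "norm (nth_deriv k (wave_rem m a) x) \<le> l ^ k * ((l * \<bar>x\<bar>) ^ (m - k) / fact (m - k))"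
    unfolding l_def by (rule norm_nth_deriv_wave_rem_le)
  also have "\<dots> = l ^ (k + (m - k)) * (\<bar>x\<bar> ^ (m - k) / fact (m - k))"
    by (simp add: power_add power_mult_distrib)
  also have "\<dots> \<le> l ^ m * L ^ M * exp \<bar>x\<bar>"
  proof (rule mult_mono)
    show "\<bar>x\<bar> ^ (m - k) / fact (m - k) \<le> exp \<bar>x\<bar>"
      using power_le_fact_exp[of "\<bar>x\<bar>" "m - k"] by (simp add: field_simps)
    show "l ^ (k + (m - k)) \<le> l ^ m * L ^ M"
    proof (cases "k \<le> m")
      case True
      then show ?thesis using mult_left_mono[OF L, of "l ^ m"] l by simp
    next
      case False
      then have "l ^ (k + (m - k)) = l ^ m * l ^ (k - m)" by (simp add: power_add[symmetric])
      also have "\<dots> \<le> l ^ m * L ^ (k - m)" using l by (intro mult_left_mono power_mono) auto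
      also have "\<dots> \<le> l ^ m * L ^ M" using l assms by (intro mult_left_mono power_increasing) auto
      finally show ?thesis .
    qed
  qed (use l assms in auto)
  finally show ?thesis by (simp add: l_def)
qed

text \<open>Doubling the exponential rate gains 2^(-n) in the n-th Taylor term. At a fixed frequency
  the remainders thus tend to zero geometrically in \<open>m\<close> in one fixed weighted
  norm.\<close>

lemma wave_rem_high_order:
  assumes "k \<le> M" "M \<le> m"
  shows "norm (nth_deriv k (wave_rem m a) x) \<le> (1 + 2 * pi * \<bar>a\<bar>) ^ M * 2 ^ M * (1 / 2) ^ m * exp (4 * pi * \<bar>a\<bar> * \<bar>x\<bar>)"
proof -
  define l where "l = 2 * pi * \<bar>a\<bar>"
  have l: "0 \<le> l" by (simp add: l_def)
  define n where "n = m - k"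
  have "norm (nth_deriv k (wave_rem m a) x) \<le> l ^ k * ((l * \<bar>x\<bar>) ^ n / fact n)"
    unfolding l_def n_def by (rule norm_nth_deriv_wave_rem_le)
  also have "(l * \<bar>x\<bar>) ^ n / fact n = (1 / 2) ^ n * ((2 * l * \<bar>x\<bar>) ^ n / fact n)"
    by (simp add: power_mult_distrib power_divide)
  also have "l ^ k * \<dots> \<le> (1 + l) ^ M * ((1 / 2) ^ n * exp (2 * l * \<bar>x\<bar>))"
  proof (intro mult_mono)
    have "l ^ k \<le> (1 + l) ^ k" using l by (intro power_mono) auto
    also have "\<dots> \<le> (1 + l) ^ M" using l assms by (intro power_increasing) auto
    finally show "l ^ k \<le> (1 + l) ^ M" .
    show "(2 * l * \<bar>x\<bar>) ^ n / fact n \<le> exp (2 * l * \<bar>x\<bar>)"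
      using power_le_fact_exp[of "2 * l * \<bar>x\<bar>" n] l by (simp add: field_simps)
  qed (use l in auto)
  also have "(1 / 2) ^ n = 2 ^ k * (1 / 2 :: real) ^ m"
    using assms power_add[of "1 / 2 :: real" k n] by (simp add: n_def power_divide)
  also have "(1 + l) ^ M * (2 ^ k * (1 / 2) ^ m * exp (2 * l * \<bar>x\<bar>)) \<le> (1 + l) ^ M * (2 ^ M * (1 / 2) ^ m * exp (2 * l * \<bar>x\<bar>))"
    using l assms by (intro mult_left_mono mult_right_mono power_increasing) auto
  finally show ?thesis by (simp add: l_def mult_ac)
qed

lemma poly_times_power_bounded:
  assumes q: "0 < q" "q < (1::real)"
  shows "\<exists>D\<ge>0. \<forall>n. (1 + real n) ^ M * q ^ n \<le> D"
proof -
  \<comment> \<open>With q^n = exp(- d n), the polynomial is absorbed by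
    \<open>power_le_fact_exp\<close> at d (1 + n).\<close>
  define d where "d = - ln q"
  have d: "0 < d" using q by (simp add: d_def)
  have "(1 + real n) ^ M * q ^ n \<le> fact M / d ^ M * exp d" for n
  proof -
    have "(d * (1 + real n)) ^ M \<le> fact M * exp (d * (1 + real n))"
      using d by (intro power_le_fact_exp) auto
    then have "(1 + real n) ^ M \<le> fact M / d ^ M * exp (d * (1 + real n))"
      using d by (simp only: power_mult_distrib) (simp add: pos_le_divide_eq mult.commute)
    then have "(1 + real n) ^ M * q ^ n \<le> fact M / d ^ M * exp (d * (1 + real n)) * q ^ n"
      using q by (intro mult_right_mono) auto
    also have "\<dots> = fact M / d ^ M * (exp (d * (1 + real n)) * exp (- d * real n))"
      using q by (simp add: d_def exp_of_nat_mult mult.commute)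
    also have "exp (d * (1 + real n)) * exp (- d * real n) = exp d"
      by (simp add: exp_add[symmetric] algebra_simps)
    finally show ?thesis .
  qed
  moreover have "0 \<le> fact M / d ^ M * exp d" using d by simp
  ultimately show ?thesis by blast
qed

section \<open>Uniqueness for distributions tested against a flat function\<close>

lemma linear_sum_schwartz:
  assumes "complex_linear_on schwartz_space T" "finite J" "\<And>j. j \<in> J \<Longrightarrow> f j \<in> schwartz_space"
  shows "T (\<lambda>x. \<Sum>j\<in>J. c j * f j x) = (\<Sum>j\<in>J. c j * T (f j)) \<and> (\<lambda>x. \<Sum>j\<in>J. c j * f j x) \<in> schwartz_space"
  using assms(2,3)
proof induction
  case empty
  show ?case using linear_zero[OF assms(1) zero_schwartz] by simp
next
  case (insert a J)
  then show ?case
    using linear_add[OF assms(1) schwartz_cmult[of "f a" "c a"], of "\<lambda>x. \<Sum>j\<in>J. c j * f j x"]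
      linear_cmult[OF assms(1), of "f a" "c a"] schwartz_add[OF schwartz_cmult[of "f a" "c a"], of "\<lambda>x. \<Sum>j\<in>J. c j * f j x"]
    by simp
qed

text \<open>Continuity of w -> T (w g) in the norm with \<open>M\<close> derivatives and weight
  exp(-R|x|). For \<open>exp_decaying\<close> functions \<open>g\<close>, the order \<open>M\<close>
  is that of \<open>T\<close>, whatever \<open>g\<close> and \<open>R\<close> are; only
  \<open>K\<close> changes.\<close>

definition multiplier_bound ::
    "((real \<Rightarrow> complex) \<Rightarrow> complex) \<Rightarrow> nat \<Rightarrow> (real \<Rightarrow> complex) \<Rightarrow> real \<Rightarrow> real \<Rightarrow> bool" where
  "multiplier_bound T M g R K \<longleftrightarrow> 0 \<le> K \<and> (\<forall>w B. exp_growing w \<longrightarrow>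
     (\<forall>k\<le>M. \<forall>x. norm (nth_deriv k w x) \<le> B * exp (R * \<bar>x\<bar>)) \<longrightarrow> norm (T (\<lambda>x. w x * g x)) \<le> K * B)"

lemma multiplier_bound_nonneg: "multiplier_bound T M g R K \<Longrightarrow> 0 \<le> K"
  by (simp add: multiplier_bound_def)

lemma multiplier_boundD:
  "multiplier_bound T M g R K \<Longrightarrow> exp_growing w \<Longrightarrow>
   (\<And>k x. k \<le> M \<Longrightarrow> norm (nth_deriv k w x) \<le> B * exp (R * \<bar>x\<bar>)) \<Longrightarrow> norm (T (\<lambda>x. w x * g x)) \<le> K * B"
  by (simp add: multiplier_bound_def)

lemma exists_multiplier_bound:
  assumes T: "schwartz_bounded T M C" "0 \<le> C" and g: "exp_decaying g"
  shows "\<exists>K. multiplier_bound T M g R K"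
proof -
  obtain K where K: "0 \<le> K" "\<And>w B. smooth w \<Longrightarrow> (\<forall>k\<le>M. \<forall>x. norm (nth_deriv k w x) \<le> B * exp (R * \<bar>x\<bar>)) \<Longrightarrow>
     schwartz_le M (\<lambda>x. w x * g x) (K * B)"
    using exp_growing_mult_decaying_bound[OF g, of M R] by metis
  have "norm (T (\<lambda>x. w x * g x)) \<le> (C * K) * B"
    if w: "exp_growing w" "\<forall>k\<le>M. \<forall>x. norm (nth_deriv k w x) \<le> B * exp (R * \<bar>x\<bar>)" for w B
  proof -
    have "smooth w" using w(1) by (simp add: exp_growing_def)
    from K(2)[OF this w(2)] have "norm (T (\<lambda>x. w x * g x)) \<le> C * (K * B)"
      using T(1) exp_growing_mult_decaying_schwartz[OF w(1) g] unfolding schwartz_bounded_iff by blast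
    then show ?thesis by (simp add: mult.assoc)
  qed
  with K(1) T(2) show ?thesis by (intro exI[of _ "C * K"]) (auto simp: multiplier_bound_def)
qed

lemma norm_nth_deriv_wave_of_int_le:
  assumes "j \<le> M"
  shows "norm (nth_deriv j (wave (of_int n)) x) \<le> (2 * pi * (1 + real_of_int \<bar>n\<bar>)) ^ M"
proof -
  have "norm (nth_deriv j (wave (of_int n)) x) = (2 * pi * real_of_int \<bar>n\<bar>) ^ j"
    by (simp add: nth_deriv_wave norm_mult norm_power)
  also have "\<dots> \<le> (2 * pi * (1 + real_of_int \<bar>n\<bar>)) ^ j" by (intro power_mono mult_left_mono) auto
  also have "\<dots> \<le> (2 * pi * (1 + real_of_int \<bar>n\<bar>)) ^ M"
    using assms pi_ge_two mult_mono[of 1 "2 * pi" 1 "1 + real_of_int \<bar>n\<bar>"] by (intro power_increasing) auto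
  finally show ?thesis .
qed

text \<open>This is 1 / (1 - exp(2 pi i x)), written as 1/2 + (i/2) cot(pi x) to make it visibly a
  member of \<open>trig_algebra\<close>.\<close>

definition cot_factor :: "real \<Rightarrow> complex" where
  "cot_factor x = of_real (1 / 2) + \<i> / 2 * (of_real (cos (pi * x)) * of_real (inverse (sin (pi * x))))"

lemma cot_factor_trig_algebra: "cot_factor \<in> trig_algebra"
  unfolding cot_factor_def[abs_def] by (intro trig_algebra.intros)

lemma cot_factor_eq:
  assumes "x \<notin> \<int>"
  shows "(1 - wave 1 x) * cot_factor x = 1"
proof -
  define s c where "s = complex_of_real (sin (pi * x))" and "c = complex_of_real (cos (pi * x))"
  have s: "s \<noteq> 0" using assms by (simp add: s_def sin_pi_eq_0_iff)
  have sc: "s\<^sup>2 + c\<^sup>2 = 1" unfolding s_def c_def by (simp flip: of_real_power of_real_add)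
  have "wave 1 x = cis (pi * x) ^ 2"
    by (simp add: wave_iexp cis_conv_exp exp_of_nat_mult[symmetric] mult_ac)
  also have "cis (pi * x) = c + \<i> * s" by (simp add: complex_eq_iff s_def c_def)
  finally have "1 - wave 1 x = s\<^sup>2 + c\<^sup>2 - (c + \<i> * s)\<^sup>2" using sc by simp
  also have "\<dots> = - 2 * \<i> * s * (c + \<i> * s)" by (simp add: power2_eq_square algebra_simps)
  finally have w: "1 - wave 1 x = - 2 * \<i> * s * (c + \<i> * s)" .
  have "cot_factor x = (s + \<i> * c) / (2 * s)"
    using s by (simp add: cot_factor_def s_def[symmetric] c_def[symmetric] field_simps)
  then have "(1 - wave 1 x) * cot_factor x = - \<i> * (c + \<i> * s) * (s + \<i> * c)"
    unfolding w using s by (simp add: field_simps)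
  also have "\<dots> = s\<^sup>2 + c\<^sup>2" by (simp add: power2_eq_square algebra_simps)
  finally show ?thesis using sc by simp
qed

definition xpow :: "nat \<Rightarrow> real \<Rightarrow> complex" where
  "xpow j x = of_real x ^ j"

lemma xpow_trig_algebra: "xpow j \<in> trig_algebra"
  unfolding xpow_def[abs_def] by (intro trig_algebra_power trig_algebra.ident)

lemma wave_flat_schwartz: "p \<in> trig_algebra \<Longrightarrow> (\<lambda>x. wave s x * flat_fun p x) \<in> schwartz_space"
  by (intro exp_growing_mult_decaying_schwartz exp_growing_wave flat_exp_decaying)

text \<open>The functions \<open>flat_fun p\<close> stay in the Schwartz class when divided by powers of \<open>1 - wave 1\<close>, and
  the growth order \<open>M\<close> of the resulting coefficients does not depend on the power.\<close>
lemma flat_coefficients_zero: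
  assumes lin: "complex_linear_on schwartz_space T" and bd: "schwartz_bounded T M C" "0 \<le> C"
    and p: "p \<in> trig_algebra" and r: "0 < r" "r < 1"
    and decay: "\<And>n. norm (T (\<lambda>x. wave (of_int n) x * flat_fun p x)) \<le> D * r ^ nat \<bar>n\<bar>"
  shows "T (\<lambda>x. wave (of_int n) x * flat_fun p x) = 0"
proof -
  define u where "u k n = T (\<lambda>x. wave (of_int n) x * flat_fun (\<lambda>x. p x * cot_factor x ^ k) x)" for k n
  have pk: "(\<lambda>x. p x * cot_factor x ^ k) \<in> trig_algebra" for k
    by (intro trig_algebra.mult p trig_algebra_power cot_factor_trig_algebra)
  have "u 0 n = 0"
  proof (rule antidifference_chain_zero[OF _ _ r])
    fix k n
    have "u (Suc k) n - u (Suc k) (n + 1) = T (\<lambda>x. wave (of_int n) x * flat_fun (\<lambda>x. p x * cot_factor x ^ Suc k) x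
        - wave (of_int (n + 1)) x * flat_fun (\<lambda>x. p x * cot_factor x ^ Suc k) x)"
      unfolding u_def by (rule linear_diff[OF lin, symmetric]) (intro wave_flat_schwartz schwartz_cmult pk)+
    also have "(\<lambda>x. wave (of_int n) x * flat_fun (\<lambda>x. p x * cot_factor x ^ Suc k) x
        - wave (of_int (n + 1)) x * flat_fun (\<lambda>x. p x * cot_factor x ^ Suc k) x)
       = (\<lambda>x. wave (of_int n) x * flat_fun (\<lambda>x. p x * cot_factor x ^ k) x)"
    proof
      fix x
      show "wave (of_int n) x * flat_fun (\<lambda>x. p x * cot_factor x ^ Suc k) x
        - wave (of_int (n + 1)) x * flat_fun (\<lambda>x. p x * cot_factor x ^ Suc k) x
        = wave (of_int n) x * flat_fun (\<lambda>x. p x * cot_factor x ^ k) x"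
      proof (cases "x \<in> \<int>")
        case False
        have "wave (of_int n) x * flat_fun (\<lambda>x. p x * cot_factor x ^ Suc k) x
            - wave (of_int (n + 1)) x * flat_fun (\<lambda>x. p x * cot_factor x ^ Suc k) x
          = wave (of_int n) x * flat_fun (\<lambda>x. p x * cot_factor x ^ k) x * ((1 - wave 1 x) * cot_factor x)"
          using False by (simp add: wave_add flat_fun_def algebra_simps)
        then show ?thesis by (simp add: cot_factor_eq[OF False])
      qed (simp add: flat_fun_def)
    qed
    finally show "u (Suc k) n - u (Suc k) (n + 1) = u k n" by (simp add: u_def)
  next
    fix k
    \<comment> \<open>The derivatives of a wave are bounded, so rate 0 suffices; up to
      \<open>M\<close> of them at frequency \<open>n\<close> give the exponent \<open>M\<close> for
      every \<open>k\<close>.\<close>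
    obtain K where K: "multiplier_bound T M (flat_fun (\<lambda>x. p x * cot_factor x ^ k)) 0 K"
      using exists_multiplier_bound[OF bd flat_exp_decaying[OF pk]] by blast
    have "norm (u k n) \<le> (K * (2 * pi) ^ M) * (1 + real_of_int \<bar>n\<bar>) ^ M" for n
    proof -
      have "norm (u k n) \<le> K * (2 * pi * (1 + real_of_int \<bar>n\<bar>)) ^ M"
        unfolding u_def by (rule multiplier_boundD[OF K exp_growing_wave])
          (use norm_nth_deriv_wave_of_int_le in simp)
      then show ?thesis by (simp add: power_mult_distrib mult.assoc)
    qed
    then show "\<exists>B. \<forall>n. norm (u k n) \<le> B * (1 + real_of_int \<bar>n\<bar>) ^ M" by blast
  next
    show "norm (u 0 n) \<le> D * r ^ nat \<bar>n\<bar>" for n using decay by (simp add: u_def)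
  qed
  then show ?thesis by (simp add: u_def)
qed

text \<open>Since \<open>a n \<noteq> 0\<close>, Taylor expansion at the integers and the vanishing of the lower order terms
  turn the zeros at \<open>n + a n\<close> into exponential decay of the next Taylor coefficient.\<close>
lemma flat_moments_zero:
  assumes lin: "complex_linear_on schwartz_space T" and bd: "schwartz_bounded T M C" "0 \<le> C"
    and a: "\<And>n. a n \<noteq> 0" "\<And>n. \<bar>a n\<bar> < A * r ^ nat \<bar>n\<bar>" and r: "0 < r" "r < 1"
    and zero: "\<And>n. T (\<lambda>x. wave (of_int n + a n) x * flat_fun (xpow 0) x) = 0"
  shows "T (\<lambda>x. wave (of_int n) x * flat_fun (xpow J) x) = 0"
proof (induction J arbitrary: n rule: less_induct)
  case (less J)
  define m where "m = Suc J"
  have A: "0 < A"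
    using a[of 0] by (simp add: order_le_less_trans[OF abs_ge_zero])
  \<comment> \<open>A bound for all the frequencies 2 pi |a n|, made at least 1 so that its powers
    increase.\<close>
  define L where "L = 2 * pi * A + 1"
  have L1: "1 \<le> L" using A by (simp add: L_def)
  have aL: "2 * pi * \<bar>a n\<bar> \<le> L" for n
  proof -
    have "\<bar>a n\<bar> \<le> A * r ^ nat \<bar>n\<bar>" using a(2)[of n] by simp
    also have "\<dots> \<le> A * 1" using A r by (intro mult_left_mono power_le_one) auto
    finally have "2 * pi * \<bar>a n\<bar> \<le> 2 * pi * A" by (intro mult_left_mono) auto
    then show ?thesis unfolding L_def by linarith
  qed
  obtain K where K: "multiplier_bound T M (flat_fun (xpow 0)) 1 K"
    using exists_multiplier_bound[OF bd flat_exp_decaying[OF xpow_trig_algebra]] by blast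
  note K0 = multiplier_bound_nonneg[OF K]
  define W where "W = K * (2 ^ M * (2 * pi) ^ M * ((2 * pi) ^ m * L ^ M)) * fact J / (2 * pi) ^ J"
  have W0: "0 \<le> W" using K0 L1 by (simp add: W_def)
  have main: "norm (T (\<lambda>x. wave (of_int n) x * flat_fun (xpow J) x)) \<le> W * ((1 + real_of_int \<bar>n\<bar>) ^ M * \<bar>a n\<bar>)" for n
  proof -
    define c where "c j = freq (a n) ^ j / fact j" for j :: nat
    define F where "F j = (\<lambda>x. wave (of_int n) x * flat_fun (xpow j) x)" for j
    have FS: "F j \<in> schwartz_space" for j unfolding F_def by (intro wave_flat_schwartz xpow_trig_algebra)
    \<comment> \<open>What is left of the shifted wave after the terms of degree up to J are split
      off. Those of degree below J vanish by the induction hypothesis, so the coefficient of degree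
      J is controlled by \<open>w\<close> alone.\<close>
    define w where "w = (\<lambda>x. wave (of_int n) x * wave_rem m (a n) x)"
    have wg: "exp_growing w" unfolding w_def by (intro exp_growing_mult exp_growing_wave exp_growing_wave_rem)
    have wS: "(\<lambda>x. w x * flat_fun (xpow 0) x) \<in> schwartz_space"
      by (intro exp_growing_mult_decaying_schwartz wg flat_exp_decaying xpow_trig_algebra)
    have flat_xpow: "flat_fun (xpow j) x = of_real x ^ j * flat_fun (xpow 0) x" for j x
      by (simp add: flat_fun_def xpow_def)
    have dec: "wave (of_int n + a n) x * flat_fun (xpow 0) x = w x * flat_fun (xpow 0) x + (\<Sum>j<m. c j * F j x)" for x
    proof -
      have "(\<Sum>j<m. c j * F j x) = wave (of_int n) x * (\<Sum>j<m. c j * of_real x ^ j) * flat_fun (xpow 0) x"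
        unfolding F_def by (subst flat_xpow) (simp add: sum_distrib_left sum_distrib_right mult_ac)
      then show ?thesis unfolding w_def wave_rem_def c_def wave_add by (simp add: algebra_simps)
    qed
    note sums = linear_sum_schwartz[OF lin, of "{..<m}" F c]
    have "0 = T (\<lambda>x. w x * flat_fun (xpow 0) x + (\<Sum>j<m. c j * F j x))"
      using zero[of n] unfolding dec by simp
    also have "\<dots> = T (\<lambda>x. w x * flat_fun (xpow 0) x) + (\<Sum>j<m. c j * T (F j))"
      using linear_add[OF lin wS, of "\<lambda>x. \<Sum>j<m. c j * F j x"] sums FS by simp
    also have "(\<Sum>j<m. c j * T (F j)) = c J * T (F J)"
      using less.IH unfolding m_def F_def by simp
    finally have eq: "c J * T (F J) = - T (\<lambda>x. w x * flat_fun (xpow 0) x)" by (simp add: eq_neg_iff_add_eq_0 add.commute)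
    define l where "l = 2 * pi * \<bar>a n\<bar>"
    have l: "0 < l" using a(1)[of n] by (simp add: l_def)
    define P where "P = (2 * pi * (1 + real_of_int \<bar>n\<bar>)) ^ M"
    have "norm (nth_deriv k w x) \<le> (2 ^ M * P * (l ^ m * L ^ M)) * exp (1 * \<bar>x\<bar>)" if k: "k \<le> M" for k x
    proof -
      have "norm (nth_deriv k w x) \<le> 2 ^ k * P * (l ^ m * L ^ M * exp \<bar>x\<bar>)"
        unfolding w_def
      proof (rule nth_deriv_mult_bound[OF smooth_wave smooth_wave_rem])
        fix j assume j: "j \<le> k"
        show "norm (nth_deriv j (wave (of_int n)) x) \<le> P"
          unfolding P_def using j k by (intro norm_nth_deriv_wave_of_int_le) simp
        show "norm (nth_deriv j (wave_rem m (a n)) x) \<le> l ^ m * L ^ M * exp \<bar>x\<bar>"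
          unfolding l_def using j k by (intro wave_rem_small_frequency aL L1) auto
      qed
      also have "\<dots> \<le> 2 ^ M * P * (l ^ m * L ^ M * exp \<bar>x\<bar>)"
        using k l L1 by (intro mult_right_mono power_increasing) (auto simp: P_def)
      finally show ?thesis by (simp add: mult_ac)
    qed
    then have "norm (T (\<lambda>x. w x * flat_fun (xpow 0) x)) \<le> K * (2 ^ M * P * (l ^ m * L ^ M))"
      by (rule multiplier_boundD[OF K wg])
    then have "norm (c J) * norm (T (F J)) \<le> K * (2 ^ M * P * (l ^ m * L ^ M))"
      using eq by (simp flip: norm_mult)
    moreover have "norm (c J) = l ^ J / fact J"
      by (simp add: c_def l_def norm_divide norm_power norm_mult)
    ultimately have "norm (T (F J)) \<le> K * (2 ^ M * P * (l ^ m * L ^ M)) * fact J / l ^ J"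
      using l by (simp add: field_simps)
    \<comment> \<open>Of the J + 1 powers of |a n| in the remainder, J are cancelled by the Taylor
      coefficient; the remaining one carries the exponential decay.\<close>
    also have "\<dots> = K * (2 ^ M * P * ((2 * pi) ^ m * \<bar>a n\<bar> * L ^ M)) * fact J / (2 * pi) ^ J"
      using a(1)[of n] by (simp add: l_def m_def power_mult_distrib field_simps)
    also have "\<dots> = W * ((1 + real_of_int \<bar>n\<bar>) ^ M * \<bar>a n\<bar>)"
      unfolding W_def P_def power_mult_distrib by simp
    finally show ?thesis by (simp add: F_def)
  qed
  \<comment> \<open>A rate strictly between \<open>r\<close> and 1: the gap absorbs the polynomial
    factor (1 + |n|)^M.\<close>
  define q where "q = (1 + r) / 2"
  have q: "0 < q" "q < 1" "0 < r / q" "r / q < 1" using r by (auto simp: q_def field_simps)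
  obtain D where D: "0 \<le> D" "\<And>n. (1 + real n) ^ M * (r / q) ^ n \<le> D"
    using poly_times_power_bounded[OF q(3,4), of M] by blast
  have "norm (T (\<lambda>x. wave (of_int n) x * flat_fun (xpow J) x)) \<le> (W * A * D) * q ^ nat \<bar>n\<bar>" for n
  proof -
    define N where "N = nat \<bar>n\<bar>"
    have N: "real_of_int \<bar>n\<bar> = real N" by (simp add: N_def)
    have "(1 + real N) ^ M * \<bar>a n\<bar> \<le> (1 + real N) ^ M * (A * r ^ N)"
      using a(2)[of n] by (intro mult_left_mono) (auto simp: N_def)
    also have "r ^ N = (r / q) ^ N * q ^ N" using q by (simp add: power_divide)
    also have "(1 + real N) ^ M * (A * ((r / q) ^ N * q ^ N)) = A * ((1 + real N) ^ M * (r / q) ^ N) * q ^ N"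
      by simp
    also have "\<dots> \<le> A * D * q ^ N" using A q D by (intro mult_right_mono mult_left_mono) auto
    finally have "W * ((1 + real N) ^ M * \<bar>a n\<bar>) \<le> W * (A * D * q ^ N)"
      using W0 by (intro mult_left_mono)
    with main[of n] show ?thesis unfolding N by (simp add: N_def mult.assoc)
  qed
  then show ?case by (rule flat_coefficients_zero[OF lin bd xpow_trig_algebra q(1,2)])
qed

text \<open>The entire function s -> T (wave s psi), with psi = \<open>flat_fun (xpow 0)\<close>, is
  treated through its Taylor polynomials at 0: their coefficients vanish by \<open>mom\<close>, and
  the remainder tends to zero as its order grows.\<close>

lemma flat_transform_zero:
  assumes lin: "complex_linear_on schwartz_space T" and bd: "schwartz_bounded T M C" "0 \<le> C"
    and mom: "\<And>j. T (flat_fun (xpow j)) = 0"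
  shows "T (\<lambda>x. wave s x * flat_fun (xpow 0) x) = 0"
proof -
  obtain K where K: "multiplier_bound T M (flat_fun (xpow 0)) (4 * pi * \<bar>s\<bar>) K"
    using exists_multiplier_bound[OF bd flat_exp_decaying[OF xpow_trig_algebra]] by blast
  define E where "E = (1 + 2 * pi * \<bar>s\<bar>) ^ M * 2 ^ M"
  have le: "norm (T (\<lambda>x. wave s x * flat_fun (xpow 0) x)) \<le> K * (E * (1 / 2) ^ m)" if m: "M \<le> m" for m
  proof -
    define c where "c j = freq s ^ j / fact j" for j :: nat
    have S: "flat_fun (xpow j) \<in> schwartz_space" for j
      by (intro exp_decaying_schwartz flat_exp_decaying xpow_trig_algebra)
    have wS: "(\<lambda>x. wave_rem m s x * flat_fun (xpow 0) x) \<in> schwartz_space"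
      by (intro exp_growing_mult_decaying_schwartz exp_growing_wave_rem flat_exp_decaying xpow_trig_algebra)
    have flat_xpow: "flat_fun (xpow j) x = of_real x ^ j * flat_fun (xpow 0) x" for j x
      by (simp add: flat_fun_def xpow_def)
    have "(\<Sum>j<m. c j * flat_fun (xpow j) x) = (\<Sum>j<m. c j * of_real x ^ j) * flat_fun (xpow 0) x" for x
      unfolding sum_distrib_right by (intro sum.cong refl) (subst flat_xpow, simp)
    then have "wave s x * flat_fun (xpow 0) x = wave_rem m s x * flat_fun (xpow 0) x + (\<Sum>j<m. c j * flat_fun (xpow j) x)" for x
      by (simp add: wave_rem_def c_def left_diff_distrib)
    then have "T (\<lambda>x. wave s x * flat_fun (xpow 0) x) = T (\<lambda>x. wave_rem m s x * flat_fun (xpow 0) x) + (\<Sum>j<m. c j * T (flat_fun (xpow j)))"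
      using linear_add[OF lin wS, of "\<lambda>x. \<Sum>j<m. c j * flat_fun (xpow j) x"] linear_sum_schwartz[OF lin, of "{..<m}" "\<lambda>j. flat_fun (xpow j)" c] S
      by simp
    also have "\<dots> = T (\<lambda>x. wave_rem m s x * flat_fun (xpow 0) x)" by (simp add: mom)
    also have "norm \<dots> \<le> K * (E * (1 / 2) ^ m)"
      unfolding E_def by (rule multiplier_boundD[OF K exp_growing_wave_rem]) (rule wave_rem_high_order[OF _ m])
    finally show ?thesis .
  qed
  have "(\<lambda>m. K * (E * (1 / 2) ^ m)) \<longlonglongrightarrow> K * (E * 0)"
    by (intro tendsto_intros LIMSEQ_realpow_zero) auto
  then have "norm (T (\<lambda>x. wave s x * flat_fun (xpow 0) x)) \<le> K * (E * 0)"
    by (rule LIMSEQ_le_const) (use le in blast)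
  then show ?thesis by simp
qed

section \<open>From waves to arbitrary Schwartz multipliers\<close>

lemma lipschitz_of_deriv_bound:
  fixes \<phi> :: "real \<Rightarrow> complex"
  assumes "\<And>t. (\<phi> has_vector_derivative \<phi>' t) (at t)" "\<And>t. norm (\<phi>' t) \<le> K"
  shows "norm (\<phi> t - \<phi> s) \<le> K * \<bar>t - s\<bar>"
proof -
  have "norm (\<phi> t - \<phi> s) \<le> K * norm (t - s)"
  proof (rule differentiable_bound[OF convex_UNIV])
    show "(\<phi> has_derivative (\<lambda>h. h *\<^sub>R \<phi>' x)) (at x within UNIV)" for x
      using assms(1) by (simp add: has_vector_derivative_def)
    have "K \<ge> 0" using assms(2) norm_ge_zero order_trans by blast
    then show "onorm (\<lambda>h. h *\<^sub>R \<phi>' x) \<le> K" for x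
      by (intro onorm_le) (simp add: mult_right_mono[OF assms(2)] mult.commute[of "\<bar>_\<bar>"])
  qed auto
  then show ?thesis by simp
qed

lemma constant_of_quadratic_bound:
  fixes \<phi> :: "real \<Rightarrow> complex"
  assumes le: "\<And>s t. s \<le> t \<Longrightarrow> norm (\<phi> t - \<phi> s) \<le> K * (t - s)\<^sup>2"
  shows "\<phi> s = \<phi> t"
proof -
  have le': "norm (\<phi> t - \<phi> s) \<le> K * (t - s)\<^sup>2" for s t
    using le[of s t] le[of t s] by (cases "s \<le> t") (auto simp: norm_minus_commute power2_commute)
  have "(\<phi> has_vector_derivative 0) (at x)" for x
    by (rule has_vector_derivative_quadratic[where K = K]) (simp add: le')
  then obtain c where "\<And>x. \<phi> x = c"
    using has_vector_derivative_zero_constant[of UNIV \<phi>] by (metis UNIV_I convex_UNIV)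
  then show ?thesis by simp
qed

text \<open>A sharp cut-off in frequency. For rapid \<open>q\<close> the function
  \<open>ift (band I q)\<close> is still smooth with bounded derivatives, hence an admissible
  multiplier.\<close>

definition band :: "real set \<Rightarrow> (real \<Rightarrow> complex) \<Rightarrow> real \<Rightarrow> complex" where
  "band I q t = indicator I t * q t"

lemma integrable_band:
  assumes "integrable lborel q" "I \<in> sets lborel"
  shows "integrable lborel (band I q)"
proof -
  have "(\<lambda>t. indicator I t *\<^sub>R q t) = band I q"
    by (auto simp: band_def fun_eq_iff split: split_indicator)
  with integrable_mult_indicator[OF assms(2,1)] show ?thesis by simp
qed

lemma rapid_band:
  assumes "rapid q" "I \<in> sets lborel"
  shows "rapid (band I q)"
proof -
  have "(\<lambda>t. freq t ^ k * band I q t) = band I (\<lambda>t. freq t ^ k * q t)" for k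
    by (auto simp: band_def)
  then show ?thesis
    unfolding rapid_def using integrable_band[OF rapidD[OF assms(1)] assms(2)] by simp
qed

lemma norm_nth_deriv_ift_band_le:
  assumes q: "rapid q" and I: "I \<in> sets lborel"
  shows "norm (nth_deriv k (ift (band I q)) x)
    \<le> (LINT t|lborel. norm (band I (\<lambda>t. freq t ^ k * q t) t))"
proof -
  have "(\<lambda>t. freq t ^ k * band I q t) = band I (\<lambda>t. freq t ^ k * q t)"
    by (auto simp: band_def)
  then show ?thesis
    unfolding nth_deriv_ift(1)[OF rapid_band[OF q I]]
    using norm_ift_le[OF integrable_band[OF rapidD[OF q, of k] I]] by simp
qed

lemma exp_growing_ift_band:
  assumes "rapid q" "I \<in> sets lborel"
  shows "exp_growing (ift (band I q))"
  by (rule exp_growingI[where R = "\<lambda>_. 0"])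
    (use norm_nth_deriv_ift_band_le[OF assms] nth_deriv_ift(2)[OF rapid_band[OF assms]] in auto)

text \<open>A short frequency band contributes, to first order, a multiple of a single wave. The
  weight exp |x| is needed because the Lipschitz constant in the frequency variable grows like
  |x|.\<close>

lemma band_deriv_estimate:
  assumes q: "q \<in> schwartz_space"
  shows "\<exists>L\<ge>0. \<forall>x s t. s \<le> t \<longrightarrow>
    norm (nth_deriv k (\<lambda>x. ift (band {s<..t} q) x - of_real (t - s) * q s * wave s x) x) \<le> L * (t - s)\<^sup>2 * exp (1 * \<bar>x\<bar>)"
proof -
  \<comment> \<open>Each derivative in x multiplies by \<open>freq\<close>; passing to
    \<open>p\<close> reduces the estimate to order zero.\<close>
  define p where "p = (xmul ^^ k) q"
  have p: "p \<in> schwartz_space" unfolding p_def by (rule schwartz_xmul_funpow[OF q])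
  have p_eq: "p t = freq t ^ k * q t" for t by (simp add: p_def xmul_funpow)
  obtain B0 B1 where B: "\<And>t. norm (p t) \<le> B0" "\<And>t. norm (nth_deriv 1 p t) \<le> B1"
    using schwartzD(2)[OF p, of 0 0] schwartzD(2)[OF p, of 0 1] by auto
  have B0: "0 \<le> B0" and B1: "0 \<le> B1"
    using order_trans[OF norm_ge_zero B(1)] order_trans[OF norm_ge_zero B(2)] by blast+
  define L where "L = 2 * pi * B0 + B1"
  have lip: "norm (wave x t * p t - wave x s * p s) \<le> (L * exp \<bar>x\<bar>) * \<bar>t - s\<bar>" for x s t
  proof (rule lipschitz_of_deriv_bound)
    show "((\<lambda>t. wave x t * p t) has_vector_derivative (wave x t * nth_deriv 1 p t + nth_deriv 1 (wave x) t * p t)) (at t)" for t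
      by (rule product_has_deriv[OF smooth_wave schwartzD(1)[OF p]])
    show "norm (wave x t * nth_deriv 1 p t + nth_deriv 1 (wave x) t * p t) \<le> L * exp \<bar>x\<bar>" for t
    proof -
      have "norm (wave x t * nth_deriv 1 p t + nth_deriv 1 (wave x) t * p t) \<le> norm (nth_deriv 1 p t) + 2 * pi * \<bar>x\<bar> * norm (p t)"
      proof -
        have "norm (nth_deriv 1 (wave x) t * p t) = 2 * pi * \<bar>x\<bar> * norm (p t)"
          unfolding nth_deriv_wave by (simp add: norm_mult)
        then show ?thesis
          using norm_triangle_ineq[of "wave x t * nth_deriv 1 p t" "nth_deriv 1 (wave x) t * p t"]
          by (simp only: norm_mult norm_wave)
      qed
      also have "\<dots> \<le> B1 * exp \<bar>x\<bar> + 2 * pi * exp \<bar>x\<bar> * B0"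
      proof (rule add_mono)
        have "norm (nth_deriv 1 p t) * 1 \<le> B1 * exp \<bar>x\<bar>" by (intro mult_mono B B1) auto
        then show "norm (nth_deriv 1 p t) \<le> B1 * exp \<bar>x\<bar>" by simp
        have "\<bar>x\<bar> \<le> exp \<bar>x\<bar>" using exp_ge_add_one_self[of "\<bar>x\<bar>"] by linarith
        then show "2 * pi * \<bar>x\<bar> * norm (p t) \<le> 2 * pi * exp \<bar>x\<bar> * B0"
          by (intro mult_mono B) auto
      qed
      finally show ?thesis by (simp add: L_def algebra_simps)
    qed
  qed
  have "norm (nth_deriv k (\<lambda>x. ift (band {s<..t} q) x - of_real (t - s) * q s * wave s x) x) \<le> L * (t - s)\<^sup>2 * exp (1 * \<bar>x\<bar>)"
    if st: "s \<le> t" for x s t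
  proof -
    note rq = schwartz_rapid[OF q]
    have I: "{s<..t} \<in> sets lborel" by simp
    let ?i = "\<lambda>\<tau>. indicator {s<..t} \<tau> :: real"
    have int_i: "integrable lborel ?i" and LINT_i: "(LINT \<tau>|lborel. ?i \<tau>) = t - s"
      using st by (auto simp: integrable_indicator_iff)
    have "nth_deriv k (\<lambda>x. ift (band {s<..t} q) x - of_real (t - s) * q s * wave s x) x
       = ift (band {s<..t} p) x - of_real (t - s) * (wave x s * p s)"
    proof -
      have "(\<lambda>t'. freq t' ^ k * band {s<..t} q t') = band {s<..t} p"
        by (auto simp: band_def p_eq)
      then have "nth_deriv k (ift (band {s<..t} q)) = ift (band {s<..t} p)"
        unfolding nth_deriv_ift(1)[OF rapid_band[OF rq I]] by simp
      moreover have "nth_deriv k (\<lambda>x. of_real (t - s) * q s * wave s x) x = of_real (t - s) * (wave x s * p s)"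
        by (simp add: nth_deriv_cmult(2)[OF smooth_wave] nth_deriv_wave p_eq wave_commute[of s x])
      ultimately show ?thesis
        by (subst nth_deriv_diff(2)[OF nth_deriv_ift(2)[OF rapid_band[OF rq I]] nth_deriv_cmult(1)[OF smooth_wave]]) simp
    qed
    also have "\<dots> = (LINT \<tau>|lborel. of_real (?i \<tau>) * (wave x \<tau> * p \<tau> - wave x s * p s))"
    proof -
      have ip: "integrable lborel (\<lambda>\<tau>. wave x \<tau> * band {s<..t} p \<tau>)"
        by (intro integrable_wave_mult integrable_band schwartz_integrable p I)
      have ic: "integrable lborel (\<lambda>\<tau>. complex_of_real (?i \<tau>) * (wave x s * p s))"
        by (intro integrable_mult_left integrable_of_real int_i)
      have c: "(LINT \<tau>|lborel. complex_of_real (?i \<tau>) * (wave x s * p s)) = of_real (t - s) * (wave x s * p s)"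
        by (simp only: integral_mult_left_zero integral_complex_of_real LINT_i)
      have "ift (band {s<..t} p) x - of_real (t - s) * (wave x s * p s)
         = (LINT \<tau>|lborel. wave x \<tau> * band {s<..t} p \<tau> - complex_of_real (?i \<tau>) * (wave x s * p s))"
        unfolding ift_def by (simp only: Bochner_Integration.integral_diff[OF ip ic] c)
      also have "\<dots> = (LINT \<tau>|lborel. of_real (?i \<tau>) * (wave x \<tau> * p \<tau> - wave x s * p s))"
        by (intro Bochner_Integration.integral_cong refl) (auto simp: band_def split: split_indicator)
      finally show ?thesis .
    qed
    also have "norm \<dots> \<le> (LINT \<tau>|lborel. ?i \<tau> * ((L * exp \<bar>x\<bar>) * (t - s)))"
    proof (rule Bochner_Integration.integral_norm_bound_integral)
      show "integrable lborel (\<lambda>\<tau>. ?i \<tau> * ((L * exp \<bar>x\<bar>) * (t - s)))"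
        by (intro integrable_mult_left int_i)
      have "integrable lborel (\<lambda>\<tau>. wave x \<tau> * band {s<..t} p \<tau> - complex_of_real (?i \<tau>) * (wave x s * p s))"
        by (intro Bochner_Integration.integrable_diff integrable_wave_mult integrable_band schwartz_integrable p I
            integrable_mult_left integrable_of_real int_i)
      also have "(\<lambda>\<tau>. wave x \<tau> * band {s<..t} p \<tau> - complex_of_real (?i \<tau>) * (wave x s * p s))
          = (\<lambda>\<tau>. of_real (?i \<tau>) * (wave x \<tau> * p \<tau> - wave x s * p s))"
        by (auto simp: band_def fun_eq_iff split: split_indicator)
      finally show "integrable lborel \<dots>" .
      fix \<tau>
      show "norm (of_real (?i \<tau>) * (wave x \<tau> * p \<tau> - wave x s * p s)) \<le> ?i \<tau> * ((L * exp \<bar>x\<bar>) * (t - s))"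
      proof (cases "\<tau> \<in> {s<..t}")
        case True
        have "norm (wave x \<tau> * p \<tau> - wave x s * p s) \<le> (L * exp \<bar>x\<bar>) * \<bar>\<tau> - s\<bar>" by (rule lip)
        also have "\<dots> \<le> (L * exp \<bar>x\<bar>) * (t - s)"
          using True B0 B1 by (intro mult_left_mono) (auto simp: L_def)
        finally show ?thesis using True by simp
      qed simp
    qed
    also have "\<dots> = L * (t - s)\<^sup>2 * exp (1 * \<bar>x\<bar>)"
      using LINT_i int_i by (simp add: power2_eq_square)
    finally show ?thesis .
  qed
  moreover have "0 \<le> L" using B0 B1 by (simp add: L_def)
  ultimately show ?thesis by blast
qed

text \<open>With \<open>u\<close> written as a superposition of waves, the part of \<open>T (u g)\<close> coming from frequencies
  up to \<open>t\<close> has zero derivative in \<open>t\<close>; this replaces interchanging \<open>T\<close> with the Fourier integral.\<close>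
lemma zero_on_multiples_of_test_function:
  assumes lin: "complex_linear_on schwartz_space T" and bd: "schwartz_bounded T M C" "0 \<le> C"
    and g: "exp_decaying g" and zero: "\<And>s. T (\<lambda>x. wave s x * g x) = 0"
    and u: "u \<in> schwartz_space"
  shows "T (\<lambda>x. u x * g x) = 0"
proof -
  define q where "q = fourier u"
  have q: "q \<in> schwartz_space" unfolding q_def by (rule schwartz_fourier[OF u])
  note rq = schwartz_rapid[OF q]
  have u_eq: "u x = ift q x" for x unfolding q_def by (rule ift_fourier[OF u, symmetric])
  define G where "G I = ift (band I q)" for I
  have Gg: "exp_growing (G I)" if "I \<in> sets lborel" for I
    unfolding G_def by (rule exp_growing_ift_band[OF rq that])
  have GS: "(\<lambda>x. w x * g x) \<in> schwartz_space" if "exp_growing w" for w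
    by (rule exp_growing_mult_decaying_schwartz[OF that g])
  have G_diff: "G I x - G J x = G (I - J) x" if "I \<in> sets lborel" "J \<in> sets lborel" "J \<subseteq> I" for I J x
  proof -
    have "band (I - J) q = (\<lambda>t. band I q t - band J q t)"
      using that(3) by (auto simp: band_def fun_eq_iff split: split_indicator)
    then show ?thesis
      unfolding G_def using ift_diff[OF integrable_band integrable_band, OF rapid_integrable[OF rq] that(1) rapid_integrable[OF rq] that(2)]
      by simp
  qed
  have T_diff: "T (\<lambda>x. G I x * g x) - T (\<lambda>x. G J x * g x) = T (\<lambda>x. G (I - J) x * g x)"
    if "I \<in> sets lborel" "J \<in> sets lborel" "J \<subseteq> I" for I J
    using linear_diff[OF lin GS[OF Gg[OF that(1)]] GS[OF Gg[OF that(2)]] schwartz_cmult[OF GS[OF Gg[OF that(2)]]]]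
    by (simp add: left_diff_distrib[symmetric] G_diff[OF that])
  define \<Phi> where "\<Phi> t = T (\<lambda>x. G {..t} x * g x)" for t
  obtain l where l: "\<And>k. 0 \<le> l k" "\<And>k x s t. s \<le> t \<Longrightarrow>
    norm (nth_deriv k (\<lambda>x. ift (band {s<..t} q) x - of_real (t - s) * q s * wave s x) x) \<le> l k * (t - s)\<^sup>2 * exp (1 * \<bar>x\<bar>)"
    using band_deriv_estimate[OF q] by metis
  define L where "L = (\<Sum>k\<le>M. l k)"
  obtain K where K: "multiplier_bound T M g 1 K"
    using exists_multiplier_bound[OF bd g] by blast
  have "norm (\<Phi> t - \<Phi> s) \<le> (K * L) * (t - s)\<^sup>2" if st: "s \<le> t" for s t
  proof -
    \<comment> \<open>\<open>T\<close> vanishes on the subtracted wave by \<open>zero\<close>, so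
      only a multiplier of size (t - s)^2 remains.\<close>
    define w where "w x = ift (band {s<..t} q) x - of_real (t - s) * q s * wave s x" for x
    have wg: "exp_growing w"
      unfolding w_def[abs_def] using Gg[of "{s<..t}", unfolded G_def]
      by (intro exp_growing_diff exp_growing_cmult exp_growing_wave) auto
    have wave_S: "(\<lambda>x. wave s x * g x) \<in> schwartz_space" by (rule GS[OF exp_growing_wave])
    have "{..t} - {..s} = {s<..t}" by auto
    then have "\<Phi> t - \<Phi> s = T (\<lambda>x. G {s<..t} x * g x)"
      unfolding \<Phi>_def using st by (subst T_diff) auto
    also have "(\<lambda>x. G {s<..t} x * g x) = (\<lambda>x. w x * g x + (of_real (t - s) * q s) * (wave s x * g x))"
      by (auto simp: G_def w_def algebra_simps)
    also have "T \<dots> = T (\<lambda>x. w x * g x) + (of_real (t - s) * q s) * T (\<lambda>x. wave s x * g x)"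
      by (simp only: linear_add[OF lin GS[OF wg] schwartz_cmult[OF wave_S]] linear_cmult[OF lin wave_S])
    also have "\<dots> = T (\<lambda>x. w x * g x)" by (simp add: zero)
    also have "norm \<dots> \<le> K * (L * (t - s)\<^sup>2)"
    proof (rule multiplier_boundD[OF K wg])
      fix k x assume "k \<le> M"
      then have "l k \<le> L" unfolding L_def using l(1) by (intro member_le_sum) auto
      then have "l k * (t - s)\<^sup>2 * exp (1 * \<bar>x\<bar>) \<le> L * (t - s)\<^sup>2 * exp (1 * \<bar>x\<bar>)"
        by (intro mult_right_mono) auto
      with l(2)[OF st] show "norm (nth_deriv k w x) \<le> L * (t - s)\<^sup>2 * exp (1 * \<bar>x\<bar>)"
        unfolding w_def[abs_def] by (rule order_trans)
    qed
    finally show ?thesis by (simp add: mult.assoc)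
  qed
  then have const: "\<Phi> s = \<Phi> t" for s t by (rule constant_of_quadratic_bound)
  obtain K0 where K0: "multiplier_bound T M g 0 K0"
    using exists_multiplier_bound[OF bd g] by blast
  \<comment> \<open>The frequencies outside (-n, n] enter through these L^1 tails alone, and the
    tails tend to zero by dominated convergence.\<close>
  define c where "c k n = (LINT t|lborel. norm (band (- {- real n<..real n}) (\<lambda>t. freq t ^ k * q t) t))" for k n
  have c_nonneg: "0 \<le> c k n" for k n unfolding c_def by simp
  have le: "norm (T (\<lambda>x. u x * g x)) \<le> K0 * (\<Sum>k\<le>M. c k n)" for n
  proof -
    have eq: "{..real n} - {..- real n} = {- real n<..real n}" "UNIV - {- real n<..real n} = - {- real n<..real n}" by auto
    have "T (\<lambda>x. G {- real n<..real n} x * g x) = \<Phi> (real n) - \<Phi> (- real n)"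
      unfolding \<Phi>_def by (subst T_diff) (auto simp: eq)
    also have "\<dots> = 0" using const[of "real n" "- real n"] by simp
    finally have "T (\<lambda>x. G {- real n<..real n} x * g x) = 0" .
    moreover have "band UNIV q = q" by (auto simp: band_def)
    then have "u = G UNIV" by (auto simp: G_def u_eq)
    ultimately have "T (\<lambda>x. u x * g x) = T (\<lambda>x. G (- {- real n<..real n}) x * g x)"
      using T_diff[of UNIV "{- real n<..real n}"] by (simp add: eq)
    also have "norm \<dots> \<le> K0 * (\<Sum>k\<le>M. c k n)"
    proof (rule multiplier_boundD[OF K0 Gg], simp)
      fix k x assume k: "k \<le> M"
      have "norm (nth_deriv k (G (- {- real n<..real n})) x) \<le> c k n"
        unfolding G_def c_def by (rule norm_nth_deriv_ift_band_le[OF rq]) simp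
      also have "\<dots> \<le> (\<Sum>k\<le>M. c k n)" using k by (intro member_le_sum) (auto simp: c_nonneg)
      finally show "norm (nth_deriv k (G (- {- real n<..real n})) x) \<le> (\<Sum>k\<le>M. c k n) * exp (0 * \<bar>x\<bar>)" by simp
    qed
    finally show ?thesis .
  qed
  have "(\<lambda>n. c k n) \<longlonglongrightarrow> 0" for k
  proof -
    let ?p = "\<lambda>t. freq t ^ k * q t"
    note ip = rapidD[OF rq, of k]
    have "(\<lambda>n. c k n) \<longlonglongrightarrow> (LINT t|(lborel :: real measure). (0::real))"
      unfolding c_def
    proof (rule integral_dominated_convergence[where w = "\<lambda>t. norm (?p t)"])
      show "integrable lborel (\<lambda>t. norm (?p t))" by (rule integrable_norm[OF ip])
      show "(\<lambda>t. norm (band (- {- real n<..real n}) ?p t)) \<in> borel_measurable lborel" for n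
        by (intro borel_measurable_integrable integrable_norm integrable_band[OF ip]) simp
      show "AE t in lborel. norm (norm (band (- {- real n<..real n}) ?p t)) \<le> norm (?p t)" for n
        by (intro AE_I2) (auto simp: band_def split: split_indicator)
      show "AE t in lborel. (\<lambda>n. norm (band (- {- real n<..real n}) ?p t)) \<longlonglongrightarrow> 0"
      proof (rule AE_I2)
        fix t
        obtain N :: nat where N: "\<bar>t\<bar> < real N" using reals_Archimedean2 by blast
        have "eventually (\<lambda>n. norm (band (- {- real n<..real n}) ?p t) = 0) sequentially"
          using eventually_ge_at_top[of N]
        proof eventually_elim
          case (elim n)
          then have "\<bar>t\<bar> < real n" using N by linarith
          then have "t \<notin> - {- real n<..real n}" by auto
          then show ?case by (simp only: band_def indicator_simps) simp
        qed
        then show "(\<lambda>n. norm (band (- {- real n<..real n}) ?p t)) \<longlonglongrightarrow> 0" by (rule tendsto_eventually)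
      qed
    qed simp
    then show ?thesis by simp
  qed
  then have "(\<lambda>n. K0 * (\<Sum>k\<le>M. c k n)) \<longlonglongrightarrow> K0 * (\<Sum>k\<le>M. 0)"
    by (intro tendsto_intros)
  then have "norm (T (\<lambda>x. u x * g x)) \<le> K0 * (\<Sum>k\<le>M. 0)"
    by (rule LIMSEQ_le_const) (use le in blast)
  then show ?thesis by simp
qed

section \<open>Division by the flat function\<close>

text \<open>When the support of \<open>f\<close> avoids the integers, this class is closed under
  differentiation and contains the quotient of \<open>f\<close> by \<open>flat_weight\<close>. The
  value 0 at the integers is then the right one, as \<open>f\<close> vanishes near them.\<close>

inductive_set flat_quotients :: "(real \<Rightarrow> complex) \<Rightarrow> (real \<Rightarrow> complex) set" for f where
  base: "p \<in> trig_algebra \<Longrightarrow>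
    (\<lambda>x. if x \<in> \<int> then 0 else nth_deriv k f x * (p x * of_real (inverse (flat_weight x)))) \<in> flat_quotients f"
| add: "a \<in> flat_quotients f \<Longrightarrow> b \<in> flat_quotients f \<Longrightarrow> (\<lambda>x. a x + b x) \<in> flat_quotients f"

lemma nth_deriv_zero_outside_support:
  assumes f: "smooth f" and x: "x \<notin> closure {x. f x \<noteq> 0}"
  shows "nth_deriv k f x = 0"
  using x
proof (induction k arbitrary: x)
  case 0
  then show ?case using closure_subset[of "{x. f x \<noteq> 0}"] by auto
next
  case (Suc k)
  have "((\<lambda>x. 0) has_vector_derivative nth_deriv (Suc k) f x) (at x)"
    by (rule has_vector_derivative_transform_within_open[OF smooth_has_deriv[OF f, of k x], of "- closure {x. f x \<noteq> 0}"])
      (use Suc in \<open>auto simp: open_Compl\<close>)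
  from vector_derivative_at[OF this] show ?case by simp
qed

lemma flat_quotients_deriv:
  assumes f: "smooth f" and supp: "closure {x. f x \<noteq> 0} \<subseteq> - \<int>" and a: "a \<in> flat_quotients f"
  shows "\<exists>b\<in>flat_quotients f. \<forall>x. (a has_vector_derivative b x) (at x)"
  using a
proof induction
  case (base p k)
  obtain p' where p': "p' \<in> trig_algebra" "\<And>x. x \<notin> \<int> \<Longrightarrow> (p has_vector_derivative p' x) (at x)"
    using trig_algebra_deriv[OF base] by blast
  \<comment> \<open>The derivative of p / flat_weight is (p' - flat_log_deriv p) / flat_weight; the
    sign is written as a constant factor to match the rules of \<open>trig_algebra\<close>.\<close>
  define r where "r x = p' x + (-1) * (of_real (flat_log_deriv x) * p x)" for x
  have r: "r \<in> trig_algebra"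
    unfolding r_def[abs_def] by (intro trig_algebra.intros p' base flat_log_deriv_trig_algebra)
  let ?a = "\<lambda>x. if x \<in> \<int> then 0 else nth_deriv k f x * (p x * of_real (inverse (flat_weight x)))"
  let ?b = "\<lambda>x. (if x \<in> \<int> then 0 else nth_deriv k f x * (r x * of_real (inverse (flat_weight x))))
      + (if x \<in> \<int> then 0 else nth_deriv (Suc k) f x * (p x * of_real (inverse (flat_weight x))))"
  have "(?a has_vector_derivative ?b x) (at x)" for x
  proof (cases "x \<in> \<int>")
    case False
    have w: "flat_weight x \<noteq> 0" by (simp add: flat_weight_def)
    have "((\<lambda>x. inverse (flat_weight x)) has_real_derivative - (flat_log_deriv x * inverse (flat_weight x))) (at x)"
      using DERIV_inverse'[OF flat_weight_has_deriv[OF False] w] w by (simp add: mult_ac)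
    note e = of_real_has_vector_derivative[OF this]
    from has_vector_derivative_mult[OF smooth_has_deriv[OF f, of k x] has_vector_derivative_mult[OF p'(2)[OF False] e]]
    have "((\<lambda>x. nth_deriv k f x * (p x * of_real (inverse (flat_weight x)))) has_vector_derivative ?b x) (at x)"
      using False by (simp add: r_def algebra_simps)
    then show ?thesis
      by (rule has_vector_derivative_transform_within_open[of _ _ _ "- \<int>"])
        (use False in \<open>auto simp: closed_of_int_image open_Compl\<close>)
  next
    case True
    have "((\<lambda>x. 0) has_vector_derivative ?b x) (at x)" using True by simp
    then show ?thesis
      by (rule has_vector_derivative_transform_within_open[of _ _ _ "- closure {x. f x \<noteq> 0}"])
        (use True supp nth_deriv_zero_outside_support[OF f] in \<open>auto simp: open_Compl\<close>)
  qed
  moreover have "?b \<in> flat_quotients f"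
    by (intro flat_quotients.intros r base)
  ultimately show ?case by (intro bexI[of _ ?b] allI)
next
  case (add a b)
  then obtain a' b' where "a' \<in> flat_quotients f" "b' \<in> flat_quotients f"
    "\<forall>x. (a has_vector_derivative a' x) (at x)" "\<forall>x. (b has_vector_derivative b' x) (at x)" by blast
  then show ?case
    by (intro bexI[of _ "\<lambda>x. a' x + b' x"]) (auto intro!: derivative_intros flat_quotients.add)
qed

lemma flat_quotients_zero_outside_support:
  assumes "smooth f" "a \<in> flat_quotients f" "x \<notin> closure {x. f x \<noteq> 0}"
  shows "a x = 0"
  using assms(2) by induction (auto simp: nth_deriv_zero_outside_support[OF assms(1,3)])

text \<open>The flat function is positive off the integers, so the quotient is smooth. It inherits
  the compact support of \<open>f\<close>, and continuity on that compact set bounds all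
  seminorms.\<close>

lemma schwartz_flat_quotient:
  assumes f: "f \<in> schwartz_space" and comp: "compact (closure {x. f x \<noteq> 0})"
    and supp: "closure {x. f x \<noteq> 0} \<subseteq> - \<int>"
  shows "\<exists>u\<in>schwartz_space. \<forall>x. f x = u x * flat_fun (xpow 0) x"
proof -
  note sf = schwartzD(1)[OF f]
  \<comment> \<open>\<open>nth_deriv 0 f\<close> and the factor 1 put the quotient into the form of
    \<open>flat_quotients.base\<close> with p = 1.\<close>
  define u where "u x = (if x \<in> \<int> then 0 else nth_deriv 0 f x * (1 * of_real (inverse (flat_weight x))))" for x
  have u: "u \<in> flat_quotients f"
    unfolding u_def[abs_def] by (rule flat_quotients.base[OF trig_algebra.const])
  have *: "smooth u \<and> nth_deriv k u \<in> flat_quotients f" for k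
    by (rule nth_deriv_closed_set[OF u flat_quotients_deriv[OF sf supp]])
  have "u \<in> schwartz_space"
    unfolding schwartz_space_iff
  proof (intro conjI allI)
    show su: "smooth u" using * by blast
    fix m k
    have "continuous_on (closure {x. f x \<noteq> 0}) (\<lambda>x. \<bar>x\<bar> ^ m * norm (nth_deriv k u x))"
      by (intro continuous_intros smooth_continuous smooth_nth_deriv su)
    from compact_imp_bounded[OF compact_continuous_image[OF this comp]]
    obtain B where B: "\<And>x. x \<in> closure {x. f x \<noteq> 0} \<Longrightarrow> norm (\<bar>x\<bar> ^ m * norm (nth_deriv k u x)) \<le> B"
      unfolding bounded_iff by blast
    have "\<bar>x\<bar> ^ m * norm (nth_deriv k u x) \<le> \<bar>B\<bar>" for x
    proof (cases "x \<in> closure {x. f x \<noteq> 0}")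
      case True
      then show ?thesis using B[OF True] by simp
    next
      case False
      have "nth_deriv k u x = 0"
        by (rule flat_quotients_zero_outside_support[OF sf _ False]) (use * in blast)
      then show ?thesis by simp
    qed
    then show "\<exists>B. \<forall>x. \<bar>x\<bar> ^ m * norm (nth_deriv k u x) \<le> B" by blast
  qed
  moreover have "f x = u x * flat_fun (xpow 0) x" for x
  proof (cases "x \<in> \<int>")
    case True
    then show ?thesis using nth_deriv_zero_outside_support[OF sf, of x 0] supp by (auto simp: u_def)
  next
    case False
    have "flat_weight x \<noteq> 0" by (simp add: flat_weight_def)
    with False show ?thesis by (simp add: u_def flat_fun_def xpow_def)
  qed
  ultimately show ?thesis by blast
qed

section \<open>The spanning theorem\<close>

text \<open>The induction for the moments runs over all integers at once, and its outcome is then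
  used at 0: the moments there determine T (wave s psi) for every s. Test functions supported off
  the integers are multiples of psi, so \<open>T\<close> vanishes on them.\<close>

lemma flat_uniqueness:
  assumes lin: "complex_linear_on schwartz_space T" and bd: "schwartz_bounded T M C" "0 \<le> C"
    and a: "\<And>n. a n \<noteq> 0" "\<And>n. \<bar>a n\<bar> < A * r ^ nat \<bar>n\<bar>" and r: "0 < r" "r < 1"
    and zero: "\<And>n. T (\<lambda>x. wave (of_int n + a n) x * flat_fun (xpow 0) x) = 0"
  shows "distr_support T \<subseteq> \<int>"
proof -
  have "T (flat_fun (xpow j)) = 0" for j
    using flat_moments_zero[where T = T and a = a and J = j and n = 0, OF lin bd a r zero] by simp
  from flat_transform_zero[OF lin bd this]
  have wave_zero: "T (\<lambda>x. wave s x * flat_fun (xpow 0) x) = 0" for s .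
  have "vanishes_on T (- \<int>)"
    unfolding vanishes_on_def
  proof (intro ballI impI)
    fix f assume f: "f \<in> schwartz_space" "compact (closure {x. f x \<noteq> 0}) \<and> closure {x. f x \<noteq> 0} \<subseteq> - \<int>"
    then obtain u where u: "u \<in> schwartz_space" "\<And>x. f x = u x * flat_fun (xpow 0) x"
      using schwartz_flat_quotient[of f] by blast
    have "f = (\<lambda>x. u x * flat_fun (xpow 0) x)" using u(2) by auto
    then show "T f = 0"
      using zero_on_multiples_of_test_function[OF lin bd flat_exp_decaying[OF xpow_trig_algebra] wave_zero u(1)] by simp
  qed
  moreover have "open (- \<int> :: real set)" by (simp add: open_Compl)
  ultimately show ?thesis unfolding distr_support_def by blast
qed

lemma translate_ift:
  "ift g (t - l) = ift (\<lambda>x. wave (- l) x * g x) t"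
proof -
  have "wave (t - l) x = wave t x * wave (- l) x" for x
    using wave_add[of t "- l" x] by simp
  then show ?thesis unfolding ift_def by (simp add: mult.assoc)
qed

theorem theorem3:
  fixes X :: "(real \<Rightarrow> complex) set" and N :: "(real \<Rightarrow> complex) \<Rightarrow> real"
  assumes "banach_function_space X N"
    and "schwartz_continuously_embedded X N"
    and "dense_in_space X N schwartz_space"
    and "\<And>h. h \<in> dual_space X N \<Longrightarrow> spectrum_on h \<int> \<Longrightarrow> (\<forall>f\<in>X. h f = 0)"
  shows "\<exists>\<phi>\<in>schwartz_space. \<forall>\<Lambda>. exp_small_perturbation \<Lambda> \<longrightarrow>
           spans_space X N {\<lambda>t. \<phi> (t - l) | l. l \<in> \<Lambda>}"
proof -
  interpret banach_function_space X N by (rule assms(1))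
  define \<psi> where "\<psi> = flat_fun (xpow 0)"
  have \<psi>S: "\<psi> \<in> schwartz_space"
    unfolding \<psi>_def by (intro exp_decaying_schwartz flat_exp_decaying xpow_trig_algebra)
  have wave_S: "(\<lambda>x. wave s x * \<psi> x) \<in> schwartz_space" for s
    unfolding \<psi>_def by (intro wave_flat_schwartz xpow_trig_algebra)
  have SX: "schwartz_space \<subseteq> X" and emb: "continuous_map schwartz_topology (norm_topology X N) (\<lambda>f. f)"
    using assms(2) by (auto simp: schwartz_continuously_embedded_def)
  have trans: "(\<lambda>t. ift \<psi> (t - l)) = ift (\<lambda>x. wave (- l) x * \<psi> x)" for l
    by (rule ext) (rule translate_ift)
  show ?thesis
  proof (intro bexI[of _ "ift \<psi>"] allI impI)
    show "ift \<psi> \<in> schwartz_space" by (rule schwartz_ift[OF \<psi>S])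
    fix \<Lambda> assume "exp_small_perturbation \<Lambda>"
    then obtain a C r where a: "\<And>n. a n \<noteq> 0" "\<And>n. \<bar>a n\<bar> < C * r ^ nat \<bar>n\<bar>" and r: "0 < r" "r < 1"
      and \<Lambda>: "\<Lambda> = {of_int n + a n | n. True}"
      unfolding exp_small_perturbation_def by blast
    show "spans_space X N {\<lambda>t. ift \<psi> (t - l) | l. l \<in> \<Lambda>}"
    proof (rule spans_spaceI)
      show "{\<lambda>t. ift \<psi> (t - l) | l. l \<in> \<Lambda>} \<subseteq> X"
        using SX schwartz_ift[OF wave_S] by (auto simp: trans)
      fix h f assume h: "h \<in> dual_space X N" and ann: "\<forall>g\<in>{\<lambda>t. ift \<psi> (t - l) | l. l \<in> \<Lambda>}. h g = 0" and f: "f \<in> X"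
      have hlin: "complex_linear_on schwartz_space h"
        using h SX unfolding dual_space_def complex_linear_on_def by blast
      have "continuous_map schwartz_topology euclidean (h \<circ> (\<lambda>f. f))"
        using h by (intro continuous_map_compose[OF emb]) (simp add: dual_space_def)
      then obtain M C0 where C0: "0 \<le> C0" "schwartz_bounded h M C0"
        using continuous_imp_schwartz_bounded[OF hlin] by (auto simp: o_def)
      \<comment> \<open>By Fourier inversion \<open>h\<close> is the Fourier transform of this
        \<open>T\<close>, so the support of \<open>T\<close> is the one that
        \<open>spectrum_on\<close> asks for.\<close>
      define T where "T g = h (ift g)" for g
      have lin: "complex_linear_on schwartz_space T"
        unfolding complex_linear_on_def T_def
      proof (intro conjI ballI allI)
        fix f g assume fg: "f \<in> schwartz_space" "g \<in> schwartz_space"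
        then have "ift (\<lambda>x. f x + g x) = (\<lambda>x. ift f x + ift g x)"
          by (auto intro: ift_add schwartz_integrable)
        then show "h (ift (\<lambda>x. f x + g x)) = h (ift f) + h (ift g)"
          using linear_add[OF hlin schwartz_ift schwartz_ift] fg by simp
      next
        fix c f assume "f \<in> schwartz_space"
        moreover have "ift (\<lambda>x. c * f x) = (\<lambda>x. c * ift f x)" by (auto simp: ift_cmult)
        ultimately show "h (ift (\<lambda>x. c * f x)) = c * h (ift f)"
          using linear_cmult[OF hlin schwartz_ift] by simp
      qed
      obtain K where K: "\<And>f B. f \<in> schwartz_space \<Longrightarrow> schwartz_le (2 * M + 2) f B \<Longrightarrow> schwartz_le M (ift f) (K * B)"
        using schwartz_le_ift[of M] by blast
      have "schwartz_bounded T (2 * M + 2) (C0 * \<bar>K\<bar>)"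
        unfolding schwartz_bounded_iff
      proof (intro ballI allI impI)
        fix f B assume fB: "f \<in> schwartz_space" "schwartz_le (2 * M + 2) f B"
        have "norm (T f) \<le> C0 * (K * B)"
          unfolding T_def using C0(2) schwartz_ift[OF fB(1)] K[OF fB] unfolding schwartz_bounded_iff by blast
        also have "\<dots> \<le> C0 * (\<bar>K\<bar> * B)"
          using C0(1) schwartz_le_nonneg[OF fB(2)] by (intro mult_left_mono mult_right_mono) auto
        finally show "norm (T f) \<le> C0 * \<bar>K\<bar> * B" by (simp add: mult.assoc)
      qed
      note bd = this
      have "distr_support T \<subseteq> \<int>"
      \<comment> \<open>Translation by l becomes multiplication by \<open>wave (- l)\<close>, which
        places the zeros at - l. Replacing n by - n brings them into the required form with
        perturbation \<open>- a (- n)\<close>.\<close>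
      proof (rule flat_uniqueness[OF lin bd _ _ _ r])
        show "0 \<le> C0 * \<bar>K\<bar>" using C0 by simp
        fix n :: int
        show "- a (- n) \<noteq> 0" using a(1) by simp
        show "\<bar>- a (- n)\<bar> < C * r ^ nat \<bar>n\<bar>" using a(2)[of "- n"] by simp
        have "of_int (- n) + a (- n) \<in> \<Lambda>" using \<Lambda> by blast
        then have "h (\<lambda>t. ift \<psi> (t - (of_int (- n) + a (- n)))) = 0" using ann by blast
        then have "h (ift (\<lambda>x. wave (- (of_int (- n) + a (- n))) x * \<psi> x)) = 0" unfolding trans .
        then show "T (\<lambda>x. wave (of_int n + - a (- n)) x * flat_fun (xpow 0) x) = 0"
          by (simp add: T_def \<psi>_def)
      qed
      moreover have "h g = fourier_distr T g" if "g \<in> schwartz_space" for g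
      proof -
        have "ift (fourier g) = g" by (rule ext) (rule ift_fourier[OF that])
        then show ?thesis by (simp add: fourier_distr_def T_def)
      qed
      ultimately have "spectrum_on h \<int>"
        unfolding spectrum_on_def using schwartz_bounded_imp_tempered[OF lin bd] by blast
      with assms(4)[OF h] f show "h f = 0" by blast
    qed
  qed
qed

end
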